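(* Let $\mathbb F$ be a field of characteristic $0$ and let $\mathtt g=\mathtt g(\mathfrak A)$ be the Kac-Moody Lie algebra over $\mathbb F$ corresponding to the indecomposable generalized Cartan matrix $\mathfrak A$, where indecomposable means that, after possibly renumbering the indices, $a_{1,2}a_{2,3}\cdots a_{n-1,n}\neq 0$. Then $\mathtt g^{(1)}=[\mathtt g,\mathtt g]$ is central (i.e. $\operatorname{Cent}(\mathtt g^{(1)})=\mathbb F\,\mathrm{id}$), and $$\operatorname{Cent}(\mathtt g)=\mathbb F\,\mathrm{id}\oplus\operatorname{Hom}_{\mathbb F}\bigl(\mathtt g/\mathtt g^{(1)},\,\mathcal C_{\mathtt g}(\mathtt g^{(1)})\bigr),$$ where an element of the second summand is viewed as an endomorphism of $\mathtt g$ by composing with the projection $\mathtt g\to\mathtt g/\mathtt g^{(1)}$ and the inclusion $\mathcal C_{\mathtt g}(\mathtt g^{(1)})\subseteq \mathtt g$.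
   Context: For a Lie algebra $\mathcal L$ over $\mathbb F$, $\operatorname{Cent}(\mathcal L)=\{\chi\in\operatorname{End}_{\mathbb F}(\mathcal L)\mid\chi([x,y])=[x,\chi(y)]\ \forall x,y\in\mathcal L\}$; for $\mathcal B\subseteq\mathcal L$, $\mathcal C_{\mathcal L}(\mathcal B)=\{z\in\mathcal L\mid[z,\mathcal B]=0\}$. $\mathfrak A=(a_{i,j})_{i,j=1}^n$ is a generalized Cartan matrix of rank $\ell$: $a_{i,i}=2$ for all $i$, $a_{i,j}$ is a nonpositive integer for $i\ne j$, and $a_{i,j}=0$ if and only if $a_{j,i}=0$. A realization of $\mathfrak A$ is a triple $(\mathfrak h,\Pi,\Pi^\vee)$ with $\mathfrak h$ an $\mathbb F$-vector space of dimension $2n-\ell$ and linearly independent subsets $\Pi=\{\alpha_1,\dots,\alpha_n\}\subset\mathfrak h^*$, $\Pi^\vee=\{\alpha_1^\vee,\dots,\alpha_n^\vee\}\subset\mathfrak h$ with $\langle\alpha_i|\alpha_j^\vee\rangle=a_{j,i}$. The Kac-Moody Lie algebra $\mathtt g(\mathfrak A)$ is the Lie algebra over $\mathbb F$ generated by $\mathfrak h$ and $e_i,f_i$ ($1\le i\le n$) with defining relations $[e_i,f_j]=\delta_{i,j}\alpha_i^\vee$; $[h,h']=0$; $[h,e_i]=\langle\alpha_i|h\rangle e_i$, $[h,f_i]=-\langle\alpha_i|h\rangle f_i$ for $h,h'\in\mathfrak h$; and $(\operatorname{ad}e_i)^{1-a_{i,j}}e_j=0=(\operatorname{ad}f_i)^{1-a_{i,j}}f_j$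 for $i\neq j$. *)

theory Defs
  imports "HOL-Analysis.Analysis" "HOL-Library.FuncSet" "HOL-Library.Function_Algebras"
begin

section \<open>Lie algebras, derived algebra, centralizer, centroid\<close>

text \<open>A Lie algebra is a type \<open>'g\<close> with a scalar multiplication \<open>s\<close> over the field \<open>'f\<close> and a
  bracket \<open>b\<close>. Subalgebras are subsets of \<open>'g\<close>.\<close>

locale lie_algebra = vector_space s
  for s :: "'f::field \<Rightarrow> 'g::ab_group_add \<Rightarrow> 'g" +
  fixes b :: "'g \<Rightarrow> 'g \<Rightarrow> 'g"
  assumes bracket_linear_right: "Vector_Spaces.linear s s (b x)"
    and bracket_linear_left: "Vector_Spaces.linear s s (\<lambda>x. b x y)"
    and bracket_self: "b x x = 0"
    and jacobi: "b x (b y z) + b y (b z x) + b z (b x y) = 0"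

definition derived_algebra ::
  "('f::field \<Rightarrow> 'g::ab_group_add \<Rightarrow> 'g) \<Rightarrow> ('g \<Rightarrow> 'g \<Rightarrow> 'g) \<Rightarrow> 'g set" where
  "derived_algebra s b = module.span s {b x y | x y. True}"

definition lie_centralizer :: "('g::ab_group_add \<Rightarrow> 'g \<Rightarrow> 'g) \<Rightarrow> 'g set \<Rightarrow> 'g set" where
  "lie_centralizer b B = {z. \<forall>x\<in>B. b z x = 0}"

text \<open>For a subspace \<open>L\<close>, linear endomorphisms of \<open>L\<close> are represented by functions on \<open>'g\<close> that
  are \<open>undefined\<close> outside \<open>L\<close>, so that equality of functions is equality of endomorphisms
  of \<open>L\<close>. For \<open>L = UNIV\<close> these are just the linear maps on \<open>'g\<close>.\<close>

definition linear_endos ::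
  "('f::field \<Rightarrow> 'g::ab_group_add \<Rightarrow> 'g) \<Rightarrow> 'g set \<Rightarrow> ('g \<Rightarrow> 'g) set" where
  "linear_endos s L = {\<psi> \<in> L \<rightarrow>\<^sub>E L.
     (\<forall>x\<in>L. \<forall>y\<in>L. \<psi> (x + y) = \<psi> x + \<psi> y) \<and> (\<forall>c. \<forall>x\<in>L. \<psi> (s c x) = s c (\<psi> x))}"

definition lie_centroid ::
  "('f::field \<Rightarrow> 'g::ab_group_add \<Rightarrow> 'g) \<Rightarrow> ('g \<Rightarrow> 'g \<Rightarrow> 'g) \<Rightarrow> 'g set \<Rightarrow> ('g \<Rightarrow> 'g) set" where
  "lie_centroid s b L = {\<psi> \<in> linear_endos s L. \<forall>x\<in>L. \<forall>y\<in>L. \<psi> (b x y) = b x (\<psi> y)}"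

definition scalar_endos ::
  "('f::field \<Rightarrow> 'g::ab_group_add \<Rightarrow> 'g) \<Rightarrow> 'g set \<Rightarrow> ('g \<Rightarrow> 'g) set" where
  "scalar_endos s L = {restrict (s c) L | c. True}"

definition central_lie_algebra ::
  "('f::field \<Rightarrow> 'g::ab_group_add \<Rightarrow> 'g) \<Rightarrow> ('g \<Rightarrow> 'g \<Rightarrow> 'g) \<Rightarrow> 'g set \<Rightarrow> bool" where
  "central_lie_algebra s b L \<longleftrightarrow> lie_centroid s b L = scalar_endos s L"


section \<open>Quotient spaces and direct sums\<close>

definition coset_proj :: "'g::ab_group_add set \<Rightarrow> 'g \<Rightarrow> 'g set" where
  "coset_proj W x = (+) x ` W"

text \<open>The space of linear maps from the quotient of \<open>'g\<close> by the subspace \<open>W\<close> to the subspace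
  \<open>C\<close>. The quotient is the set \<open>range (coset_proj W)\<close> of cosets, and its vector space operations
  are those of representatives.\<close>

definition quotient_hom ::
  "('f::field \<Rightarrow> 'g::ab_group_add \<Rightarrow> 'g) \<Rightarrow> 'g set \<Rightarrow> 'g set \<Rightarrow> ('g set \<Rightarrow> 'g) set" where
  "quotient_hom s W C = {\<phi> \<in> range (coset_proj W) \<rightarrow>\<^sub>E C.
     (\<forall>x y. \<phi> (coset_proj W (x + y)) = \<phi> (coset_proj W x) + \<phi> (coset_proj W y)) \<and>
     (\<forall>c x. \<phi> (coset_proj W (s c x)) = s c (\<phi> (coset_proj W x)))}"

definition quotient_hom_endos ::
  "('f::field \<Rightarrow> 'g::ab_group_add \<Rightarrow> 'g) \<Rightarrow> 'g set \<Rightarrow> 'g set \<Rightarrow> ('g \<Rightarrow> 'g) set" where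
  "quotient_hom_endos s W C = {\<phi> \<circ> coset_proj W | \<phi>. \<phi> \<in> quotient_hom s W C}"

definition pointwise_scale :: "('f \<Rightarrow> 'v \<Rightarrow> 'v) \<Rightarrow> 'f \<Rightarrow> ('x \<Rightarrow> 'v) \<Rightarrow> 'x \<Rightarrow> 'v" where
  "pointwise_scale s c \<phi> = (\<lambda>x. s c (\<phi> x))"

definition internal_direct_sum ::
  "('f::field \<Rightarrow> 'v::ab_group_add \<Rightarrow> 'v) \<Rightarrow> 'v set \<Rightarrow> 'v set \<Rightarrow> 'v set \<Rightarrow> bool" where
  "internal_direct_sum s U S T \<longleftrightarrow>
     module.subspace s S \<and> module.subspace s T \<and>
     U = {x + y | x y. x \<in> S \<and> y \<in> T} \<and> S \<inter> T = {0}"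


section \<open>Lie algebras given by generators and relations\<close>

datatype ('f, 'x) lie_term =
    Gen 'x
  | Zero
  | Plus "('f, 'x) lie_term" "('f, 'x) lie_term"
  | Scale 'f "('f, 'x) lie_term"
  | Bracket "('f, 'x) lie_term" "('f, 'x) lie_term"

primrec lie_eval ::
  "('f \<Rightarrow> 'g::ab_group_add \<Rightarrow> 'g) \<Rightarrow> ('g \<Rightarrow> 'g \<Rightarrow> 'g) \<Rightarrow> ('x \<Rightarrow> 'g) \<Rightarrow> ('f, 'x) lie_term \<Rightarrow> 'g" where
  "lie_eval s b \<iota> (Gen x) = \<iota> x"
| "lie_eval s b \<iota> Zero = 0"
| "lie_eval s b \<iota> (Plus t u) = lie_eval s b \<iota> t + lie_eval s b \<iota> u"
| "lie_eval s b \<iota> (Scale c t) = s c (lie_eval s b \<iota> t)"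
| "lie_eval s b \<iota> (Bracket t u) = b (lie_eval s b \<iota> t) (lie_eval s b \<iota> u)"

text \<open>The least congruence that contains the relations \<open>R\<close> and the axioms of Lie algebras. Two
  terms are congruent iff their difference lies, as an element of the free Lie algebra, in the
  ideal generated by \<open>R\<close>.\<close>

inductive lie_cong ::
  "(('f::field, 'x) lie_term \<times> ('f, 'x) lie_term) set \<Rightarrow>
   ('f, 'x) lie_term \<Rightarrow> ('f, 'x) lie_term \<Rightarrow> bool"
  for R where
  rel: "(t, u) \<in> R \<Longrightarrow> lie_cong R t u"
| refl: "lie_cong R t t"
| sym: "lie_cong R t u \<Longrightarrow> lie_cong R u t"
| trans: "lie_cong R t u \<Longrightarrow> lie_cong R u v \<Longrightarrow> lie_cong R t v"
| cong_plus: "lie_cong R t t' \<Longrightarrow> lie_cong R u u' \<Longrightarrow> lie_cong R (Plus t u) (Plus t' u')"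
| cong_scale: "lie_cong R t t' \<Longrightarrow> lie_cong R (Scale c t) (Scale c t')"
| cong_bracket: "lie_cong R t t' \<Longrightarrow> lie_cong R u u' \<Longrightarrow> lie_cong R (Bracket t u) (Bracket t' u')"
| plus_assoc: "lie_cong R (Plus (Plus t u) v) (Plus t (Plus u v))"
| plus_comm: "lie_cong R (Plus t u) (Plus u t)"
| plus_zero: "lie_cong R (Plus Zero t) t"
| scale_plus_right: "lie_cong R (Scale c (Plus t u)) (Plus (Scale c t) (Scale c u))"
| scale_plus_left: "lie_cong R (Scale (c + d) t) (Plus (Scale c t) (Scale d t))"
| scale_scale: "lie_cong R (Scale c (Scale d t)) (Scale (c * d) t)"
| scale_one: "lie_cong R (Scale 1 t) t"
| scale_zero: "lie_cong R (Scale 0 t) Zero"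
| bracket_plus_left: "lie_cong R (Bracket (Plus t u) v) (Plus (Bracket t v) (Bracket u v))"
| bracket_plus_right: "lie_cong R (Bracket t (Plus u v)) (Plus (Bracket t u) (Bracket t v))"
| bracket_scale_left: "lie_cong R (Bracket (Scale c t) u) (Scale c (Bracket t u))"
| bracket_scale_right: "lie_cong R (Bracket t (Scale c u)) (Scale c (Bracket t u))"
| bracket_self: "lie_cong R (Bracket t t) Zero"
| jacobi: "lie_cong R
    (Plus (Plus (Bracket t (Bracket u v)) (Bracket u (Bracket v t))) (Bracket v (Bracket t u))) Zero"

text \<open>\<open>(s, b)\<close> is the Lie algebra with generators \<open>\<iota> x\<close> and defining relations \<open>R\<close>: every element
  is the value of a term, and two terms have the same value exactly if the relations force it.
  This determines the Lie algebra together with \<open>\<iota>\<close> up to unique isomorphism.\<close>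

definition lie_presented_by ::
  "('f::field \<Rightarrow> 'g::ab_group_add \<Rightarrow> 'g) \<Rightarrow> ('g \<Rightarrow> 'g \<Rightarrow> 'g) \<Rightarrow> ('x \<Rightarrow> 'g) \<Rightarrow>
   (('f, 'x) lie_term \<times> ('f, 'x) lie_term) set \<Rightarrow> bool" where
  "lie_presented_by s b \<iota> R \<longleftrightarrow>
     lie_algebra s b \<and> surj (lie_eval s b \<iota>) \<and>
     (\<forall>t u. lie_eval s b \<iota> t = lie_eval s b \<iota> u \<longleftrightarrow> lie_cong R t u)"


section \<open>Generalized Cartan matrices and Kac-Moody algebras\<close>

definition generalized_cartan_matrix :: "int^'n::finite^'n \<Rightarrow> bool" where
  "generalized_cartan_matrix A \<longleftrightarrow>
     (\<forall>i. A $ i $ i = 2) \<and>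
     (\<forall>i j. i \<noteq> j \<longrightarrow> A $ i $ j \<le> 0) \<and>
     (\<forall>i j. A $ i $ j = 0 \<longleftrightarrow> A $ j $ i = 0)"

text \<open>\<open>\<sigma>\<close> is the renumbering of the index type by \<open>1, \<dots>, n\<close>. The condition asks that all
  consecutive entries are nonzero, i.e. for a path through all vertices of the Dynkin diagram,
  which in general is more than connectedness of the diagram.\<close>

definition indecomposable_matrix :: "int^'n::finite^'n \<Rightarrow> bool" where
  "indecomposable_matrix A \<longleftrightarrow>
     (\<exists>\<sigma> :: nat \<Rightarrow> 'n. bij_betw \<sigma> {1..CARD('n)} UNIV \<and>
        (\<Prod>k = 1..<CARD('n). A $ \<sigma> k $ \<sigma> (k + 1)) \<noteq> 0)"

text \<open>A realization \<open>(\<hh>, \<Pi>, \<Pi>\<^sup>\<or>)\<close>, where \<open>\<hh>\<close> is the type \<open>'h\<close> with scalar multiplication \<open>sH\<close>, and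
  \<open>\<alpha>\<close> and \<open>\<alpha>c\<close> are the families of simple roots and coroots. Independence of \<open>\<alpha>\<close> is meant in the
  space of all functions \<open>'h \<Rightarrow> 'f\<close>, which contains the dual of \<open>\<hh>\<close> as a subspace. As
  \<open>2 n - rank A > 0\<close>, the dimension condition includes finite dimensionality.\<close>

definition realization ::
  "int^'n::finite^'n \<Rightarrow> ('f::field_char_0 \<Rightarrow> 'h::ab_group_add \<Rightarrow> 'h) \<Rightarrow>
   ('n \<Rightarrow> 'h \<Rightarrow> 'f) \<Rightarrow> ('n \<Rightarrow> 'h) \<Rightarrow> bool" where
  "realization A sH \<alpha> \<alpha>c \<longleftrightarrow>
     vector_space sH \<and>
     vector_space.dim sH UNIV = 2 * CARD('n) - rank ((\<chi> i j. of_int (A $ i $ j)) :: 'f^'n^'n) \<and>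
     (\<forall>i. Vector_Spaces.linear sH (*) (\<alpha> i)) \<and>
     inj \<alpha> \<and> \<not> module.dependent (pointwise_scale (*)) (range \<alpha>) \<and>
     inj \<alpha>c \<and> \<not> module.dependent sH (range \<alpha>c) \<and>
     (\<forall>i j. \<alpha> i (\<alpha>c j) = of_int (A $ j $ i))"

datatype ('h, 'n) km_gen = H 'h | E 'n | F 'n

text \<open>The defining relations. The first two express that the vector space \<open>\<hh>\<close>, not just its
  underlying set, is part of the generators.\<close>

inductive_set km_relations ::
  "int^'n::finite^'n \<Rightarrow> ('f::field_char_0 \<Rightarrow> 'h::ab_group_add \<Rightarrow> 'h) \<Rightarrow>
   ('n \<Rightarrow> 'h \<Rightarrow> 'f) \<Rightarrow> ('n \<Rightarrow> 'h) \<Rightarrow>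
   (('f, ('h, 'n) km_gen) lie_term \<times> ('f, ('h, 'n) km_gen) lie_term) set"
  for A sH \<alpha> \<alpha>c where
  H_plus: "(Gen (H (h + h')), Plus (Gen (H h)) (Gen (H h'))) \<in> km_relations A sH \<alpha> \<alpha>c"
| H_scale: "(Gen (H (sH c h)), Scale c (Gen (H h))) \<in> km_relations A sH \<alpha> \<alpha>c"
| EF_same: "(Bracket (Gen (E i)) (Gen (F i)), Gen (H (\<alpha>c i))) \<in> km_relations A sH \<alpha> \<alpha>c"
| EF_diff: "i \<noteq> j \<Longrightarrow> (Bracket (Gen (E i)) (Gen (F j)), Zero) \<in> km_relations A sH \<alpha> \<alpha>c"
| HH: "(Bracket (Gen (H h)) (Gen (H h')), Zero) \<in> km_relations A sH \<alpha> \<alpha>c"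
| HE: "(Bracket (Gen (H h)) (Gen (E i)), Scale (\<alpha> i h) (Gen (E i))) \<in> km_relations A sH \<alpha> \<alpha>c"
| HF: "(Bracket (Gen (H h)) (Gen (F i)), Scale (- \<alpha> i h) (Gen (F i))) \<in> km_relations A sH \<alpha> \<alpha>c"
| serre_E: "i \<noteq> j \<Longrightarrow>
    ((Bracket (Gen (E i)) ^^ nat (1 - A $ i $ j)) (Gen (E j)), Zero) \<in> km_relations A sH \<alpha> \<alpha>c"
| serre_F: "i \<noteq> j \<Longrightarrow>
    ((Bracket (Gen (F i)) ^^ nat (1 - A $ i $ j)) (Gen (F j)), Zero) \<in> km_relations A sH \<alpha> \<alpha>c"

definition kac_moody_algebra ::
  "int^'n::finite^'n \<Rightarrow> ('f::field_char_0 \<Rightarrow> 'h::ab_group_add \<Rightarrow> 'h) \<Rightarrow>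
   ('n \<Rightarrow> 'h \<Rightarrow> 'f) \<Rightarrow> ('n \<Rightarrow> 'h) \<Rightarrow>
   ('f \<Rightarrow> 'g::ab_group_add \<Rightarrow> 'g) \<Rightarrow> ('g \<Rightarrow> 'g \<Rightarrow> 'g) \<Rightarrow> (('h, 'n) km_gen \<Rightarrow> 'g) \<Rightarrow> bool" where
  "kac_moody_algebra A sH \<alpha> \<alpha>c s b \<iota> \<longleftrightarrow>
     realization A sH \<alpha> \<alpha>c \<and> lie_presented_by s b \<iota> (km_relations A sH \<alpha> \<alpha>c)"

end

theory Submission
  imports Defs
begin

text \<open>
  The centroid of the derived algebra \<open>\<gg>'\<close> is stable under commutators with \<open>ad \<hh>\<close>, and evaluation at
  a Chevalley generator \<open>e\<^sub>j\<close> is injective on it. So it suffices to exclude nonzero centroid elements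
  \<open>\<psi>\<close> that are homogeneous of degree \<open>\<gamma> \<noteq> 0\<close> for the root grading. Since \<open>\<psi>\<close> commutes with the
  coroots, \<open>\<gamma>\<close> is a null vector of the Cartan matrix, and up to exchanging \<open>e\<close> and \<open>f\<close> it is positive.
  Together with the path in the Dynkin diagram this forces the matrix to be symmetrizable.

  For a symmetrizable matrix there is a Lie bialgebra cobracket \<open>\<delta>\<close> with \<open>\<delta> \<hh> = 0\<close>,
  \<open>\<delta> e\<^sub>i = \<epsilon>\<^sub>i h\<^sub>i \<and> e\<^sub>i\<close> and \<open>\<delta> f\<^sub>i = \<epsilon>\<^sub>i h\<^sub>i \<and> f\<^sub>i\<close>. The cocycle identity gives
  \<open>[\<gg>\<^sub>\<beta>, \<gg>\<^sub>-\<^sub>\<beta>] \<subseteq> \<bbbF> \<nu>(\<beta>)\<close> and, because bracket after cobracket is a derivation, that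
  no nonzero \<open>x \<in> \<gg>\<^sub>\<beta>\<close> with \<open>\<beta> > 0\<close> is annihilated by all \<open>f\<^sub>i\<close> (the Gabber-Kac theorem).
  With \<open>[\<psi> x, y] = [x, \<psi> y]\<close> and the independence of the coroots the first fact shows that no \<open>e\<^sub>j\<close>
  lies in the image of \<open>\<psi>\<close>; then an element of least positive height in the image contradicts the
  second fact. The second fact also shows that the centralizer of \<open>\<gg>'\<close> is the center of \<open>\<gg>\<close>.

  That \<open>\<hh>\<close> embeds in \<open>\<gg>\<close> follows from its action on highest weight modules.
\<close>

text \<open>The algebra is given by the Serre relations and not as a quotient by a maximal ideal
  meeting \<hh> trivially, so the absence of singular vectors has to be proved, and the argument for
  it needs a symmetrizer. This is why symmetrizability is extracted from the null vector before
  anything else can be said about the centroid. The cobracket does the work of the invariant form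
  and the Casimir operator. As a 1-cocycle it is determined by its values on the generators, so its
  existence is a finite check of the relations inside a semidirect product, and no form has to be
  built degree by degree. With (\<alpha> i | \<alpha> j) = \<epsilon> i * a i j and (\<rho> |
  \<alpha> i) = \<epsilon> i, bracket after cobracket yields the Casimir identity 2 (\<rho> |
  \<beta>) = (\<beta> | \<beta>) for a nonzero singular vector of degree \<beta>. The left side is
  positive for \<beta> > 0, while sl2 theory makes the right side nonpositive.\<close>

lemma vector_space_pointwise_scale:
  "vector_space s \<Longrightarrow> vector_space (pointwise_scale s)"
  unfolding vector_space_def pointwise_scale_def by (auto simp: fun_eq_iff)

lemma exists_separating_functional:
  assumes "vector_space s" "(x::'g::ab_group_add) \<noteq> 0"
  shows "\<exists>\<phi>. Vector_Spaces.linear s ((*) :: 'f::field \<Rightarrow> _) \<phi> \<and> \<phi> x = 1"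
proof -
  interpret V: vector_space s by fact
  interpret P: vector_space_pair s "(*) :: 'f \<Rightarrow> _"
    by unfold_locales (auto simp: algebra_simps)
  have "V.independent {x}" using assms(2) by (simp add: V.dependent_single)
  from P.linear_independent_extend[OF this, of "\<lambda>_. 1"] show ?thesis by auto
qed

section \<open>Lie algebras on a carrier set and evaluation of terms\<close>

locale lie_on = vector_space sc
  for sc :: "'f::field \<Rightarrow> 'v::ab_group_add \<Rightarrow> 'v" +
  fixes C :: "'v set" and br :: "'v \<Rightarrow> 'v \<Rightarrow> 'v"
  assumes C_subspace: "subspace C"
    and br_C: "x \<in> C \<Longrightarrow> y \<in> C \<Longrightarrow> br x y \<in> C"
    and br_add_left: "x \<in> C \<Longrightarrow> y \<in> C \<Longrightarrow> z \<in> C \<Longrightarrow> br (x + y) z = br x z + br y z"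
    and br_add_right: "x \<in> C \<Longrightarrow> y \<in> C \<Longrightarrow> z \<in> C \<Longrightarrow> br x (y + z) = br x y + br x z"
    and br_scale_left: "x \<in> C \<Longrightarrow> y \<in> C \<Longrightarrow> br (sc c x) y = sc c (br x y)"
    and br_scale_right: "x \<in> C \<Longrightarrow> y \<in> C \<Longrightarrow> br x (sc c y) = sc c (br x y)"
    and br_self: "x \<in> C \<Longrightarrow> br x x = 0"
    and br_jacobi: "x \<in> C \<Longrightarrow> y \<in> C \<Longrightarrow> z \<in> C \<Longrightarrow>
      br x (br y z) + br y (br z x) + br z (br x y) = 0"
begin

lemma C_closed [simp]:
  "0 \<in> C" "x \<in> C \<Longrightarrow> y \<in> C \<Longrightarrow> x + y \<in> C" "x \<in> C \<Longrightarrow> sc c x \<in> C"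
  "x \<in> C \<Longrightarrow> y \<in> C \<Longrightarrow> br x y \<in> C" "x \<in> C \<Longrightarrow> - x \<in> C"
  using C_subspace br_C by (auto simp: subspace_0 subspace_add subspace_scale subspace_neg)

lemma br_antisym: "x \<in> C \<Longrightarrow> y \<in> C \<Longrightarrow> br x y = - br y x"
proof -
  assume xy: "x \<in> C" "y \<in> C"
  have "br (x + y) (x + y) = 0" using xy by (simp add: br_self)
  then have "br y x + br x y = 0"
    using xy br_self[of x] br_self[of y] by (simp add: br_add_left br_add_right)
  then show ?thesis by (metis add.commute eq_neg_iff_add_eq_0)
qed

lemma br_zero [simp]: "x \<in> C \<Longrightarrow> br 0 x = 0" "x \<in> C \<Longrightarrow> br x 0 = 0"
  using br_scale_left[of 0 x 0] br_scale_right[of x 0 0] by auto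

lemma br_minus: "x \<in> C \<Longrightarrow> y \<in> C \<Longrightarrow> br (- x) y = - br x y"
  "x \<in> C \<Longrightarrow> y \<in> C \<Longrightarrow> br x (- y) = - br x y"
  using br_scale_left[of x y "-1"] br_scale_right[of x y "-1"] by auto

lemma br_leibniz:
  assumes "x \<in> C" "y \<in> C" "z \<in> C"
  shows "br x (br y z) = br (br x y) z + br y (br x z)"
  using br_jacobi[OF assms] br_antisym[of z x] br_antisym[of z "br x y"] assms
  by (simp add: br_minus algebra_simps)

lemma lie_eval_in_C: "(\<And>x. \<rho> x \<in> C) \<Longrightarrow> lie_eval sc br \<rho> t \<in> C"
  by (induction t) auto

text \<open>A presentation tells which elements of \<gg> agree. To show that an element is nonzero,
  or that a map on \<gg> is well defined, terms are evaluated in another model of the relations: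
  operators on a highest weight module (\<open>endos\<close>) or a semidirect product
  (\<open>SD\<close>). In both, the laws are established on a subset of the type, hence the carrier
  \<open>C\<close>.\<close>

lemma lie_cong_sound:
  assumes \<rho>: "\<And>x. \<rho> x \<in> C"
    and R: "\<And>t u. (t, u) \<in> R \<Longrightarrow> lie_eval sc br \<rho> t = lie_eval sc br \<rho> u"
    and "lie_cong R t u"
  shows "lie_eval sc br \<rho> t = lie_eval sc br \<rho> u"
  using assms(3)
proof (induction rule: lie_cong.induct)
  case (jacobi t u v)
  then show ?case by (simp add: br_jacobi lie_eval_in_C[OF \<rho>])
qed (simp_all add: R lie_eval_in_C[OF \<rho>] br_add_left br_add_right br_scale_left br_scale_right
  br_self scale_left_distrib scale_right_distrib algebra_simps)

end

section \<open>The sl2 computation behind the Serre relations\<close>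

locale chevalley_on = lie_on sc C br
  for sc :: "'f::field_char_0 \<Rightarrow> 'v::ab_group_add \<Rightarrow> 'v" and C br +
  fixes a :: "'n \<Rightarrow> 'n \<Rightarrow> int" and hc e f :: "'n \<Rightarrow> 'v"
  assumes in_C [simp]: "hc i \<in> C" "e i \<in> C" "f i \<in> C"
    and diag: "a i i = 2" and zero_sym: "a i j = 0 \<Longrightarrow> a j i = 0"
    and nonpos: "i \<noteq> j \<Longrightarrow> a i j \<le> 0"
    and ef: "br (e i) (f j) = (if i = j then hc i else 0)"
    and he: "br (hc i) (e j) = sc (of_int (a i j)) (e j)"
begin

lemma fe: "br (f i) (e j) = (if i = j then - hc i else 0)"
  using br_antisym[of "f i" "e j"] by (simp add: ef)

lemma eh: "br (e j) (hc i) = sc (- of_int (a i j)) (e j)"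
  using br_antisym[of "e j" "hc i"] by (simp add: he)

definition u :: "'n \<Rightarrow> 'n \<Rightarrow> nat \<Rightarrow> 'v" where "u i j k = (br (e i) ^^ k) (e j)"

lemma u_simps: "u i j 0 = e j" "u i j (Suc k) = br (e i) (u i j k)" by (simp_all add: u_def)

lemma u_C [simp]: "u i j k \<in> C" by (induction k) (auto simp: u_simps)

lemma h_u: "br (hc i) (u i j k) = sc (of_int (2 * int k + a i j)) (u i j k)"
proof (induction k)
  case (Suc k)
  have "br (hc i) (u i j (Suc k)) = sc 2 (u i j (Suc k)) + br (e i) (br (hc i) (u i j k))"
    by (simp add: u_simps br_leibniz[of "hc i" "e i"] he diag br_scale_left)
  also have "\<dots> = sc 2 (u i j (Suc k)) + sc (of_int (2 * int k + a i j)) (u i j (Suc k))"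
    by (simp add: Suc.IH br_scale_right u_simps)
  finally show ?case by (simp add: algebra_simps flip: scale_left_distrib)
qed (simp add: u_simps he)

text \<open>The scalar is the accumulated sum of the weights 2k + a i j of \<open>h_u\<close>. It
  vanishes at k = - a i j, that is, at the Serre exponent \<open>Suc k\<close> = 1 - a i j.\<close>

lemma f_u: "br (f i) (u i j (Suc k)) = sc (- of_int (int (Suc k) * (int k + a i j))) (u i j k)"
  if "i \<noteq> j"
proof (induction k)
  case 0
  show ?case using that by (simp add: u_simps br_leibniz[of "f i" "e i"] fe br_minus he)
next
  case (Suc k)
  have "br (f i) (u i j (Suc (Suc k))) =
      - br (hc i) (u i j (Suc k)) + br (e i) (br (f i) (u i j (Suc k)))"
    by (simp only: u_simps(2)[of i j "Suc k"] br_leibniz[of "f i" "e i"] fe in_C u_C)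
      (simp add: br_minus)
  also have "\<dots> = sc (- of_int (2 * int (Suc k) + a i j) - of_int (int (Suc k) * (int k + a i j))) (u i j (Suc k))"
    by (simp only: h_u Suc.IH br_scale_right in_C u_C flip: u_simps(2))
      (simp only: scale_left_diff_distrib scale_minus_left, simp)
  finally show ?case by (simp add: algebra_simps)
qed

text \<open>The Serre element is singular before any Serre relation is imposed. This allows the
  relations to be verified on a module that was built without them.\<close>

lemma f_serre: "br (f k) (u i j (nat (1 - a i j))) = 0" if "i \<noteq> j"
proof -
  define m where "m = nat (- a i j)"
  have m: "nat (1 - a i j) = Suc m" "int m + a i j = 0"
    using nonpos[OF that] by (simp_all add: m_def nat_diff_distrib')
  consider "k = i" | "k = j" "k \<noteq> i" | "k \<noteq> i" "k \<noteq> j" by blast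
  then show ?thesis
  proof cases
    case 1
    then show ?thesis using f_u[OF that, of m] m by simp
  next
    case 2
    have fe': "br (f k) (e i) = 0" using 2 by (simp add: fe)
    \<comment> \<open>The generator f_j passes e_i and turns the inner e_j into -h_j. One e_i makes
      this a multiple of e_i, and the next one kills it.\<close>
    have "br (f k) (u i j (Suc l)) = sc (of_int (a j i)) (if l = 0 then e i else 0)" for l
    proof (induction l)
      case 0
      then show ?case using 2
        by (simp add: u_simps br_leibniz[of "f j" "e i"] fe br_minus eh)
    next
      case (Suc l)
      show ?case
        by (simp only: u_simps(2)[of i j "Suc l"] br_leibniz[of "f k" "e i"] fe' Suc.IH in_C u_C)
          (simp add: br_scale_right br_self)
    qed
    \<comment> \<open>For exponent one the multiple of e_i survives, so its coefficient must vanish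
      by the symmetric zero pattern.\<close>
    moreover have "a j i = 0" if "m = 0" using that m zero_sym by simp
    ultimately show ?thesis unfolding m by simp
  next
    case 3
    have "br (f k) (u i j l) = 0" for l
      by (induction l) (use 3 in \<open>simp_all add: u_simps br_leibniz[of "f k" "e i"] fe\<close>)
    then show ?thesis .
  qed
qed

end

section \<open>Highest weight modules and the embedding of the Cartan subalgebra\<close>

text \<open>The irreducible highest weight module with highest weight \<open>\<Lambda>\<close>, realized inside the dual of
  the Verma module of the free algebra on the \<open>f\<^sub>i\<close>: functions on words in the index set.\<close>

locale highest_weight_module =
  fixes sH :: "'f::field_char_0 \<Rightarrow> 'h::ab_group_add \<Rightarrow> 'h"
    and \<alpha> :: "'n::finite \<Rightarrow> 'h \<Rightarrow> 'f" and \<alpha>c :: "'n \<Rightarrow> 'h" and a :: "'n \<Rightarrow> 'n \<Rightarrow> int" and \<Lambda> :: "'h \<Rightarrow> 'f"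
  assumes \<alpha>_lin: "Vector_Spaces.linear sH (*) (\<alpha> i)"
    and \<Lambda>_lin: "Vector_Spaces.linear sH (*) \<Lambda>"
    and \<alpha>_\<alpha>c: "\<alpha> i (\<alpha>c j) = of_int (a j i)"
    and a_diag: "a i i = 2" and a_zero_sym: "a i j = 0 \<Longrightarrow> a j i = 0"
    and a_nonpos: "i \<noteq> j \<Longrightarrow> a i j \<le> 0"
begin

abbreviation sv :: "'f \<Rightarrow> ('n list \<Rightarrow> 'f) \<Rightarrow> ('n list \<Rightarrow> 'f)" where "sv \<equiv> pointwise_scale (*)"

definition wtw :: "'n list \<Rightarrow> 'h \<Rightarrow> 'f" where "wtw w h = \<Lambda> h - (\<Sum>i\<leftarrow>w. \<alpha> i h)"
definition Hop :: "'h \<Rightarrow> ('n list \<Rightarrow> 'f) \<Rightarrow> 'n list \<Rightarrow> 'f" where "Hop h \<phi> = (\<lambda>w. wtw w h * \<phi> w)"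
definition Eop :: "'n \<Rightarrow> ('n list \<Rightarrow> 'f) \<Rightarrow> 'n list \<Rightarrow> 'f" where "Eop i \<phi> = (\<lambda>w. \<phi> (i # w))"
text \<open>A word i1 ... ik stands for f_i1 ... f_ik v in the free Verma module, of weight
  \<open>wtw\<close>. Each generator acts on functions of words by the transpose of the opposite
  one: \<open>Eop i\<close> is dual to prepending f_i, and \<open>Fw i w\<close> evaluates \<phi> on
  e_i applied to the word. The recursion is e_i f_j = f_j e_i, plus h_i if i = j.\<close>

primrec Fw :: "'n \<Rightarrow> 'n list \<Rightarrow> ('n list \<Rightarrow> 'f) \<Rightarrow> 'f" where
  "Fw i [] \<phi> = 0"
| "Fw i (j # w) \<phi> = Fw i w (Eop j \<phi>) + (if i = j then wtw w (\<alpha>c i) * \<phi> w else 0)"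
definition Fop :: "'n \<Rightarrow> ('n list \<Rightarrow> 'f) \<Rightarrow> 'n list \<Rightarrow> 'f" where "Fop i \<phi> = (\<lambda>w. Fw i w \<phi>)"
definition vac :: "'n list \<Rightarrow> 'f" where "vac w = (if w = [] then 1 else 0)"

lemma op_add: "Hop h (\<phi> + \<psi>) = Hop h \<phi> + Hop h \<psi>" "Eop i (\<phi> + \<psi>) = Eop i \<phi> + Eop i \<psi>"
  "Fop i (\<phi> + \<psi>) = Fop i \<phi> + Fop i \<psi>"
proof -
  show E: "Eop i (\<phi> + \<psi>) = Eop i \<phi> + Eop i \<psi>" for i \<phi> \<psi> by (simp add: Eop_def fun_eq_iff)
  show "Hop h (\<phi> + \<psi>) = Hop h \<phi> + Hop h \<psi>" by (simp add: Hop_def fun_eq_iff algebra_simps)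
  have "Fw i w (\<phi> + \<psi>) = Fw i w \<phi> + Fw i w \<psi>" for w
    by (induction w arbitrary: \<phi> \<psi>) (auto simp: E algebra_simps)
  then show "Fop i (\<phi> + \<psi>) = Fop i \<phi> + Fop i \<psi>" by (simp add: Fop_def fun_eq_iff)
qed

lemma op_scale: "Hop h (sv c \<phi>) = sv c (Hop h \<phi>)" "Eop i (sv c \<phi>) = sv c (Eop i \<phi>)"
  "Fop i (sv c \<phi>) = sv c (Fop i \<phi>)"
proof -
  show E: "Eop i (sv c \<phi>) = sv c (Eop i \<phi>)" for i \<phi>
    by (simp add: Eop_def pointwise_scale_def fun_eq_iff)
  show "Hop h (sv c \<phi>) = sv c (Hop h \<phi>)" by (simp add: Hop_def pointwise_scale_def fun_eq_iff)
  have "Fw i w (sv c \<phi>) = c * Fw i w \<phi>" for w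
    by (induction w arbitrary: \<phi>) (auto simp: E algebra_simps, simp_all add: pointwise_scale_def)
  then show "Fop i (sv c \<phi>) = sv c (Fop i \<phi>)" by (simp add: Fop_def pointwise_scale_def fun_eq_iff)
qed

lemma op_zero: "Hop h 0 = 0" "Eop i 0 = 0" "Fop i 0 = 0"
  using op_add(1)[of h 0 0] op_add(2)[of i 0 0] op_add(3)[of i 0 0] by simp_all

lemma EF: "Eop i (Fop j \<phi>) = Fop j (Eop i \<phi>) + (if i = j then Hop (\<alpha>c i) \<phi> else 0)"
  by (auto simp: Eop_def Fop_def Hop_def fun_eq_iff)

lemma HE: "Hop h (Eop i \<phi>) = Eop i (Hop h \<phi>) + sv (\<alpha> i h) (Eop i \<phi>)"
  by (auto simp: Eop_def Hop_def fun_eq_iff wtw_def pointwise_scale_def algebra_simps)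

lemma HF: "Hop h (Fop i \<phi>) = Fop i (Hop h \<phi>) + sv (- \<alpha> i h) (Fop i \<phi>)"
proof -
  have E: "Eop j (Hop h \<phi>) = Hop h (Eop j \<phi>) + sv (- \<alpha> j h) (Eop j \<phi>)" for j \<phi>
    by (auto simp: Eop_def Hop_def fun_eq_iff wtw_def pointwise_scale_def algebra_simps)
  have add: "Fw i w (\<phi> + \<psi>) = Fw i w \<phi> + Fw i w \<psi>"
    and scale: "Fw i w (sv c \<phi>) = c * Fw i w \<phi>" for w c \<phi> \<psi>
    using op_add(3)[of i \<phi> \<psi>] op_scale(3)[of i c \<phi>]
    by (simp_all add: Fop_def fun_eq_iff pointwise_scale_def)
  have "wtw w h * Fw i w \<phi> = Fw i w (Hop h \<phi>) - \<alpha> i h * Fw i w \<phi>" for w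
  proof (induction w arbitrary: \<phi>)
    case (Cons j w)
    show ?case using Cons.IH[of "Eop j \<phi>"]
      by (auto simp: E add scale algebra_simps) (simp_all add: wtw_def Hop_def algebra_simps)
  qed simp
  then show ?thesis by (simp add: Hop_def Fop_def fun_eq_iff pointwise_scale_def)
qed

lemma HH: "Hop h (Hop h' \<phi>) = Hop h' (Hop h \<phi>)"
  by (simp add: Hop_def fun_eq_iff)

lemma Hop_add_left: "Hop (h + h') \<phi> = Hop h \<phi> + Hop h' \<phi>"
  and Hop_scale_left: "Hop (sH c h) \<phi> = sv c (Hop h \<phi>)"
proof -
  note lin = \<alpha>_lin[THEN Vector_Spaces.linear_iff[THEN iffD1]] \<Lambda>_lin[THEN Vector_Spaces.linear_iff[THEN iffD1]]
  have "(\<Sum>i\<leftarrow>w. \<alpha> i (h + h')) = (\<Sum>i\<leftarrow>w. \<alpha> i h) + (\<Sum>i\<leftarrow>w. \<alpha> i h')"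
    and "(\<Sum>i\<leftarrow>w. \<alpha> i (sH c h)) = c * (\<Sum>i\<leftarrow>w. \<alpha> i h)" for w
    by (induction w) (use lin in \<open>auto simp: algebra_simps\<close>)
  then show "Hop (h + h') \<phi> = Hop h \<phi> + Hop h' \<phi>" "Hop (sH c h) \<phi> = sv c (Hop h \<phi>)"
    using lin by (auto simp: Hop_def fun_eq_iff wtw_def pointwise_scale_def algebra_simps)
qed

text \<open>The submodule generated by \<open>vac\<close>. Both Serre arguments rest on this
  restriction: \<open>serre_upper\<close> on generation by the operators \<open>Fop\<close>, and
  \<open>serre_lower\<close> on the finite support of the elements.\<close>

inductive in_L :: "('n list \<Rightarrow> 'f) \<Rightarrow> bool" where
  in_L_vac: "in_L vac"
| in_L_add: "in_L \<phi> \<Longrightarrow> in_L \<psi> \<Longrightarrow> \<eta> = \<phi> + \<psi> \<Longrightarrow> in_L \<eta>"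
| in_L_scale: "in_L \<phi> \<Longrightarrow> in_L (sv c \<phi>)"
| in_L_F: "in_L \<phi> \<Longrightarrow> in_L (Fop i \<phi>)"

definition L :: "('n list \<Rightarrow> 'f) set" where "L = {\<phi>. in_L \<phi>}"

lemma L_vac: "vac \<in> L" and L_add: "\<phi> \<in> L \<Longrightarrow> \<psi> \<in> L \<Longrightarrow> \<phi> + \<psi> \<in> L"
  and L_scale: "\<phi> \<in> L \<Longrightarrow> sv c \<phi> \<in> L" and L_F: "\<phi> \<in> L \<Longrightarrow> Fop i \<phi> \<in> L"
  by (auto simp: L_def intro: in_L.intros)

lemmas L_intros = L_vac L_add L_scale L_F

lemma L_induct [consumes 1, case_names vac add scale F]:
  assumes "\<phi> \<in> L" "P vac" "\<And>\<phi> \<psi>. \<phi> \<in> L \<Longrightarrow> P \<phi> \<Longrightarrow> \<psi> \<in> L \<Longrightarrow> P \<psi> \<Longrightarrow> P (\<phi> + \<psi>)"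
    "\<And>\<phi> c. \<phi> \<in> L \<Longrightarrow> P \<phi> \<Longrightarrow> P (sv c \<phi>)" "\<And>\<phi> i. \<phi> \<in> L \<Longrightarrow> P \<phi> \<Longrightarrow> P (Fop i \<phi>)"
  shows "P \<phi>"
proof -
  have "in_L \<phi>" using assms(1) by (simp add: L_def)
  then show ?thesis
  proof (induction rule: in_L.induct)
    case (in_L_add \<phi> \<psi> \<eta>)
    then show ?case using assms(3)[of \<phi> \<psi>] unfolding L_def by blast
  qed (use assms(2,4,5) in \<open>auto simp: L_def\<close>)
qed

lemma L_zero: "0 \<in> L"
  using L_scale[OF L_vac, of 0] by (simp add: pointwise_scale_def zero_fun_def)

lemma L_diff: "\<phi> \<in> L \<Longrightarrow> \<psi> \<in> L \<Longrightarrow> \<phi> - \<psi> \<in> L"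
  using L_add[OF _ L_scale[of \<psi> "-1"], of \<phi>]
  by (simp add: pointwise_scale_def fun_diff_def plus_fun_def)

lemma H_vac: "Hop h vac = sv (\<Lambda> h) vac" and E_vac: "Eop i vac = 0"
  by (auto simp: Hop_def Eop_def vac_def wtw_def pointwise_scale_def fun_eq_iff)

lemma H_L: "\<phi> \<in> L \<Longrightarrow> Hop h \<phi> \<in> L"
proof (induction rule: L_induct)
  case (F \<phi> i)
  then show ?case unfolding HF by (intro L_intros)
qed (simp_all only: H_vac op_add op_scale L_intros)

lemma E_L: "\<phi> \<in> L \<Longrightarrow> Eop i \<phi> \<in> L"
proof (induction rule: L_induct)
  case (F \<phi> j)
  then show ?case unfolding EF by (cases "i = j") (simp_all only: simp_thms if_True if_False L_intros H_L L_zero)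
qed (simp_all only: E_vac L_zero op_add op_scale L_intros)

lemma L_finite_support: "\<phi> \<in> L \<Longrightarrow> \<exists>n. \<forall>w. length w \<ge> n \<longrightarrow> \<phi> w = 0"
proof (induction rule: L_induct)
  case vac
  then show ?case by (auto simp: vac_def intro: exI[of _ 1])
next
  case (add \<phi> \<psi>)
  then obtain m n where "\<forall>w. length w \<ge> m \<longrightarrow> \<phi> w = 0" "\<forall>w. length w \<ge> n \<longrightarrow> \<psi> w = 0" by auto
  then show ?case by (intro exI[of _ "max m n"]) auto
next
  case (scale \<phi> c)
  then show ?case by (auto simp: pointwise_scale_def)
next
  case (F \<phi> i)
  then obtain n where "\<forall>w. length w \<ge> n \<longrightarrow> \<phi> w = 0" by auto
  then have "Fw i w \<phi> = 0" if "length w \<ge> Suc n" for w using that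
  proof (induction w arbitrary: \<phi> n)
    case (Cons j w)
    have "Fw i w (Eop j \<phi>) = 0"
    proof (cases n)
      case 0
      have "Eop j \<phi> = 0" using Cons.prems(1) 0 by (auto simp: Eop_def)
      moreover have "Fw i w 0 = 0" using op_zero(3)[of i] by (simp add: Fop_def fun_eq_iff)
      ultimately show ?thesis by simp
    next
      case (Suc k)
      show ?thesis by (rule Cons.IH[of k]) (use Cons.prems Suc in \<open>auto simp: Eop_def\<close>)
    qed
    then show ?case using Cons.prems by auto
  qed simp
  then show ?case unfolding Fop_def by blast
qed

text \<open>The default value 0 outside \<open>L\<close> makes equality of endomorphisms of
  \<open>L\<close> an equality of functions, and it is stable under sums and scalars.\<close>

definition res :: "(('n list \<Rightarrow> 'f) \<Rightarrow> ('n list \<Rightarrow> 'f)) \<Rightarrow> ('n list \<Rightarrow> 'f) \<Rightarrow> ('n list \<Rightarrow> 'f)" where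
  "res X \<phi> = (if \<phi> \<in> L then X \<phi> else 0)"

definition endos :: "(('n list \<Rightarrow> 'f) \<Rightarrow> ('n list \<Rightarrow> 'f)) set" where
  "endos = {X. (\<forall>\<phi>\<in>L. X \<phi> \<in> L) \<and> (\<forall>\<phi>\<in>L. \<forall>\<psi>\<in>L. X (\<phi> + \<psi>) = X \<phi> + X \<psi>) \<and>
     (\<forall>c. \<forall>\<phi>\<in>L. X (sv c \<phi>) = sv c (X \<phi>)) \<and> (\<forall>\<phi>. \<phi> \<notin> L \<longrightarrow> X \<phi> = 0)}"

definition comm where
  "comm X Y = (\<lambda>\<phi>. X (Y \<phi>) - Y (X \<phi>))" for X Y :: "('n list \<Rightarrow> 'f) \<Rightarrow> ('n list \<Rightarrow> 'f)"

lemma endosD: assumes "X \<in> endos"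
  shows "\<phi> \<in> L \<Longrightarrow> X \<phi> \<in> L" "\<phi> \<in> L \<Longrightarrow> \<psi> \<in> L \<Longrightarrow> X (\<phi> + \<psi>) = X \<phi> + X \<psi>"
    "\<phi> \<in> L \<Longrightarrow> X (sv c \<phi>) = sv c (X \<phi>)" "\<phi> \<notin> L \<Longrightarrow> X \<phi> = 0" "X 0 = 0"
    "\<phi> \<in> L \<Longrightarrow> \<psi> \<in> L \<Longrightarrow> X (\<phi> - \<psi>) = X \<phi> - X \<psi>"
proof -
  show add: "X (\<phi> + \<psi>) = X \<phi> + X \<psi>" if "\<phi> \<in> L" "\<psi> \<in> L" for \<phi> \<psi>
    using assms that by (auto simp: endos_def)
  from add[OF L_zero L_zero] show "X 0 = 0" by simp
  from add[of "\<phi> - \<psi>" \<psi>] show "\<phi> \<in> L \<Longrightarrow> \<psi> \<in> L \<Longrightarrow> X (\<phi> - \<psi>) = X \<phi> - X \<psi>"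
    by (simp add: L_diff algebra_simps)
qed (use assms in \<open>auto simp: endos_def\<close>)

lemma sv_add: "sv c (\<phi> + \<psi>) = sv c \<phi> + sv c \<psi>" and sv_diff: "sv c (\<phi> - \<psi>) = sv c \<phi> - sv c \<psi>"
  by (auto simp: pointwise_scale_def fun_eq_iff algebra_simps)

lemma sv_zero: "sv c 0 = 0"
  by (auto simp: pointwise_scale_def)

lemma sv_sv: "sv c (sv d \<phi>) = sv d (sv c \<phi>)"
  by (auto simp: pointwise_scale_def fun_eq_iff algebra_simps)

sublocale endo: lie_on "pointwise_scale sv" endos comm
proof -
  interpret V: vector_space "pointwise_scale sv"
    by (intro vector_space_pointwise_scale) (unfold_locales, auto simp: algebra_simps)
  show "lie_on (pointwise_scale sv) endos comm"
  proof unfold_locales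
    show "V.subspace endos" unfolding V.subspace_def
    proof (intro conjI ballI allI)
      show "0 \<in> endos" by (auto simp: endos_def L_zero pointwise_scale_def)
    next
      fix X Y assume "X \<in> endos" "Y \<in> endos"
      then show "X + Y \<in> endos"
        by (auto simp: endos_def sv_add algebra_simps intro: L_add)
    next
      fix X c assume "X \<in> endos"
      then show "pointwise_scale sv c X \<in> endos"
        by (auto simp: endos_def sv_add sv_sv pointwise_scale_def[of sv] intro: L_scale)
          (auto simp: pointwise_scale_def fun_eq_iff)
    qed
  next
    fix X Y assume *: "X \<in> endos" "Y \<in> endos"
    show "comm X Y \<in> endos" unfolding endos_def comm_def
      using endosD[OF *(1)] endosD[OF *(2)]
      by (auto simp: sv_diff L_diff algebra_simps)
  next
    fix X Y Z assume *: "X \<in> endos" "Y \<in> endos" "Z \<in> endos"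
    note e = endosD[OF *(1)] endosD[OF *(2)] endosD[OF *(3)]
    show "comm (X + Y) Z = comm X Z + comm Y Z"
    proof
      fix \<phi> show "comm (X + Y) Z \<phi> = (comm X Z + comm Y Z) \<phi>"
        by (cases "\<phi> \<in> L") (simp_all add: comm_def e algebra_simps)
    qed
    show "comm X (Y + Z) = comm X Y + comm X Z"
    proof
      fix \<phi> show "comm X (Y + Z) \<phi> = (comm X Y + comm X Z) \<phi>"
        by (cases "\<phi> \<in> L") (simp_all add: comm_def e algebra_simps)
    qed
    show "comm X (comm Y Z) + comm Y (comm Z X) + comm Z (comm X Y) = 0"
    proof
      fix \<phi> show "(comm X (comm Y Z) + comm Y (comm Z X) + comm Z (comm X Y)) \<phi> = 0 \<phi>"
        by (cases "\<phi> \<in> L") (simp_all add: comm_def e L_diff algebra_simps)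
    qed
  next
    fix X Y c assume *: "X \<in> endos" "Y \<in> endos"
    note e = endosD[OF *(1)] endosD[OF *(2)]
    show "comm (pointwise_scale sv c X) Y = pointwise_scale sv c (comm X Y)"
    proof
      fix \<phi> show "comm (pointwise_scale sv c X) Y \<phi> = (pointwise_scale sv c (comm X Y)) \<phi>"
        by (cases "\<phi> \<in> L") (simp_all add: comm_def e pointwise_scale_def[of sv] sv_diff sv_zero)
    qed
    show "comm X (pointwise_scale sv c Y) = pointwise_scale sv c (comm X Y)"
    proof
      fix \<phi> show "comm X (pointwise_scale sv c Y) \<phi> = (pointwise_scale sv c (comm X Y)) \<phi>"
        by (cases "\<phi> \<in> L") (simp_all add: comm_def e pointwise_scale_def[of sv] sv_diff sv_zero)
    qed
  next
    fix X assume *: "X \<in> endos"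
    show "comm X X = 0" by (simp add: comm_def fun_eq_iff)
  qed
qed

lemma res_endos: "res (Hop h) \<in> endos" "res (Eop i) \<in> endos" "res (Fop i) \<in> endos"
  by (auto simp: endos_def res_def op_add op_scale H_L E_L intro: L_intros)

lemma comm_res_EF:
  "comm (res (Eop i)) (res (Fop j)) = (if i = j then res (Hop (\<alpha>c i)) else 0)"
  by (rule ext) (auto simp: comm_def res_def EF L_F E_L op_zero L_zero)

lemma comm_res_HE: "comm (res (Hop h)) (res (Eop i)) = pointwise_scale sv (\<alpha> i h) (res (Eop i))"
  by (rule ext) (auto simp: comm_def res_def HE H_L E_L op_zero L_zero sv_zero pointwise_scale_def[of sv]
      pointwise_scale_def fun_eq_iff)

lemma comm_res_HF: "comm (res (Hop h)) (res (Fop i)) = pointwise_scale sv (- \<alpha> i h) (res (Fop i))"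
  by (rule ext) (auto simp: comm_def res_def HF H_L L_F op_zero L_zero sv_zero pointwise_scale_def[of sv]
      pointwise_scale_def fun_eq_iff)

lemma comm_res_HH: "comm (res (Hop h)) (res (Hop h')) = 0"
  by (rule ext) (auto simp: comm_def res_def HH[of h h'] H_L op_zero L_zero)

sublocale upper: chevalley_on "pointwise_scale sv" endos comm a
  "\<lambda>i. res (Hop (\<alpha>c i))" "\<lambda>i. res (Eop i)" "\<lambda>i. res (Fop i)"
  by unfold_locales
    (auto simp: res_endos a_diag a_zero_sym a_nonpos comm_res_EF comm_res_HE \<alpha>_\<alpha>c)

text \<open>Exchanging e and f gives the second family of Serre relations. As [f_i, e_i] = -h_i, the
  coroots change sign while the matrix stays.\<close>

sublocale lower: chevalley_on "pointwise_scale sv" endos comm a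
  "\<lambda>i. - res (Hop (\<alpha>c i))" "\<lambda>i. res (Fop i)" "\<lambda>i. res (Eop i)"
proof
  show "comm (res (Fop i)) (res (Eop j)) = (if i = j then - res (Hop (\<alpha>c i)) else 0)" for i j
    using endo.br_antisym[of "res (Fop i)" "res (Eop j)"] by (auto simp: res_endos comm_res_EF)
  show "comm (- res (Hop (\<alpha>c i))) (res (Fop j)) = pointwise_scale sv (of_int (a i j)) (res (Fop j))"
    for i j by (simp add: endo.br_minus res_endos comm_res_HF \<alpha>_\<alpha>c)
qed (auto simp: res_endos a_diag a_zero_sym a_nonpos)

lemma u_upper_vac: "upper.u i j k vac = 0"
proof (induction k)
  case 0
  show ?case unfolding upper.u_simps by (simp only: res_def L_vac E_vac if_True)
next
  case (Suc k)
  have "upper.u i j (Suc k) vac = res (Eop i) (upper.u i j k vac) - upper.u i j k (res (Eop i) vac)"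
    unfolding upper.u_simps by (simp only: comm_def)
  also have "res (Eop i) vac = 0" by (simp only: res_def L_vac E_vac if_True)
  also have "upper.u i j k 0 = 0" by (rule endosD(5)) (rule upper.u_C)
  finally show ?case unfolding Suc by (simp only: res_def L_zero op_zero if_True diff_zero)
qed

text \<open>By \<open>upper.f_serre\<close> the element commutes with all \<open>Fop\<close>, and it
  annihilates \<open>vac\<close>; so it annihilates everything that \<open>vac\<close>
  generates.\<close>

lemma serre_upper:
  assumes "i \<noteq> j" shows "(comm (res (Eop i)) ^^ nat (1 - a i j)) (res (Eop j)) = 0"
proof -
  define X where "X = upper.u i j (nat (1 - a i j))"
  have X: "X \<in> endos" by (simp add: X_def)
  have "comm (res (Fop k)) X = 0" for k unfolding X_def by (rule upper.f_serre[OF assms])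
  then have com: "res (Fop k) (X \<phi>) = X (res (Fop k) \<phi>)" for k \<phi>
    by (simp add: comm_def fun_eq_iff)
  have "X \<phi> = 0" if "\<phi> \<in> L" for \<phi> using that
  proof (induction rule: L_induct)
    case vac
    show ?case unfolding X_def by (rule u_upper_vac)
  next
    case (F \<phi> i)
    have "X (Fop i \<phi>) = X (res (Fop i) \<phi>)" using F(1) by (simp only: res_def if_True)
    also have "\<dots> = res (Fop i) 0" by (simp only: com[symmetric] F(2))
    finally show ?case by (simp only: res_def L_zero if_True op_zero)
  qed (simp_all only: endosD[OF X] add_0_left sv_zero)
  then have "X = 0" using endosD(4)[OF X] by fastforce
  then show ?thesis by (simp add: X_def upper.u_def)
qed

lemma u_lower_Nil: "lower.u i j k \<phi> [] = 0"
proof (induction k arbitrary: \<phi>)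
  case 0
  show ?case unfolding lower.u_simps by (simp add: res_def Fop_def)
next
  case (Suc k)
  have "lower.u i j (Suc k) \<phi> [] = res (Fop i) (lower.u i j k \<phi>) [] - lower.u i j k (res (Fop i) \<phi>) []"
    unfolding lower.u_simps by (simp only: comm_def minus_apply)
  also have "\<dots> = 0" unfolding Suc.IH by (simp add: res_def Fop_def)
  finally show ?case .
qed

text \<open>Dually, the element commutes with all \<open>Eop\<close>, which shorten the support, and
  its values vanish at the empty word because those of every \<open>Fop\<close> do. A function is
  determined by its value at the empty word and its images under all \<open>Eop\<close>.\<close>

lemma serre_lower:
  assumes "i \<noteq> j" shows "(comm (res (Fop i)) ^^ nat (1 - a i j)) (res (Fop j)) = 0"
proof -
  define X where "X = lower.u i j (nat (1 - a i j))"
  have X: "X \<in> endos" by (simp add: X_def)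
  have "comm (res (Eop k)) X = 0" for k unfolding X_def by (rule lower.f_serre[OF assms])
  then have com: "res (Eop k) (X \<phi>) = X (res (Eop k) \<phi>)" for k \<phi>
    by (simp add: comm_def fun_eq_iff)
  have "X \<phi> = 0" if "\<phi> \<in> L" "\<forall>w. length w \<ge> n \<longrightarrow> \<phi> w = 0" for \<phi> n using that
  proof (induction n arbitrary: \<phi>)
    case 0
    then have "\<phi> = 0" by auto
    then show ?case by (simp only: endosD(5)[OF X])
  next
    case (Suc n)
    have "Eop k (X \<phi>) = 0" for k
    proof -
      have "X (Eop k \<phi>) = 0" by (rule Suc.IH) (use Suc.prems E_L in \<open>auto simp: Eop_def\<close>)
      then show ?thesis using com[of k \<phi>] Suc.prems(1) endosD(1)[OF X Suc.prems(1)]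
        by (simp add: res_def)
    qed
    then have "X \<phi> (k # w) = 0" for k w by (simp add: Eop_def fun_eq_iff)
    moreover have "X \<phi> [] = 0" unfolding X_def by (rule u_lower_Nil)
    ultimately have "X \<phi> w = 0" for w by (cases w) auto
    then show ?case by auto
  qed
  then have "X \<phi> = 0" if "\<phi> \<in> L" for \<phi> using L_finite_support[OF that] that by blast
  then have "X = 0" using endosD(4)[OF X] by fastforce
  then show ?thesis by (simp add: X_def lower.u_def)
qed

fun rep :: "('h, 'n) km_gen \<Rightarrow> ('n list \<Rightarrow> 'f) \<Rightarrow> 'n list \<Rightarrow> 'f" where
  "rep (H h) = res (Hop h)"
| "rep (E i) = res (Eop i)"
| "rep (F i) = res (Fop i)"

end

lemma lie_eval_funpow_Bracket:
  "lie_eval s b \<iota> ((Bracket t ^^ k) u) = (b (lie_eval s b \<iota> t) ^^ k) (lie_eval s b \<iota> u)"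
  by (induction k) auto

context highest_weight_module
begin

lemma rep_relations:
  fixes A :: "int^'n^'n"
  assumes A: "\<And>i j. A $ i $ j = a i j" and "(t, u) \<in> km_relations A sH \<alpha> \<alpha>c"
  shows "lie_eval (pointwise_scale sv) comm rep t = lie_eval (pointwise_scale sv) comm rep u"
  using assms(2)
proof cases
  case (H_plus h h')
  then show ?thesis by (auto simp: res_def Hop_add_left)
next
  case (H_scale c h)
  have "res (Hop (sH c h)) = pointwise_scale sv c (res (Hop h))"
    by (rule ext) (simp add: res_def Hop_scale_left pointwise_scale_def[of sv] sv_zero)
  with H_scale show ?thesis by simp
qed (simp_all add: comm_res_EF comm_res_HE comm_res_HF comm_res_HH lie_eval_funpow_Bracket A
    serre_upper serre_lower)

lemma lie_cong_rep:
  fixes A :: "int^'n^'n"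
  assumes A: "\<And>i j. A $ i $ j = a i j" and "lie_cong (km_relations A sH \<alpha> \<alpha>c) t u"
  shows "lie_eval (pointwise_scale sv) comm rep t = lie_eval (pointwise_scale sv) comm rep u"
proof (rule endo.lie_cong_sound[OF _ _ assms(2)])
  fix x show "rep x \<in> endos" by (cases x) (simp_all add: res_endos)
qed (rule rep_relations[OF A])

end

lemma kac_moody_H_eq_0:
  fixes A :: "int^'n::finite^'n" and \<iota> :: "('h::ab_group_add, 'n) km_gen \<Rightarrow> 'g::ab_group_add"
  assumes A: "generalized_cartan_matrix A" and km: "kac_moody_algebra A sH \<alpha> \<alpha>c s b \<iota>"
    and 0: "\<iota> (H h) = 0"
  shows "h = 0"
proof (rule ccontr)
  assume "h \<noteq> 0"
  from km have re: "realization A sH \<alpha> \<alpha>c" and pr: "lie_presented_by s b \<iota> (km_relations A sH \<alpha> \<alpha>c)"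
    by (auto simp: kac_moody_algebra_def)
  \<comment> \<open>With \<Lambda> h = 1 the element h acts on \<open>vac\<close> by 1, so it cannot
    be zero in \<gg>.\<close>
  from exists_separating_functional[OF _ \<open>h \<noteq> 0\<close>, of sH] re obtain \<Lambda> where
    \<Lambda>: "Vector_Spaces.linear sH (*) \<Lambda>" "\<Lambda> h = 1" unfolding realization_def by auto
  interpret W: highest_weight_module sH \<alpha> \<alpha>c "\<lambda>i j. A $ i $ j" \<Lambda>
    by (rule highest_weight_module.intro)
      (use A re \<Lambda> in \<open>auto simp: generalized_cartan_matrix_def realization_def\<close>)
  have "lie_eval s b \<iota> (Gen (H h)) = lie_eval s b \<iota> Zero" using 0 by simp
  then have "lie_cong (km_relations A sH \<alpha> \<alpha>c) (Gen (H h)) Zero"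
    using pr unfolding lie_presented_by_def by blast
  from W.lie_cong_rep[OF HOL.refl this] have "W.rep (H h) = 0" by simp
  then have "W.res (W.Hop h) W.vac = 0" by (simp only: W.rep.simps zero_fun_apply)
  then have "W.Hop h W.vac = 0" by (simp only: W.res_def W.L_vac if_True)
  then have "W.Hop h W.vac [] = 0" by (simp only: zero_fun_apply)
  then show False by (simp add: \<Lambda> W.vac_def W.H_vac pointwise_scale_def)
qed

section \<open>Positive parts, weights and root spaces\<close>

inductive pos_part :: "('f \<Rightarrow> 'g \<Rightarrow> 'g) \<Rightarrow> ('g \<Rightarrow> 'g \<Rightarrow> 'g) \<Rightarrow> ('n::finite \<Rightarrow> 'g::ab_group_add) \<Rightarrow>
    int^'n \<Rightarrow> 'g \<Rightarrow> bool" for s b e where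
  zero: "pos_part s b e \<beta> 0"
| gen: "pos_part s b e (axis i 1) (e i)"
| step: "pos_part s b e \<beta> x \<Longrightarrow> pos_part s b e (axis i 1 + \<beta>) (b (e i) x)"
| add: "pos_part s b e \<beta> x \<Longrightarrow> pos_part s b e \<beta> y \<Longrightarrow> pos_part s b e \<beta> (x + y)"
| scale: "pos_part s b e \<beta> x \<Longrightarrow> pos_part s b e \<beta> (s c x)"

definition ht :: "int^'n::finite \<Rightarrow> int" where "ht \<beta> = (\<Sum>i\<in>UNIV. \<beta> $ i)"

lemma ht_simps [simp]: "ht 0 = 0" "ht (\<beta> + \<delta>) = ht \<beta> + ht \<delta>" "ht (- \<beta>) = - ht \<beta>"
  "ht (\<beta> - \<delta>) = ht \<beta> - ht \<delta>" "ht (axis i c) = c"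
  by (auto simp: ht_def sum.distrib sum_negf sum_subtractf axis_def)

lemma vec_0_le_uminus: "0 \<le> - \<beta> \<longleftrightarrow> \<beta> \<le> 0" for \<beta> :: "int^'n::finite"
  by (simp add: less_eq_vec_def)

lemma ht_nonneg: "0 \<le> \<beta> \<Longrightarrow> 0 \<le> ht \<beta>"
  by (auto simp: ht_def less_eq_vec_def intro: sum_nonneg)

lemma ht_eq_0: "0 \<le> \<beta> \<Longrightarrow> ht \<beta> = 0 \<Longrightarrow> \<beta> = 0"
  unfolding ht_def less_eq_vec_def by (subst (asm) sum_nonneg_eq_0_iff) (auto simp: vec_eq_iff)

lemma ht_pos: "0 \<le> \<beta> \<Longrightarrow> \<beta> \<noteq> 0 \<Longrightarrow> 0 < ht \<beta>"
  using ht_nonneg[of \<beta>] ht_eq_0[of \<beta>] by linarith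

context lie_algebra
begin

lemma b_add: "b (x + y) z = b x z + b y z" "b z (x + y) = b z x + b z y"
  and b_scale: "b (s c x) y = s c (b x y)" "b x (s c y) = s c (b x y)"
  using bracket_linear_left[of z] bracket_linear_right[of z]
    bracket_linear_left[of y] bracket_linear_right[of x]
  by (auto simp: Vector_Spaces.linear_iff)

lemma b_zero [simp]: "b 0 x = 0" "b x 0 = 0"
  using b_scale[of 0 0 x] b_scale(2)[of x 0 0] by auto

lemma b_minus: "b (- x) y = - b x y" "b x (- y) = - b x y"
  using b_scale(1)[of "-1" x y] b_scale(2)[of x "-1" y] by auto

lemma b_diff: "b (x - y) z = b x z - b y z" "b z (x - y) = b z x - b z y"
  using b_add(1)[of x "- y" z] b_add(2)[of z x "- y"] by (auto simp: b_minus)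

lemma b_antisym: "b x y = - b y x"
proof -
  have "b y x + b x y = 0"
    using bracket_self[of "x + y"] bracket_self[of x] bracket_self[of y] by (simp add: b_add)
  then show ?thesis by (metis add.commute eq_neg_iff_add_eq_0)
qed

lemma b_leibniz: "b x (b y z) = b (b x y) z + b y (b x z)"
proof -
  have "b x (b y z) + b y (b z x) + b z (b x y) = 0" by (rule local.jacobi)
  moreover have "b y (b z x) = - b y (b x z)" "b z (b x y) = - b (b x y) z"
    using b_antisym[of z x] b_antisym[of z "b x y"] by (simp_all add: b_minus)
  ultimately show ?thesis by (simp add: algebra_simps)
qed

lemma b_sum: "b x (sum g B) = (\<Sum>y\<in>B. b x (g y))"
  by (induction B rule: infinite_finite_induct) (auto simp: b_add)

end

text \<open>These consequences of the presentation are symmetric under exchanging e and f and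
  replacing h by -h, which \<open>swap\<close> exploits. The presentation itself comes back in the
  construction of the cobracket.\<close>

locale kac_moody = lie_algebra s b
  for s :: "'f::field_char_0 \<Rightarrow> 'g::ab_group_add \<Rightarrow> 'g" and b +
  fixes sH :: "'f \<Rightarrow> 'h::ab_group_add \<Rightarrow> 'h"
    and \<alpha> :: "'n::finite \<Rightarrow> 'h \<Rightarrow> 'f" and \<alpha>c :: "'n \<Rightarrow> 'h" and a :: "'n \<Rightarrow> 'n \<Rightarrow> int"
    and Hm :: "'h \<Rightarrow> 'g" and e f :: "'n \<Rightarrow> 'g"
  assumes Hm_linear: "Vector_Spaces.linear sH s Hm" and Hm_eq_0: "Hm h = 0 \<Longrightarrow> h = 0"
    and \<alpha>_linear: "Vector_Spaces.linear sH (*) (\<alpha> i)"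
    and \<alpha>_\<alpha>c: "\<alpha> i (\<alpha>c j) = of_int (a j i)"
    and \<alpha>_indep: "(\<And>h. (\<Sum>i\<in>UNIV. c i * \<alpha> i h) = 0) \<Longrightarrow> c i = 0"
    and \<alpha>c_indep: "(\<Sum>i\<in>UNIV. sH (c i) (\<alpha>c i)) = 0 \<Longrightarrow> c i = 0"
    and a_diag: "a i i = 2" and a_zero_sym: "a i j = 0 \<Longrightarrow> a j i = 0"
    and a_nonpos: "i \<noteq> j \<Longrightarrow> a i j \<le> 0"
    and a_connected: "i \<in> S \<Longrightarrow> (\<And>i j. i \<in> S \<Longrightarrow> a i j \<noteq> 0 \<Longrightarrow> j \<in> S) \<Longrightarrow> k \<in> S"
    and HH: "b (Hm h) (Hm h') = 0"
    and He: "b (Hm h) (e i) = s (\<alpha> i h) (e i)"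
    and Hf: "b (Hm h) (f i) = s (- \<alpha> i h) (f i)"
    and ef: "b (e i) (f j) = (if i = j then Hm (\<alpha>c i) else 0)"
    and serre_e: "i \<noteq> j \<Longrightarrow> (b (e i) ^^ nat (1 - a i j)) (e j) = 0"
    and serre_f: "i \<noteq> j \<Longrightarrow> (b (f i) ^^ nat (1 - a i j)) (f j) = 0"
    and generated: "subspace U \<Longrightarrow> (\<And>h. Hm h \<in> U) \<Longrightarrow> (\<And>i. e i \<in> U) \<Longrightarrow> (\<And>i. f i \<in> U) \<Longrightarrow>
      (\<And>x y. x \<in> U \<Longrightarrow> y \<in> U \<Longrightarrow> b x y \<in> U) \<Longrightarrow> x \<in> U"
begin

lemma Hm_add: "Hm (h + h') = Hm h + Hm h'" and Hm_scale: "Hm (sH c h) = s c (Hm h)"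
  using Hm_linear by (auto simp: Vector_Spaces.linear_iff)

lemma \<alpha>_add: "\<alpha> i (h + h') = \<alpha> i h + \<alpha> i h'" and \<alpha>_scale: "\<alpha> i (sH c h) = c * \<alpha> i h"
  using \<alpha>_linear by (auto simp: Vector_Spaces.linear_iff)

abbreviation hc :: "'n \<Rightarrow> 'g" where "hc i \<equiv> Hm (\<alpha>c i)"

lemma fe: "b (f i) (e j) = (if i = j then - hc i else 0)"
  using b_antisym[of "f i" "e j"] by (auto simp: ef)

lemma eH: "b (e i) (Hm h) = s (- \<alpha> i h) (e i)" and fH: "b (f i) (Hm h) = s (\<alpha> i h) (f i)"
  using b_antisym[of "e i" "Hm h"] b_antisym[of "f i" "Hm h"] by (auto simp: He Hf)

definition wt :: "int^'n \<Rightarrow> 'h \<Rightarrow> 'f" where "wt \<beta> h = (\<Sum>i\<in>UNIV. of_int (\<beta> $ i) * \<alpha> i h)"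

lemma wt_simps [simp]: "wt 0 h = 0" "wt (\<beta> + \<delta>) h = wt \<beta> h + wt \<delta> h" "wt (- \<beta>) h = - wt \<beta> h"
  "wt (\<beta> - \<delta>) h = wt \<beta> h - wt \<delta> h" "wt (axis i 1) h = \<alpha> i h"
  by (auto simp: wt_def sum.distrib sum_negf sum_subtractf algebra_simps axis_def if_distrib
      if_distribR cong: if_cong)

text \<open>By independence of the simple roots and characteristic 0, a degree in the root lattice
  is determined by its \<hh>-weight. So the grading can be read off from eigenvalues.\<close>

lemma wt_inj: assumes "\<And>h. wt \<beta> h = wt \<delta> h" shows "\<beta> = \<delta>"
proof -
  have "of_int ((\<beta> - \<delta>) $ i) = (0::'f)" for i
  proof (rule \<alpha>_indep)
    show "(\<Sum>i\<in>UNIV. of_int ((\<beta> - \<delta>) $ i) * \<alpha> i h) = 0" for h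
      using assms[of h] wt_simps(4)[of \<beta> \<delta> h] unfolding wt_def by simp
  qed
  then show ?thesis by (simp add: vec_eq_iff)
qed

definition pairing :: "'n \<Rightarrow> int^'n \<Rightarrow> int" where "pairing i \<beta> = (\<Sum>j\<in>UNIV. a i j * \<beta> $ j)"

lemma wt_\<alpha>c: "wt \<beta> (\<alpha>c i) = of_int (pairing i \<beta>)"
  by (simp add: wt_def pairing_def \<alpha>_\<alpha>c mult.commute)

definition gs :: "int^'n \<Rightarrow> 'g set" where "gs \<beta> = {x. \<forall>h. b (Hm h) x = s (wt \<beta> h) x}"

lemma gsD: "x \<in> gs \<beta> \<Longrightarrow> b (Hm h) x = s (wt \<beta> h) x" by (simp add: gs_def)

lemma gsD': "x \<in> gs \<beta> \<Longrightarrow> b x (Hm h) = s (- wt \<beta> h) x"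
  using b_antisym[of x "Hm h"] by (simp add: gs_def)

lemma gs_subspace: "subspace (gs \<beta>)"
  unfolding subspace_def gs_def by (auto simp: b_add b_scale scale_right_distrib mult.commute)

lemma gs_closed [simp]: "0 \<in> gs \<beta>" "x \<in> gs \<beta> \<Longrightarrow> y \<in> gs \<beta> \<Longrightarrow> x + y \<in> gs \<beta>"
  "x \<in> gs \<beta> \<Longrightarrow> s c x \<in> gs \<beta>" "x \<in> gs \<beta> \<Longrightarrow> - x \<in> gs \<beta>"
  using gs_subspace[of \<beta>] by (auto simp: subspace_0 subspace_add subspace_scale subspace_neg)

lemma gs_b: "x \<in> gs \<beta> \<Longrightarrow> y \<in> gs \<delta> \<Longrightarrow> b x y \<in> gs (\<beta> + \<delta>)"
  by (auto simp: gs_def b_leibniz[of "Hm _"] b_scale scale_left_distrib)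

lemma gs_gens [simp]: "e i \<in> gs (axis i 1)" "f i \<in> gs (- axis i 1)" "Hm h \<in> gs 0"
  by (auto simp: gs_def He Hf HH)

text \<open>Subtracting from \<open>b (Hm h)\<close> its eigenvalue on one summand, with h
  separating two weights, removes that summand and rescales another by a nonzero factor.\<close>

lemma gs_independent:
  assumes "finite B" "\<And>\<beta>. \<beta> \<in> B \<Longrightarrow> c \<beta> \<in> gs \<beta>" "(\<Sum>\<beta>\<in>B. c \<beta>) = 0" "\<beta> \<in> B"
  shows "c \<beta> = 0"
  using assms
proof (induction B arbitrary: c \<beta> rule: finite_induct)
  case (insert \<delta> B)
  have cB: "c \<beta> = 0" if "\<beta> \<in> B" for \<beta>
  proof -
    have "\<exists>h. wt \<beta> h \<noteq> wt \<delta> h" using wt_inj[of \<beta> \<delta>] that insert.hyps(2) by blast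
    then obtain h where h: "wt \<beta> h \<noteq> wt \<delta> h" by blast
    have "s (wt \<beta> h - wt \<delta> h) (c \<beta>) = 0"
    proof (rule insert.IH)
      have "0 = b (Hm h) (\<Sum>\<beta>\<in>insert \<delta> B. c \<beta>) - s (wt \<delta> h) (\<Sum>\<beta>\<in>insert \<delta> B. c \<beta>)"
        by (simp add: insert.prems(2))
      also have "\<dots> = (\<Sum>\<beta>\<in>insert \<delta> B. s (wt \<beta> h - wt \<delta> h) (c \<beta>))"
        unfolding b_sum scale_sum_right sum_subtractf[symmetric]
        by (intro sum.cong) (auto simp: gsD[OF insert.prems(1)] scale_left_diff_distrib)
      finally show "(\<Sum>\<beta>\<in>B. s (wt \<beta> h - wt \<delta> h) (c \<beta>)) = 0"
        using insert.hyps by simp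
    qed (use insert.prems that in auto)
    then show ?thesis using h by simp
  qed
  moreover have "c \<delta> = 0" using insert.prems(2) insert.hyps cB by simp
  ultimately show ?case using insert.prems(3) by auto
qed simp

subsection \<open>The triangular decomposition\<close>

text \<open>Only left-normed brackets of generators are formed; that they span together with \<hh>
  is \<open>span_all_gens\<close>. The generators are a parameter of \<open>pos_part\<close>, so the
  negative part is the same notion for f, with its degree counted positively.\<close>

abbreviation pos where "pos \<equiv> pos_part s b e"
abbreviation neg where "neg \<beta> \<equiv> pos_part s b f (- \<beta>)"

lemma pos_gs: "pos \<beta> x \<Longrightarrow> x \<in> gs \<beta>"
  by (induction rule: pos_part.induct) (auto intro: gs_b)

lemma pos_nonneg: "pos \<beta> x \<Longrightarrow> x = 0 \<or> (0 \<le> \<beta> \<and> \<beta> \<noteq> 0)"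
proof (induction rule: pos_part.induct)
  case (step \<beta> x i)
  then show ?case
    by (auto simp: less_eq_vec_def vec_eq_iff axis_def add_nonneg_eq_0_iff) 
qed (auto simp: less_eq_vec_def axis_def vec_eq_iff)

text \<open>In a degree that is a multiple of one simple root only e_k can be involved, and already
  [e_k, e_k] = 0.\<close>

lemma pos_multiple:
  "pos \<beta> x \<Longrightarrow> \<beta> = axis k c \<Longrightarrow> (c = 1 \<longrightarrow> (\<exists>t. x = s t (e k))) \<and> (c \<noteq> 1 \<longrightarrow> x = 0)"
proof (induction arbitrary: c rule: pos_part.induct)
  case (zero \<beta>)
  then show ?case by (auto intro: exI[of _ 0])
next
  case (gen i)
  then have "i = k \<and> c = 1" by (auto simp: axis_eq_axis)
  then show ?case by (auto intro: exI[of _ 1])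
next
  case (step \<beta> x i)
  show ?case
  proof (cases "x = 0")
    case True
    then show ?thesis by (auto intro: exI[of _ 0])
  next
    case False
    then have \<beta>: "0 \<le> \<beta>" "\<beta> \<noteq> 0" using pos_nonneg[OF step.hyps] by auto
    have eq: "\<beta> = axis k c - axis i 1" using step.prems by (metis add_diff_cancel_left')
    have ik: "i = k"
    proof (rule ccontr)
      assume "i \<noteq> k"
      then have "\<beta> $ i = - 1" unfolding eq by (simp add: axis_def)
      then show False using \<beta>(1) by (auto simp: less_eq_vec_def dest: spec[of _ i])
    qed
    have \<beta>': "\<beta> = axis k (c - 1)" unfolding eq ik by (simp add: vec_eq_iff axis_def)
    then have "0 < c - 1" using ht_pos[OF \<beta>] by simp
    with step.IH[OF \<beta>'] ik show ?thesis by (auto simp: b_scale bracket_self)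
  qed
next
  case (add \<beta> x y)
  then show ?case by (metis add_0 scale_left_distrib)
next
  case (scale \<beta> x d)
  then show ?case by (metis scale_scale scale_zero_right)
qed

text \<open>An explicit form of the derived algebra (\<open>derived_eq_dg\<close>): both triangular
  parts, but only the coroots from \<hh>. Through it, vanishing on Chevalley generators extends to
  the whole derived algebra.\<close>

definition dg_gens :: "'g set" where
  "dg_gens = range hc \<union> {x. \<exists>\<beta>. pos \<beta> x} \<union> {x. \<exists>\<beta>. pos_part s b f \<beta> x}"
definition dg :: "'g set" where "dg = span dg_gens"

lemma dg_subspace: "subspace dg" by (simp add: dg_def)

text \<open>The generator f_i moves inwards by the Leibniz rule. Where it meets e_i it leaves a
  coroot, which acts on the homogeneous rest by a scalar.\<close>

lemma b_f_pos: assumes "pos \<beta> x"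
  shows "b (f i) x \<in> span (range hc \<union> {x. \<exists>\<beta>. pos \<beta> x})" (is "_ \<in> span ?P")
  using assms
proof (induction rule: pos_part.induct)
  case (gen j)
  show ?case by (auto simp: fe span_zero intro!: span_neg intro: span_base)
next
  case (step \<beta> x j)
  have "b (e j) y \<in> span ?P" if "y \<in> span ?P" for y using that
  proof (induction rule: span_induct_alt)
    case (step c z w)
    have "b (e j) z \<in> span ?P"
    proof (cases "z \<in> range hc")
      case True
      have "s c (e j) \<in> span ?P" for c using pos_part.gen[of s b e j]
        by (auto intro!: span_scale intro: span_base)
      with True show ?thesis by (auto simp: eH simp del: scale_minus_left)
    next
      case False
      then show ?thesis using step by (auto intro!: span_base pos_part.step)
    qed
    then show ?case using step by (auto simp: b_add b_scale intro!: span_add span_scale)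
  qed (simp add: span_zero)
  moreover have "b (b (f i) (e j)) x \<in> span ?P"
  proof -
    have "x \<in> span ?P" using step.hyps by (auto intro: span_base)
    then have "b (hc j) x \<in> span ?P" by (simp add: gsD[OF pos_gs[OF step.hyps]] span_scale)
    then show ?thesis by (auto simp: fe b_minus span_zero intro: span_neg)
  qed
  ultimately show ?case using step.IH by (simp add: b_leibniz[of "f i"] span_add)
qed (auto simp: span_zero b_add b_scale intro: span_add span_scale)

text \<open>No automorphism of \<gg> is involved: the same algebra is read with renamed generators.
  Statements about positive degrees thereby hold for negative ones, \<open>gs \<beta>\<close>
  becoming \<open>gs (- \<beta>)\<close>.\<close>

lemma swap: "kac_moody s b sH \<alpha> \<alpha>c a (\<lambda>h. - Hm h) f e"
proof (rule kac_moody.intro[OF lie_algebra_axioms], rule kac_moody_axioms.intro)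
  show "Vector_Spaces.linear sH s (\<lambda>h. - Hm h)"
    using Hm_linear by (auto simp: Vector_Spaces.linear_iff scale_right_diff_distrib)
  show "(\<Sum>i\<in>UNIV. sH (c i) (\<alpha>c i)) = 0 \<Longrightarrow> c i = 0" for c i by (rule \<alpha>c_indep)
  show "(\<And>h. (\<Sum>i\<in>UNIV. c i * \<alpha> i h) = 0) \<Longrightarrow> c i = 0" for c i by (rule \<alpha>_indep)
  show "k \<in> S" if "i \<in> S" "\<And>i j. i \<in> S \<Longrightarrow> a i j \<noteq> 0 \<Longrightarrow> j \<in> S" for i k S
    using a_connected[of i S k] that by blast
  show "x \<in> U" if "subspace U" "\<And>h. - Hm h \<in> U" "\<And>i. f i \<in> U" "\<And>i. e i \<in> U"
    "\<And>x y. x \<in> U \<Longrightarrow> y \<in> U \<Longrightarrow> b x y \<in> U" for U x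
  proof (rule generated[OF that(1) _ that(4,3,5)])
    show "Hm h \<in> U" for h using subspace_neg[OF that(1) that(2)[of h]] by simp
  qed
qed (auto simp: Hm_eq_0 \<alpha>_linear \<alpha>_\<alpha>c a_diag a_zero_sym a_nonpos b_minus HH He Hf fe serre_e serre_f)

lemma swap_gs: "kac_moody.gs s b \<alpha> (\<lambda>h. - Hm h) \<beta> = gs (- \<beta>)"
proof -
  interpret sw: kac_moody s b sH \<alpha> \<alpha>c a "\<lambda>h. - Hm h" f e by (rule swap)
  show ?thesis by (auto simp: sw.gs_def gs_def b_minus minus_equation_iff[of _ "s _ _"])
qed

lemma dg_base: "x \<in> dg_gens \<Longrightarrow> x \<in> dg" by (simp add: dg_def span_base)

lemma pos_dg: "pos \<beta> x \<Longrightarrow> x \<in> dg" and neg_dg: "pos_part s b f \<beta> x \<Longrightarrow> x \<in> dg"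
  and hc_dg: "hc i \<in> dg"
  by (auto simp: dg_gens_def intro!: dg_base)

lemma ef_dg: "e i \<in> dg" "f i \<in> dg"
  using pos_dg[OF pos_part.gen] neg_dg[OF pos_part.gen] by auto

definition all_gens :: "'g set" where
  "all_gens = range Hm \<union> {x. \<exists>\<beta>. pos \<beta> x} \<union> {x. \<exists>\<beta>. pos_part s b f \<beta> x}"

lemma neg_gs: "pos_part s b f \<beta> x \<Longrightarrow> x \<in> gs (- \<beta>)"
proof -
  interpret sw: kac_moody s b sH \<alpha> \<alpha>c a "\<lambda>h. - Hm h" f e by (rule swap)
  show "pos_part s b f \<beta> x \<Longrightarrow> x \<in> gs (- \<beta>)" using sw.pos_gs swap_gs by blast
qed

lemma b_gen_dg:
  assumes "x \<in> all_gens" shows "b (e i) x \<in> dg" "b (f i) x \<in> dg" "b (Hm h) x \<in> dg"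
proof -
  interpret sw: kac_moody s b sH \<alpha> \<alpha>c a "\<lambda>h. - Hm h" f e by (rule swap)
  have P: "span (range hc \<union> {x. \<exists>\<beta>. pos \<beta> x}) \<subseteq> dg"
    unfolding dg_def dg_gens_def by (rule span_mono) auto
  have N: "span (range (\<lambda>i. - hc i) \<union> {x. \<exists>\<beta>. pos_part s b f \<beta> x}) \<subseteq> dg"
    by (rule span_minimal) (auto simp: dg_subspace hc_dg neg_dg intro: subspace_neg)
  have sc: "s c (e i) \<in> dg" "s c (f i) \<in> dg" for c i
    using ef_dg by (auto intro: subspace_scale[OF dg_subspace])
  consider h' where "x = Hm h'" | \<beta> where "pos \<beta> x" | \<beta> where "pos_part s b f \<beta> x"
    using assms by (auto simp: all_gens_def)
  then have "b (e i) x \<in> dg \<and> b (f i) x \<in> dg \<and> b (Hm h) x \<in> dg"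
  proof cases
    case 1
    then show ?thesis using sc by (auto simp: eH fH HH subspace_0[OF dg_subspace] simp del: scale_minus_left)
  next
    case 2
    then show ?thesis using P b_f_pos[OF 2] pos_dg[OF pos_part.step[OF 2]] pos_dg[OF 2]
      by (auto simp: gsD[OF pos_gs[OF 2]] intro: subspace_scale[OF dg_subspace])
  next
    case 3
    then show ?thesis using N sw.b_f_pos[OF 3] neg_dg[OF pos_part.step[OF 3]] neg_dg[OF 3]
      by (auto simp: gsD[OF neg_gs[OF 3]] intro!: subspace_scale[OF dg_subspace] simp del: scale_minus_left)
  qed
  then show "b (e i) x \<in> dg" "b (f i) x \<in> dg" "b (Hm h) x \<in> dg" by auto
qed

lemma dg_all: "dg \<subseteq> span all_gens"
  unfolding dg_def dg_gens_def all_gens_def by (rule span_mono) auto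

text \<open>The elements that map the span of \<open>all_gens\<close> into \<open>dg\<close> form a
  subalgebra, because \<open>dg\<close> lies in that span. It contains the generators, so it is all
  of \<gg>.\<close>

lemma b_all_dg: assumes "y \<in> span all_gens" shows "b x y \<in> dg"
proof -
  define K where "K = {x. \<forall>y\<in>span all_gens. b x y \<in> dg}"
  have K: "g \<in> K" if "\<And>x. x \<in> all_gens \<Longrightarrow> b g x \<in> dg" for g
    unfolding K_def
  proof (rule CollectI, rule ballI)
    fix y assume "y \<in> span all_gens"
    then show "b g y \<in> dg"
      by (induction rule: span_induct_alt) (simp_all add: b_add b_scale that subspace_0[OF dg_subspace]
          subspace_add[OF dg_subspace] subspace_scale[OF dg_subspace])
  qed
  have "x \<in> K"
  proof (rule generated)
    show "subspace K" unfolding subspace_def K_def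
      by (auto simp: b_add b_scale intro: subspace_0 subspace_add subspace_scale dg_subspace)
    show "b x y \<in> K" if "x \<in> K" "y \<in> K" for x y unfolding K_def
    proof (rule CollectI, rule ballI)
      fix z assume z: "z \<in> span all_gens"
      have "b (b x y) z = b x (b y z) - b y (b x z)" by (simp add: b_leibniz[of x y z])
      moreover have "b x (b y z) \<in> dg" "b y (b x z) \<in> dg"
        using that z dg_all unfolding K_def by blast+
      ultimately show "b (b x y) z \<in> dg" by (simp add: subspace_diff[OF dg_subspace])
    qed
  qed (auto intro!: K b_gen_dg)
  then show ?thesis using assms by (simp add: K_def)
qed

lemma span_all_gens: "x \<in> span all_gens"
proof (rule generated[OF subspace_span])
  show "e i \<in> span all_gens" "f i \<in> span all_gens" for i
    using ef_dg dg_all by auto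
  show "b x y \<in> span all_gens" if "y \<in> span all_gens" for x y
    using b_all_dg[OF that] dg_all by auto
qed (auto simp: all_gens_def intro: span_base)

lemma b_dg: "b x y \<in> dg" by (rule b_all_dg[OF span_all_gens])

definition V :: "int^'n \<Rightarrow> 'g set" where
  "V \<beta> = span ({x. pos \<beta> x} \<union> {x. neg \<beta> x} \<union> (if \<beta> = 0 then range Hm else {}))"

lemma V_subspace: "subspace (V \<beta>)"
  by (simp add: V_def)

lemma V_gs: "V \<beta> \<subseteq> gs \<beta>"
  unfolding V_def by (rule span_minimal) (use neg_gs[of "- \<beta>"] in \<open>auto simp: gs_subspace pos_gs split: if_splits\<close>)

definition decomp :: "'g \<Rightarrow> (int^'n \<Rightarrow> 'g) \<Rightarrow> bool" where
  "decomp x c \<longleftrightarrow> finite {\<beta>. c \<beta> \<noteq> 0} \<and> (\<forall>\<beta>. c \<beta> \<in> gs \<beta>) \<and> x = (\<Sum>\<beta> | c \<beta> \<noteq> 0. c \<beta>)"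

lemma decomp_sum: "decomp x c \<Longrightarrow> finite B \<Longrightarrow> {\<beta>. c \<beta> \<noteq> 0} \<subseteq> B \<Longrightarrow> x = sum c B"
  unfolding decomp_def by (metis (mono_tags, lifting) DiffD2 mem_Collect_eq sum.mono_neutral_left)

lemma decompI: "finite B \<Longrightarrow> (\<And>\<beta>. c \<beta> \<in> gs \<beta>) \<Longrightarrow> (\<And>\<beta>. \<beta> \<notin> B \<Longrightarrow> c \<beta> = 0) \<Longrightarrow> x = sum c B \<Longrightarrow> decomp x c"
  unfolding decomp_def by (auto intro: finite_subset[of _ B] intro!: sum.mono_neutral_right)

lemma decomp_add: assumes "decomp x c" "decomp y d" shows "decomp (x + y) (\<lambda>\<beta>. c \<beta> + d \<beta>)"
proof (rule decompI)
  let ?B = "{\<beta>. c \<beta> \<noteq> 0} \<union> {\<beta>. d \<beta> \<noteq> 0}"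
  show fin: "finite ?B" using assms by (simp add: decomp_def)
  show "x + y = (\<Sum>\<beta>\<in>?B. c \<beta> + d \<beta>)"
    using decomp_sum[OF assms(1) fin] decomp_sum[OF assms(2) fin] by (simp add: sum.distrib)
qed (use assms in \<open>auto simp: decomp_def\<close>)

lemma decomp_scale: assumes "decomp x c" shows "decomp (s t x) (\<lambda>\<beta>. s t (c \<beta>))"
proof (rule decompI)
  show fin: "finite {\<beta>. c \<beta> \<noteq> 0}" using assms by (simp add: decomp_def)
  show "s t x = (\<Sum>\<beta>\<in>{\<beta>. c \<beta> \<noteq> 0}. s t (c \<beta>))"
    using decomp_sum[OF assms fin] by (simp add: scale_sum_right)
qed (use assms in \<open>auto simp: decomp_def\<close>)

lemma decomp_single: "x \<in> gs \<beta> \<Longrightarrow> decomp x (\<lambda>\<delta>. if \<delta> = \<beta> then x else 0)"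
  by (rule decompI[of "{\<beta>}"]) auto

lemma decomp_unique: assumes "decomp x c" "decomp x d" shows "c = d"
proof
  fix \<beta>
  let ?B = "insert \<beta> ({\<beta>. c \<beta> \<noteq> 0} \<union> {\<beta>. d \<beta> \<noteq> 0})"
  have fin: "finite ?B" using assms by (simp add: decomp_def)
  have "x = sum c ?B" "x = sum d ?B"
    using decomp_sum[OF assms(1) fin] decomp_sum[OF assms(2) fin] by auto
  then have "(\<Sum>\<delta>\<in>?B. c \<delta> + - d \<delta>) = 0" by (simp add: sum_subtractf del: sum.insert)
  from gs_independent[OF fin _ this, of \<beta>] show "c \<beta> = d \<beta>"
    using assms by (auto simp: decomp_def simp del: add_uminus_conv_diff) (simp add: eq_neg_iff_add_eq_0)
qed

lemma decomp_exists: "\<exists>c. decomp x c \<and> (\<forall>\<beta>. c \<beta> \<in> V \<beta>)"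
proof -
  have "x \<in> span all_gens" by (rule span_all_gens)
  then show ?thesis
  proof (induction rule: span_induct_alt)
    case base
    show ?case by (intro exI[of _ "\<lambda>_. 0"]) (auto simp: V_def span_zero intro: decompI[of "{}"])
  next
    case (step t x y)
    then obtain c where c: "decomp y c" "\<forall>\<beta>. c \<beta> \<in> V \<beta>" by blast
    obtain \<beta> where \<beta>: "x \<in> V \<beta>"
    proof -
      consider h where "x = Hm h" | \<beta> where "pos \<beta> x" | \<beta> where "pos_part s b f \<beta> x"
        using step by (auto simp: all_gens_def)
      then show ?thesis
      proof cases
        case 1
        then show ?thesis using that[of 0] by (auto simp: V_def intro: span_base)
      next
        case 2
        then show ?thesis using that[of \<beta>] by (auto simp: V_def intro: span_base)
      next
        case 3
        then show ?thesis using that[of "- \<beta>"] by (auto simp: V_def intro: span_base)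
      qed
    qed
    then have "decomp x (\<lambda>\<delta>. if \<delta> = \<beta> then x else 0)" using V_gs by (auto intro: decomp_single)
    from decomp_add[OF decomp_scale[OF this] c(1)] show ?case
      by (intro exI[of _ "\<lambda>\<delta>. s t (if \<delta> = \<beta> then x else 0) + c \<delta>"])
        (use c(2) \<beta> in \<open>auto intro: subspace_add[OF V_subspace] subspace_scale[OF V_subspace]\<close>)
  qed
qed

text \<open>A weight vector has a decomposition with components in the \<open>V \<beta>\<close> and
  a trivial one with a single component; uniqueness identifies them. So each root space is spanned
  by brackets of generators of one sign, apart from \<hh> in degree 0.\<close>

lemma gs_eq_V: "gs \<beta> = V \<beta>"
proof
  show "gs \<beta> \<subseteq> V \<beta>"
  proof
    fix x assume "x \<in> gs \<beta>"
    obtain c where c: "decomp x c" "\<And>\<beta>. c \<beta> \<in> V \<beta>" using decomp_exists by blast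
    from decomp_unique[OF c(1) decomp_single[OF \<open>x \<in> gs \<beta>\<close>]] c(2)[of \<beta>] show "x \<in> V \<beta>" by simp
  qed
qed (rule V_gs)

definition pr :: "int^'n \<Rightarrow> 'g \<Rightarrow> 'g" where "pr \<beta> x = (THE c. decomp x c) \<beta>"

lemma decomp_pr: "decomp x (\<lambda>\<beta>. pr \<beta> x)"
  and pr_eq: "decomp x c \<Longrightarrow> pr \<beta> x = c \<beta>"
proof -
  have ex: "\<exists>!c. decomp x c" for x using decomp_exists decomp_unique by blast
  show "decomp x (\<lambda>\<beta>. pr \<beta> x)" unfolding pr_def using theI'[OF ex] by simp
  show "decomp x c \<Longrightarrow> pr \<beta> x = c \<beta>" unfolding pr_def using the1_equality[OF ex] by simp
qed

lemma pr_add: "pr \<beta> (x + y) = pr \<beta> x + pr \<beta> y"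
  using pr_eq[OF decomp_add[OF decomp_pr decomp_pr]] .

lemma pr_scale: "pr \<beta> (s c x) = s c (pr \<beta> x)"
  using pr_eq[OF decomp_scale[OF decomp_pr]] .

lemma pr_gs [simp]: "pr \<beta> x \<in> gs \<beta>"
  using decomp_pr by (simp add: decomp_def)

lemma pr_same: "x \<in> gs \<beta> \<Longrightarrow> pr \<delta> x = (if \<delta> = \<beta> then x else 0)"
  using pr_eq[OF decomp_single] .

lemma sum_pr: "x = (\<Sum>\<beta> | pr \<beta> x \<noteq> 0. pr \<beta> x)" and finite_pr: "finite {\<beta>. pr \<beta> x \<noteq> 0}"
  using decomp_pr[of x] by (simp_all add: decomp_def)

lemma gs_0: assumes "x \<in> gs 0" shows "\<exists>h. x = Hm h"
proof -
  interpret sw: kac_moody s b sH \<alpha> \<alpha>c a "\<lambda>h. - Hm h" f e by (rule swap)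
  have "x \<in> V 0" using assms by (simp add: gs_eq_V)
  moreover have "V 0 \<subseteq> range Hm" unfolding V_def
  proof (rule span_minimal)
    show "subspace (range Hm)"
      by (auto simp: subspace_def Hm_add[symmetric] Hm_scale[symmetric])
        (metis Hm_scale rangeI scale_zero_left)
    have "0 \<in> range Hm" by (metis Hm_scale rangeI scale_zero_left)
    then show "{x. pos 0 x} \<union> {x. neg 0 x} \<union> (if 0 = (0::int^'n) then range Hm else {}) \<subseteq> range Hm"
      using pos_nonneg[of 0] sw.pos_nonneg[of 0] by fastforce
  qed
  ultimately show ?thesis by auto
qed

lemma gs_pos: assumes "x \<in> gs \<beta>" "0 \<le> \<beta>" "\<beta> \<noteq> 0" shows "pos \<beta> x"
proof -
  interpret sw: kac_moody s b sH \<alpha> \<alpha>c a "\<lambda>h. - Hm h" f e by (rule swap)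
  have "x \<in> V \<beta>" using assms by (simp add: gs_eq_V)
  moreover have "V \<beta> \<subseteq> {x. pos \<beta> x}" unfolding V_def
  proof (rule span_minimal)
    show "subspace {x. pos \<beta> x}" by (auto simp: subspace_def intro: pos_part.intros)
    have "x = 0" if "neg \<beta> x" for x
      using sw.pos_nonneg[OF that] assms(2,3) by (auto simp: vec_0_le_uminus)
    then show "{x. pos \<beta> x} \<union> {x. neg \<beta> x} \<union> (if \<beta> = 0 then range Hm else {}) \<subseteq> {x. pos \<beta> x}"
      using assms(3) by (auto intro: pos_part.zero)
  qed
  ultimately show ?thesis by auto
qed

lemma gs_eq_0: assumes "x \<in> gs \<beta>" "\<not> 0 \<le> \<beta>" "\<not> \<beta> \<le> 0" shows "x = 0"
proof -
  interpret sw: kac_moody s b sH \<alpha> \<alpha>c a "\<lambda>h. - Hm h" f e by (rule swap)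
  have "x \<in> V \<beta>" using assms by (simp add: gs_eq_V)
  moreover have "V \<beta> \<subseteq> {0}" unfolding V_def
    by (rule span_minimal)
      (use assms(2,3) pos_nonneg[of \<beta>] sw.pos_nonneg[of "- \<beta>"] in \<open>auto simp: subspace_single_0 vec_0_le_uminus\<close>)
  ultimately show ?thesis by auto
qed

lemma gs_simple: "x \<in> gs (axis k 1) \<Longrightarrow> \<exists>t. x = s t (e k)"
  using gs_pos[of x "axis k 1"] pos_multiple[of "axis k 1" x k 1]
  by (auto simp: less_eq_vec_def axis_def vec_eq_iff)

end

section \<open>Tensors, and cocycles on a presented algebra\<close>

context lie_algebra
begin

abbreviation lf :: "('g \<Rightarrow> 'f) \<Rightarrow> bool" where "lf \<equiv> Vector_Spaces.linear s (*)"

lemma lf_simps: "lf \<phi> \<Longrightarrow> \<phi> (x + y) = \<phi> x + \<phi> y" "lf \<phi> \<Longrightarrow> \<phi> (s c x) = c * \<phi> x"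
  by (auto simp: Vector_Spaces.linear_iff)

lemma lf_b: "lf \<phi> \<Longrightarrow> lf (\<lambda>y. \<phi> (b x y))"
  by (auto simp: Vector_Spaces.linear_iff b_add b_scale)

lemma lf_zero: "lf \<phi> \<Longrightarrow> \<phi> 0 = 0"
  using lf_simps(2)[of \<phi> 0 0] by simp

lemma lf_minus: "lf \<phi> \<Longrightarrow> \<phi> (- x) = - \<phi> x"
  using lf_simps(2)[of \<phi> "-1" x] by simp

text \<open>The tensor \<open>a \<otimes> c\<close> is represented by its contraction \<open>\<phi> \<mapsto> \<phi>(a) c\<close> with linear functionals,
  together with its image \<open>[a, c]\<close> under the bracket (which the contraction determines, see
  \<open>contraction_determines_bracket\<close>).\<close>

definition tens :: "'g \<Rightarrow> 'g \<Rightarrow> (('g \<Rightarrow> 'f) \<Rightarrow> 'g) \<times> 'g" where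
  "tens a c = (\<lambda>\<phi>. if lf \<phi> then s (\<phi> a) c else 0, b a c)"

definition wedge where "wedge a c = tens a c - tens c a"

text \<open>The diagonal adjoint action: contracting [x, a] \<otimes> c with \<phi> is contracting a
  \<otimes> c with \<open>\<lambda>y. \<phi> (b x y)\<close>. Additivity in x depends on linearity
  of the contraction in \<phi>, which is why it is stated on \<open>TS\<close>.\<close>

definition act :: "'g \<Rightarrow> (('g \<Rightarrow> 'f) \<Rightarrow> 'g) \<times> 'g \<Rightarrow> (('g \<Rightarrow> 'f) \<Rightarrow> 'g) \<times> 'g" where
  "act x T = (\<lambda>\<phi>. if lf \<phi> then fst T (\<lambda>y. \<phi> (b x y)) + b x (fst T \<phi>) else 0, b x (snd T))"

definition scN :: "'f \<Rightarrow> (('g \<Rightarrow> 'f) \<Rightarrow> 'g) \<times> 'g \<Rightarrow> (('g \<Rightarrow> 'f) \<Rightarrow> 'g) \<times> 'g" where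
  "scN c T = (\<lambda>\<phi>. s c (fst T \<phi>), s c (snd T))"

sublocale N: vector_space scN
  by unfold_locales (auto simp: scN_def prod_eq_iff fun_eq_iff scale_right_distrib scale_left_distrib)

definition TS where "TS = N.span (range (\<lambda>(a, c). tens a c))"

lemma tens_TS [simp]: "tens a c \<in> TS"
  unfolding TS_def by (rule N.span_base) auto

lemma TS_closed [simp]: "0 \<in> TS" "T \<in> TS \<Longrightarrow> U \<in> TS \<Longrightarrow> T + U \<in> TS" "T \<in> TS \<Longrightarrow> scN c T \<in> TS"
  "T \<in> TS \<Longrightarrow> U \<in> TS \<Longrightarrow> T - U \<in> TS" "T \<in> TS \<Longrightarrow> - T \<in> TS"
  by (auto simp: TS_def N.span_zero N.span_add N.span_scale N.span_diff N.span_neg)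

lemma wedge_TS [simp]: "wedge a c \<in> TS" by (simp add: wedge_def)

lemma TS_induct [consumes 1, case_names zero step]:
  assumes "T \<in> TS" "P 0" "\<And>a c T. T \<in> TS \<Longrightarrow> P T \<Longrightarrow> P (tens a c + T)"
  shows "P T"
proof -
  have eq: "scN t (tens a c) = tens (s t a) c" for t a c
    by (auto simp: scN_def tens_def fun_eq_iff lf_simps b_scale)
  have "T \<in> N.span (range (\<lambda>(a, c). tens a c))" using assms(1) by (simp add: TS_def)
  then have "T \<in> TS \<and> P T"
  proof (induction rule: N.span_induct_alt)
    case (step c x y)
    then obtain a d where x: "x = tens a d" by auto
    from step show ?case using assms(3)[of y "s c a" d] by (simp add: x eq)
  qed (simp add: assms(2))
  then show ?thesis by simp
qed

lemma tens_add: "tens (a + a') c = tens a c + tens a' c" "tens a (c + c') = tens a c + tens a c'"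
  by (auto simp: tens_def fun_eq_iff lf_simps b_add scale_left_distrib scale_right_distrib)

lemma tens_scale: "tens (s t a) c = scN t (tens a c)" "tens a (s t c) = scN t (tens a c)"
  by (auto simp: tens_def scN_def fun_eq_iff lf_simps b_scale mult.commute)

lemma tens_zero [simp]: "tens 0 c = 0" "tens a 0 = 0"
  using tens_scale(1)[of 0 0 c] tens_scale(2)[of a 0 0] by simp_all

lemma tens_minus: "tens (- a) c = - tens a c" "tens a (- c) = - tens a c"
  using tens_scale(1)[of "-1" a c] tens_scale(2)[of a "-1" c] by simp_all

lemma wedge_simps: "wedge (a + a') c = wedge a c + wedge a' c" "wedge a (c + c') = wedge a c + wedge a c'"
  "wedge (s t a) c = scN t (wedge a c)" "wedge a (s t c) = scN t (wedge a c)"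
  "wedge (- a) c = - wedge a c" "wedge a (- c) = - wedge a c" "wedge 0 c = 0" "wedge a 0 = 0"
  "wedge a a = 0"
  by (simp_all add: wedge_def tens_add tens_scale tens_minus N.scale_right_diff_distrib)

lemma wedge_antisym: "wedge a c = - wedge c a"
  by (simp add: wedge_def)

lemma act_add: "act x (T + U) = act x T + act x U"
  by (auto simp: act_def fun_eq_iff b_add)

lemma act_scale: "act x (scN c T) = scN c (act x T)"
  by (auto simp: act_def scN_def fun_eq_iff b_scale scale_right_distrib)

lemma act_zero [simp]: "act x 0 = 0"
  using act_scale[of x 0 0] by simp

lemma act_minus: "act x (- T) = - act x T"
  using act_scale[of x "-1" T] by simp

lemma act_diff: "act x (T - U) = act x T - act x U"
  using act_add[of x T "- U"] by (simp add: act_minus)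

lemma act_tens: "act x (tens a c) = tens (b x a) c + tens a (b x c)"
  by (auto simp: act_def tens_def fun_eq_iff lf_b b_scale b_leibniz[of x a c])

lemma act_wedge: "act x (wedge a c) = wedge (b x a) c + wedge a (b x c)"
  by (simp add: wedge_def act_diff act_tens)

lemma act_TS [simp]: "T \<in> TS \<Longrightarrow> act x T \<in> TS"
  by (induction rule: TS_induct) (simp_all add: act_add act_tens)

lemma act_add_left: "T \<in> TS \<Longrightarrow> act (x + y) T = act x T + act y T"
  by (induction rule: TS_induct) (simp_all add: act_add act_tens b_add tens_add algebra_simps)

lemma act_scale_left: "T \<in> TS \<Longrightarrow> act (s c x) T = scN c (act x T)"
  by (induction rule: TS_induct)
    (simp_all add: act_add act_tens b_scale tens_scale N.scale_right_distrib)

lemma act_b: "T \<in> TS \<Longrightarrow> act (b x y) T = act x (act y T) - act y (act x T)"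
proof (induction rule: TS_induct)
  case (step a c T)
  have "tens a (c - d) = tens a c - tens a d" "tens (a - d) c = tens a c - tens d c" for a c d
    using tens_add(1)[of a "- d" c] tens_add(2)[of a c "- d"] by (simp_all add: tens_minus)
  moreover have "b (b x y) z = b x (b y z) - b y (b x z)" for z using b_leibniz[of x y z] by simp
  ultimately show ?case using step by (simp add: act_add act_tens)
qed simp

text \<open>In a basis with coordinate functionals \<open>co u\<close>, a tensor T is the sum of u
  \<otimes> T(co u), so its bracket is the sum of [u, T(co u)]. Which finitely many u occur depends
  on T; asking for the formula on every larger finite set makes it additive.\<close>

lemma contraction_determines_bracket:
  assumes "T \<in> TS" "\<And>\<phi>. lf \<phi> \<Longrightarrow> fst T \<phi> = 0" shows "snd T = 0"
proof -
  define U where "U = extend_basis {}"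
  have U: "independent U" "span U = UNIV"
    using independent_extend_basis[of "{}"] span_extend_basis[of "{}"] by (simp_all add: U_def independent_empty)
  define co where "co u x = representation U x u" for u x
  have co: "lf (co u)" for u
    unfolding Vector_Spaces.linear_iff co_def using U
    by (auto simp: representation_add representation_scale)
      (unfold_locales, auto simp: algebra_simps)
  have "\<exists>W. finite W \<and> (\<forall>W'. finite W' \<longrightarrow> W \<subseteq> W' \<longrightarrow> snd T = (\<Sum>u\<in>W'. b u (fst T (co u))))"
    using assms(1)
  proof (induction rule: TS_induct)
    case (step a c T)
    then obtain W where W: "finite W"
      "\<And>W'. finite W' \<Longrightarrow> W \<subseteq> W' \<Longrightarrow> snd T = (\<Sum>u\<in>W'. b u (fst T (co u)))" by blast
    define X where "X = {u. co u a \<noteq> 0}"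
    have X: "finite X" unfolding X_def co_def by (rule finite_representation)
    have "snd (tens a c + T) = (\<Sum>u\<in>W'. b u (fst (tens a c + T) (co u)))"
      if W': "finite W'" "W \<union> X \<subseteq> W'" for W'
    proof -
      have "a = (\<Sum>u\<in>X. s (co u a) u)"
        using sum_nonzero_representation_eq[OF U(1), of a] U(2) by (simp add: X_def co_def)
      also have "\<dots> = (\<Sum>u\<in>W'. s (co u a) u)"
        using W' by (intro sum.mono_neutral_left) (auto simp: X_def)
      finally have a: "a = (\<Sum>u\<in>W'. s (co u a) u)" .
      have neg: "- b c x = b x c" for x using b_antisym[of x c] by simp
      have "b a c = - b c a" by (rule b_antisym)
      also have "b c a = b c (\<Sum>u\<in>W'. s (co u a) u)" by (rule arg_cong[OF a])
      also have "- \<dots> = (\<Sum>u\<in>W'. - b c (s (co u a) u))" by (simp only: b_sum sum_negf)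
      also have "\<dots> = (\<Sum>u\<in>W'. b (s (co u a) u) c)" by (simp only: neg)
      finally have "b a c = (\<Sum>u\<in>W'. b (s (co u a) u) c)" .
      then show ?thesis using W(2)[OF W'(1)] W'(2)
        by (simp add: tens_def co b_add b_scale sum.distrib)
    qed
    then show ?case using W(1) X by (intro exI[of _ "W \<union> X"]) auto
  qed auto
  then show ?thesis using assms(2)[OF co] by fastforce
qed

definition scS where "scS c p = (s c (fst p), scN c (snd p))"
definition brS where "brS p q = (b (fst p) (fst q), act (fst p) (snd q) - act (fst q) (snd p))"

abbreviation SD :: "('g \<times> (('g \<Rightarrow> 'f) \<Rightarrow> 'g) \<times> 'g) set" where "SD \<equiv> UNIV \<times> TS"

sublocale semidirect: lie_on scS SD brS
proof -
  interpret V: vector_space scS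
    by unfold_locales (rule prod_eqI; simp add: scS_def scale_right_distrib scale_left_distrib
        N.scale_right_distrib N.scale_left_distrib)+
  show "lie_on scS (SD) brS"
  proof unfold_locales
    show "V.subspace (SD)" by (auto simp: V.subspace_def scS_def mem_Times_iff)
  next
    fix p q assume "p \<in> SD" "q \<in> SD"
    then show "brS p q \<in> SD" by (auto simp: brS_def)
  next
    fix p q r assume pqr: "p \<in> SD" "q \<in> SD" "r \<in> SD"
    then have T: "snd p \<in> TS" "snd q \<in> TS" "snd r \<in> TS" by (simp_all add: mem_Times_iff)
    show "brS (p + q) r = brS p r + brS q r" "brS p (q + r) = brS p q + brS p r"
      by (rule prod_eqI; simp add: T brS_def b_add act_add act_add_left)+
    show "brS p (brS q r) + brS q (brS r p) + brS r (brS p q) = 0"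
      using local.jacobi[of "fst p" "fst q" "fst r"]
      by (intro prod_eqI[of _ "0 :: 'g \<times> _"]) (simp_all add: T brS_def act_b act_diff)
  next
    fix p q c assume pq: "p \<in> SD" "q \<in> SD"
    then have T: "snd p \<in> TS" "snd q \<in> TS" by (simp_all add: mem_Times_iff)
    show "brS (scS c p) q = scS c (brS p q)" "brS p (scS c q) = scS c (brS p q)"
      by (rule prod_eqI; simp add: T brS_def scS_def b_scale act_scale act_scale_left
          N.scale_right_diff_distrib)+
  next
    fix p assume "p \<in> SD"
    show "brS p p = 0" by (intro prod_eqI[of _ "0 :: 'g \<times> _"]) (simp_all add: brS_def bracket_self)
  qed
qed

text \<open>A 1-cocycle \<delta> is the same as a homomorphism x \<mapsto> (x, \<delta> x) into the
  semidirect product with \<open>TS\<close> as abelian ideal. Such a homomorphism may be prescribed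
  on generators once the relations hold; \<open>lie_cong_sound\<close> makes the choice of a term
  for x immaterial.\<close>

lemma presented_cocycle:
  assumes pr: "lie_presented_by s b \<iota> R" and \<rho>: "\<And>x. \<rho> x \<in> TS"
    and R: "\<And>t u. (t, u) \<in> R \<Longrightarrow>
      lie_eval scS brS (\<lambda>x. (\<iota> x, \<rho> x)) t = lie_eval scS brS (\<lambda>x. (\<iota> x, \<rho> x)) u"
  shows "\<exists>\<delta>. (\<forall>x. \<delta> x \<in> TS) \<and> (\<forall>x y. \<delta> (x + y) = \<delta> x + \<delta> y) \<and> (\<forall>c x. \<delta> (s c x) = scN c (\<delta> x)) \<and>
    (\<forall>x y. \<delta> (b x y) = act x (\<delta> y) - act y (\<delta> x)) \<and> (\<forall>x. \<delta> (\<iota> x) = \<rho> x)"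
proof -
  define ev where "ev = lie_eval scS brS (\<lambda>x. (\<iota> x, \<rho> x))"
  have fst_ev: "fst (ev t) = lie_eval s b \<iota> t" for t
    by (induction t) (auto simp: ev_def scS_def brS_def)
  have mem: "(\<iota> x, \<rho> x) \<in> SD" for x using \<rho> by simp
  have snd_ev: "snd (ev t) \<in> TS" for t
    using semidirect.lie_eval_in_C[OF mem, where t = t] unfolding ev_def by (auto simp: mem_Times_iff)
  define tm where "tm x = (SOME t. lie_eval s b \<iota> t = x)" for x
  define \<delta> where "\<delta> x = snd (ev (tm x))" for x
  have tm: "lie_eval s b \<iota> (tm x) = x" for x
    unfolding tm_def using pr unfolding lie_presented_by_def surj_def by (metis (mono_tags) someI_ex)
  have \<delta>: "\<delta> (lie_eval s b \<iota> t) = snd (ev t)" for t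
  proof -
    have "lie_cong R (tm (lie_eval s b \<iota> t)) t"
      using pr tm unfolding lie_presented_by_def by blast
    from semidirect.lie_cong_sound[OF mem R this] show ?thesis by (simp add: \<delta>_def ev_def)
  qed
  show ?thesis
  proof (intro exI[of _ \<delta>] conjI allI)
    show "\<delta> x \<in> TS" for x by (simp add: \<delta>_def snd_ev)
    show "\<delta> (x + y) = \<delta> x + \<delta> y" for x y
      using \<delta>[of "Plus (tm x) (tm y)"] by (simp add: tm \<delta>_def ev_def)
    show "\<delta> (s c x) = scN c (\<delta> x)" for c x
      using \<delta>[of "Scale c (tm x)"] by (simp add: tm \<delta>_def ev_def scS_def)
    show "\<delta> (b x y) = act x (\<delta> y) - act y (\<delta> x)" for x y
      using \<delta>[of "Bracket (tm x) (tm y)"] fst_ev[of "tm x"] fst_ev[of "tm y"]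
      by (simp add: tm \<delta>_def ev_def brS_def)
    show "\<delta> (\<iota> x) = \<rho> x" for x using \<delta>[of "Gen x"] by (simp add: ev_def)
  qed
qed

end

section \<open>Local nilpotency and sl2 theory\<close>

context kac_moody
begin

text \<open>By the Leibniz rule each application of x falls on one of the factors, so k + l
  applications exhaust at least one of them.\<close>

lemma funpow_b_eq_0:
  assumes "(b x ^^ k) y = 0" "(b x ^^ l) z = 0" shows "(b x ^^ (k + l)) (b y z) = 0"
  using assms
proof (induction "k + l" arbitrary: k l y z)
  case (Suc n)
  have pow: "(b x ^^ n) (v + w) = (b x ^^ n) v + (b x ^^ n) w" for v w
    by (induction n) (auto simp: b_add)
  have step: "(b x ^^ j) w = 0 \<Longrightarrow> j > 0 \<Longrightarrow> (b x ^^ (j - 1)) (b x w) = 0" for j w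
    by (cases j) (auto simp: funpow_swap1)
  have z: "(b x ^^ n) 0 = 0" by (induction n) auto
  have "(b x ^^ n) (b (b x y) z) = 0"
  proof (cases k)
    case (Suc k')
    then show ?thesis using Suc.hyps(1)[of k' l "b x y" z] Suc.hyps(2) Suc.prems step[of k y] by simp
  qed (use Suc.prems z in auto)
  moreover have "(b x ^^ n) (b y (b x z)) = 0"
  proof (cases l)
    case (Suc l')
    then show ?thesis using Suc.hyps(1)[of k l' y "b x z"] Suc.hyps(2) Suc.prems step[of l z] by simp
  qed (use Suc.prems z in auto)
  ultimately have "(b x ^^ n) (b x (b y z)) = 0" unfolding b_leibniz[of x y z] by (simp add: pow)
  then show ?case by (simp add: Suc.hyps(2)[symmetric] funpow_swap1)
qed simp

text \<open>By \<open>funpow_b_eq_0\<close> the elements killed by some power form a subalgebra, so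
  it suffices to treat the generators. For f_j with j \<noteq> i this is the Serre relation.\<close>

lemma f_locally_nilpotent: "\<exists>k. (b (f i) ^^ k) x = 0"
proof -
  have add: "(b y ^^ k) (v + w) = (b y ^^ k) v + (b y ^^ k) w" for y v w k
    by (induction k) (auto simp: b_add)
  have scale: "(b y ^^ k) (s c v) = s c ((b y ^^ k) v)" for y v c k
    by (induction k) (auto simp: b_scale)
  have zero: "(b y ^^ k) 0 = 0" for y k by (induction k) auto
  have mono: "(b y ^^ (k + l)) v = 0" "(b y ^^ (l + k)) v = 0" if "(b y ^^ k) v = 0" for y k l v
    using that by (simp_all add: funpow_add zero add.commute[of k l])
  have "x \<in> {x. \<exists>k. (b (f i) ^^ k) x = 0}"
  proof (rule generated)
    show "subspace {x. \<exists>k. (b (f i) ^^ k) x = 0}"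
    proof (rule subspaceI)
      show "0 \<in> {x. \<exists>k. (b (f i) ^^ k) x = 0}" by (auto intro: exI[of _ 0])
      show "v + w \<in> {x. \<exists>k. (b (f i) ^^ k) x = 0}"
        if "v \<in> {x. \<exists>k. (b (f i) ^^ k) x = 0}" "w \<in> {x. \<exists>k. (b (f i) ^^ k) x = 0}" for v w
      proof -
        from that obtain k l where "(b (f i) ^^ k) v = 0" "(b (f i) ^^ l) w = 0" by auto
        then have "(b (f i) ^^ (k + l)) (v + w) = 0" by (simp add: add mono)
        then show ?thesis by blast
      qed
    qed (auto simp: scale intro: exI)
    show "Hm h \<in> {x. \<exists>k. (b (f i) ^^ k) x = 0}" for h
      by (auto intro!: exI[of _ 2] simp: numeral_2_eq_2 fH b_scale bracket_self)
    show "f j \<in> {x. \<exists>k. (b (f i) ^^ k) x = 0}" for j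
      using serre_f[of i j] bracket_self[of "f i"]
      by (cases "i = j") (auto intro: exI[of _ 1])
    \<comment> \<open>The exponent 3 comes from the string e_i, -h_i, a multiple of f_i, 0.\<close>
    show "e j \<in> {x. \<exists>k. (b (f i) ^^ k) x = 0}" for j
      by (cases "i = j") (auto intro!: exI[of _ 3] simp: numeral_3_eq_3 fe fH b_scale b_minus bracket_self)
  qed (use funpow_b_eq_0 in blast)
  then show ?thesis by simp
qed

lemma pairing_simps [simp]: "pairing i (\<beta> + \<gamma>) = pairing i \<beta> + pairing i \<gamma>"
  "pairing i (\<beta> - \<gamma>) = pairing i \<beta> - pairing i \<gamma>" "pairing i (- \<beta>) = - pairing i \<beta>"
  "pairing i (axis j 1) = a i j" "pairing i 0 = 0"
  by (auto simp: pairing_def sum.distrib sum_subtractf sum_negf algebra_simps axis_def if_distrib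
      cong: if_cong)

text \<open>If a vector killed by e_i had negative weight m, the factors (k + 1)(m - k) would never
  vanish, and no power of f_i could kill it, against \<open>f_locally_nilpotent\<close>.\<close>

lemma pairing_nonneg_if_singular:
  assumes "x \<in> gs \<beta>" "x \<noteq> 0" "b (e i) x = 0" shows "0 \<le> pairing i \<beta>"
proof (rule ccontr)
  assume neg: "\<not> 0 \<le> pairing i \<beta>"
  define y where "y k = (b (f i) ^^ k) x" for k
  have y_Suc: "y (Suc k) = b (f i) (y k)" and y_0: "y 0 = x" for k by (simp_all add: y_def)
  have hy: "b (hc i) (y k) = s (of_int (pairing i \<beta> - 2 * int k)) (y k)" for k
  proof (induction k)
    case 0
    then show ?case using gsD[OF assms(1)] by (simp add: y_0 wt_\<alpha>c)
  next
    case (Suc k)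
    have "b (hc i) (y (Suc k)) = s (- 2) (y (Suc k)) + b (f i) (b (hc i) (y k))"
      unfolding y_Suc b_leibniz[of "hc i" "f i"] by (simp add: Hf \<alpha>_\<alpha>c a_diag b_minus b_scale)
    also have "\<dots> = s (- 2 + of_int (pairing i \<beta> - 2 * int k)) (y (Suc k))"
      unfolding Suc.IH by (simp only: b_scale scale_left_distrib y_Suc)
    finally show ?case by (simp add: algebra_simps)
  qed
  have ey: "b (e i) (y (Suc k)) = s (of_int (int (Suc k) * (pairing i \<beta> - int k))) (y k)" for k
  proof (induction k)
    case 0
    then show ?case using hy[of 0] by (simp add: y_Suc y_0 b_leibniz[of "e i" "f i"] ef assms(3))
  next
    case (Suc k)
    have "b (e i) (y (Suc (Suc k))) = b (hc i) (y (Suc k)) + b (f i) (b (e i) (y (Suc k)))"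
      by (simp add: y_Suc[of "Suc k"] b_leibniz[of "e i" "f i"] ef)
    also have "\<dots> = s (of_int (pairing i \<beta> - 2 * int (Suc k)) +
        of_int (int (Suc k) * (pairing i \<beta> - int k))) (y (Suc k))"
      unfolding Suc.IH by (simp only: hy b_scale scale_left_distrib y_Suc[of k, symmetric])
    finally show ?case unfolding of_int_add[symmetric] by (simp add: algebra_simps)
  qed
  have "y k \<noteq> 0" for k
  proof (induction k)
    case (Suc k)
    have "int (Suc k) * (pairing i \<beta> - int k) \<noteq> 0" using neg by simp
    then have "s (of_int (int (Suc k) * (pairing i \<beta> - int k))) (y k) \<noteq> 0"
      using Suc by (simp only: scale_eq_0_iff of_int_eq_0_iff) simp
    then show ?case using ey[of k] by auto
  qed (simp add: y_0 assms(2))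
  then show False using f_locally_nilpotent[of i x] by (simp add: y_def)
qed

lemma fst_scN: "fst (scN c T) \<phi> = s c (fst T \<phi>)" by (simp add: scN_def)
lemma snd_act: "snd (act x T) = b x (snd T)" by (simp add: act_def)
lemma snd_wedge: "snd (wedge x y) = s 2 (b x y)"
  using b_antisym[of y x] by (simp add: wedge_def tens_def scale_left_distrib[of 1 1, simplified])

end

subsection \<open>The standard cobracket of a symmetrizable Kac-Moody algebra\<close>

locale kac_moody_cobracket = kac_moody s b sH \<alpha> \<alpha>c a Hm e f
  for s :: "'f::field_char_0 \<Rightarrow> 'g::ab_group_add \<Rightarrow> 'g" and b
    and sH :: "'f \<Rightarrow> 'h::ab_group_add \<Rightarrow> 'h"
    and \<alpha> :: "'n::finite \<Rightarrow> 'h \<Rightarrow> 'f" and \<alpha>c a Hm e f +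
  fixes \<epsilon> :: "'n \<Rightarrow> int" and \<delta> :: "'g \<Rightarrow> (('g \<Rightarrow> 'f) \<Rightarrow> 'g) \<times> 'g"
  assumes \<epsilon>_pos: "0 < \<epsilon> i" and \<epsilon>_sym: "\<epsilon> i * a i j = \<epsilon> j * a j i"
    and \<delta>_TS: "\<delta> x \<in> TS"
    and \<delta>_add: "\<delta> (x + y) = \<delta> x + \<delta> y" and \<delta>_scale: "\<delta> (s c x) = scN c (\<delta> x)"
    and \<delta>_b: "\<delta> (b x y) = act x (\<delta> y) - act y (\<delta> x)"
    and \<delta>_H: "\<delta> (Hm h) = 0"
    and \<delta>_e: "\<delta> (e i) = scN (of_int (\<epsilon> i)) (wedge (Hm (\<alpha>c i)) (e i))"
    and \<delta>_f: "\<delta> (f i) = scN (of_int (\<epsilon> i)) (wedge (Hm (\<alpha>c i)) (f i))"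
begin

lemma \<delta>_minus: "\<delta> (- x) = - \<delta> x"
  using \<delta>_scale[of "-1" x] by simp

text \<open>The sign of \<delta> compensates for the coroots, which are negated by
  \<open>swap\<close>.\<close>

lemma swap_cobracket:
  "kac_moody_cobracket s b sH \<alpha> \<alpha>c a (\<lambda>h. - Hm h) f e \<epsilon> (\<lambda>x. - \<delta> x)"
proof (rule kac_moody_cobracket.intro[OF swap], rule kac_moody_cobracket_axioms.intro)
qed (auto simp: \<epsilon>_pos \<epsilon>_sym \<delta>_TS \<delta>_add \<delta>_scale \<delta>_b act_minus \<delta>_minus \<delta>_H \<delta>_e \<delta>_f wedge_simps)

sublocale vH: vector_space sH
  using Hm_linear by (auto simp: Vector_Spaces.linear_def)

text \<open>The map from the root lattice to \<hh> induced by the form (\<alpha> i | \<alpha> j) =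
  \<epsilon> i * a i j; accordingly the value in \<open>wt_\<nu>h\<close> is (\<beta> |
  \<beta>).\<close>

definition \<nu>h :: "int^'n \<Rightarrow> 'h" where
  "\<nu>h \<beta> = (\<Sum>i\<in>UNIV. sH (of_int (\<epsilon> i * \<beta> $ i)) (\<alpha>c i))"
abbreviation \<nu> :: "int^'n \<Rightarrow> 'g" where "\<nu> \<beta> \<equiv> Hm (\<nu>h \<beta>)"

lemma \<nu>h_add: "\<nu>h (\<beta> + \<gamma>) = \<nu>h \<beta> + \<nu>h \<gamma>"
  by (simp add: \<nu>h_def sum.distrib[symmetric] vH.scale_left_distrib[symmetric] distrib_left)

lemma \<nu>h_axis: "\<nu>h (axis i 1) = sH (of_int (\<epsilon> i)) (\<alpha>c i)"
proof -
  have "\<nu>h (axis i 1) = (\<Sum>j\<in>UNIV. if j = i then sH (of_int (\<epsilon> i)) (\<alpha>c i) else 0)"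
    unfolding \<nu>h_def by (intro sum.cong) (auto simp: axis_def)
  then show ?thesis by simp
qed

lemma \<alpha>_\<nu>h: "\<alpha> i (\<nu>h \<beta>) = of_int (\<epsilon> i * pairing i \<beta>)"
proof -
  have "\<alpha> i (sum g B) = (\<Sum>j\<in>B. \<alpha> i (g j))" for g and B :: "'n set"
    by (induction B rule: infinite_finite_induct) (auto simp: \<alpha>_add \<alpha>_scale[of i 0, simplified])
  then have "\<alpha> i (\<nu>h \<beta>) = (\<Sum>j\<in>UNIV. of_int (\<epsilon> j * a j i * \<beta> $ j))"
    by (simp add: \<nu>h_def \<alpha>_scale \<alpha>_\<alpha>c ac_simps)
  then show ?thesis by (simp add: pairing_def \<epsilon>_sym[of _ i] sum_distrib_left mult.assoc)
qed

lemma wt_\<nu>h: "wt \<beta> (\<nu>h \<beta>) = of_int (\<Sum>i\<in>UNIV. \<beta> $ i * \<epsilon> i * pairing i \<beta>)"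
  by (simp add: wt_def \<alpha>_\<nu>h mult.assoc)

lemma \<nu>_eq_0: assumes "\<nu> \<beta> = 0" shows "\<beta> = 0"
proof -
  have "\<nu>h \<beta> = 0" using assms by (rule Hm_eq_0)
  then have "of_int (\<epsilon> i * \<beta> $ i) = (0::'f)" for i
    unfolding \<nu>h_def by (rule \<alpha>c_indep)
  then show ?thesis using \<epsilon>_pos by (simp add: vec_eq_iff) (metis less_irrefl)
qed

definition TP :: "int^'n \<Rightarrow> ((('g \<Rightarrow> 'f) \<Rightarrow> 'g) \<times> 'g) set" where
  "TP \<beta> = N.span {tens x y | x y \<beta>1 \<beta>2. x \<in> gs \<beta>1 \<and> y \<in> gs \<beta>2 \<and> \<beta>1 + \<beta>2 = \<beta> \<and>
     0 \<le> \<beta>1 \<and> \<beta>1 \<noteq> 0 \<and> 0 \<le> \<beta>2 \<and> \<beta>2 \<noteq> 0}"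

lemma TP_TS: "T \<in> TP \<beta> \<Longrightarrow> T \<in> TS"
  unfolding TP_def by (induction rule: N.span_induct_alt) auto

lemma tens_TP: "x \<in> gs \<beta>1 \<Longrightarrow> y \<in> gs \<beta>2 \<Longrightarrow> 0 \<le> \<beta>1 \<Longrightarrow> \<beta>1 \<noteq> 0 \<Longrightarrow> 0 \<le> \<beta>2 \<Longrightarrow> \<beta>2 \<noteq> 0 \<Longrightarrow>
    tens x y \<in> TP (\<beta>1 + \<beta>2)"
  unfolding TP_def by (rule N.span_base) blast

lemma wedge_TP: "x \<in> gs \<beta>1 \<Longrightarrow> y \<in> gs \<beta>2 \<Longrightarrow> 0 \<le> \<beta>1 \<Longrightarrow> \<beta>1 \<noteq> 0 \<Longrightarrow> 0 \<le> \<beta>2 \<Longrightarrow> \<beta>2 \<noteq> 0 \<Longrightarrow>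
    wedge x y \<in> TP (\<beta>1 + \<beta>2)"
  using tens_TP[of x \<beta>1 y \<beta>2] tens_TP[of y \<beta>2 x \<beta>1]
  by (simp add: wedge_def TP_def N.span_diff add.commute)

lemma axis_nonneg: "0 \<le> (axis i 1 :: int^'n)" "(axis i 1 :: int^'n) \<noteq> 0"
  by (auto simp: less_eq_vec_def axis_def vec_eq_iff)

lemma axis_add_nonneg: "0 \<le> \<beta> \<Longrightarrow> 0 \<le> axis i 1 + \<beta>" "0 \<le> \<beta> \<Longrightarrow> axis i 1 + \<beta> \<noteq> 0"
  for \<beta> :: "int^'n"
proof -
  assume *: "0 \<le> \<beta>"
  then show "0 \<le> axis i 1 + \<beta>" by (auto simp: less_eq_vec_def axis_def)
  have "ht (axis i 1 + \<beta>) \<noteq> 0" using ht_nonneg[OF *] by simp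
  then show "axis i 1 + \<beta> \<noteq> 0" by (metis ht_simps(1))
qed

lemma act_TP: "T \<in> TP \<beta> \<Longrightarrow> act (e i) T \<in> TP (axis i 1 + \<beta>)"
  unfolding TP_def[of \<beta>]
proof (induction rule: N.span_induct_alt)
  case (step c S T)
  then obtain x y \<beta>1 \<beta>2 where S: "S = tens x y" "x \<in> gs \<beta>1" "y \<in> gs \<beta>2" "\<beta>1 + \<beta>2 = \<beta>"
    "0 \<le> \<beta>1" "\<beta>1 \<noteq> 0" "0 \<le> \<beta>2" "\<beta>2 \<noteq> 0" by blast
  have "tens (b (e i) x) y \<in> TP (axis i 1 + \<beta>)"
    using tens_TP[OF gs_b[OF gs_gens(1) S(2)] S(3), of i] S axis_add_nonneg[of \<beta>1 i]
    by (simp add: add.assoc)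
  moreover have "tens x (b (e i) y) \<in> TP (axis i 1 + \<beta>)"
    using tens_TP[OF S(2) gs_b[OF gs_gens(1) S(3)], of i] S axis_add_nonneg[of \<beta>2 i]
    by (simp only: add.left_commute[of \<beta>1]) simp
  ultimately show ?case using step.IH
    by (simp add: S(1) act_add act_scale act_tens TP_def N.span_add N.span_scale)
qed (simp add: TP_def N.span_zero)

text \<open>In the inductive step the cocycle rule produces the wedge of \<nu> \<beta> +
  \<epsilon>_i h_i with [e_i, x]. Every other term has both factors of positive degree, because
  bracketing an element of \<hh> with a root vector returns a multiple of that root vector.\<close>

lemma \<delta>_pos: "pos \<beta> x \<Longrightarrow> \<exists>T\<in>TP \<beta>. \<delta> x = wedge (\<nu> \<beta>) x + T"
proof (induction rule: pos_part.induct)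
  case (zero \<beta>)
  have "\<delta> 0 = 0" using \<delta>_scale[of 0 0] by simp
  then show ?case by (intro bexI[of _ 0]) (auto simp: wedge_simps TP_def N.span_zero)
next
  case (gen i)
  show ?case by (intro bexI[of _ 0])
      (auto simp: \<delta>_e \<nu>h_axis Hm_scale wedge_simps TP_def N.span_zero)
next
  case (step \<beta> x i)
  show ?case
  proof (cases "x = 0")
    case True
    have "\<delta> 0 = 0" using \<delta>_scale[of 0 0] by simp
    with True show ?thesis by (intro bexI[of _ 0]) (auto simp: wedge_simps TP_def N.span_zero)
  next
    case False
    then have \<beta>: "0 \<le> \<beta>" "\<beta> \<noteq> 0" using pos_nonneg[OF step.hyps] by auto
    have x: "x \<in> gs \<beta>" by (rule pos_gs[OF step.hyps])
    obtain T where T: "T \<in> TP \<beta>" "\<delta> x = wedge (\<nu> \<beta>) x + T" using step.IH by blast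
    define U where "U = wedge (b (e i) (\<nu> \<beta>)) x - scN (of_int (\<epsilon> i)) (wedge (b x (hc i)) (e i)) + act (e i) T"
    have "\<delta> (b (e i) x) = wedge (\<nu> (axis i 1 + \<beta>)) (b (e i) x) + U"
      using b_antisym[of x "e i"]
      by (simp add: \<delta>_b T(2) \<delta>_e act_add act_scale act_wedge U_def \<nu>h_add \<nu>h_axis Hm_add Hm_scale
          wedge_simps N.scale_right_distrib N.scale_right_diff_distrib)
    moreover have "U \<in> TP (axis i 1 + \<beta>)"
    proof -
      have "wedge (b (e i) (\<nu> \<beta>)) x \<in> TP (axis i 1 + \<beta>)"
        using wedge_TP[OF gs_gens(1) x axis_nonneg \<beta>, of i]
        by (simp add: eH wedge_simps TP_def N.span_scale N.span_neg)
      moreover have "wedge (b x (hc i)) (e i) \<in> TP (axis i 1 + \<beta>)"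
        using wedge_TP[OF x gs_gens(1) \<beta> axis_nonneg, of i]
        by (simp add: gsD'[OF x] wedge_simps TP_def N.span_scale N.span_neg add.commute)
      moreover have "act (e i) T \<in> TP (axis i 1 + \<beta>)" by (rule act_TP[OF T(1)])
      ultimately show ?thesis by (simp add: U_def TP_def N.span_add N.span_diff N.span_scale)
    qed
    ultimately show ?thesis by blast
  qed
next
  case (add \<beta> x y)
  then obtain T U where "T \<in> TP \<beta>" "\<delta> x = wedge (\<nu> \<beta>) x + T" "U \<in> TP \<beta>" "\<delta> y = wedge (\<nu> \<beta>) y + U"
    by blast
  then show ?case by (intro bexI[of _ "T + U"]) (auto simp: \<delta>_add wedge_simps TP_def N.span_add)
next
  case (scale \<beta> x c)
  then obtain T where "T \<in> TP \<beta>" "\<delta> x = wedge (\<nu> \<beta>) x + T" by blast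
  then show ?case by (intro bexI[of _ "scN c T"])
      (auto simp: \<delta>_scale wedge_simps TP_def N.span_scale N.scale_right_distrib)
qed

text \<open>Bracket after cobracket is a derivation with eigenvalue 4 \<epsilon>_i on e_i: a factor
  2 from antisymmetrizing and 2 = a i i from [h_i, e_i]. In total this is 4 (\<rho> |
  \<beta>).\<close>

lemma snd_\<delta>_pos: "pos \<beta> x \<Longrightarrow> snd (\<delta> x) = s (of_int (4 * (\<Sum>i\<in>UNIV. \<epsilon> i * \<beta> $ i))) x"
proof (induction rule: pos_part.induct)
  case (zero \<beta>)
  have "\<delta> 0 = 0" using \<delta>_scale[of 0 0] by simp
  then show ?case by simp
next
  case (gen i)
  have "(\<Sum>j\<in>UNIV. \<epsilon> j * (axis i 1 :: int^'n) $ j) = (\<Sum>j\<in>UNIV. if j = i then \<epsilon> i else 0)"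
    by (intro sum.cong) (auto simp: axis_def)
  then show ?case by (simp add: \<delta>_e scN_def snd_wedge He \<alpha>_\<alpha>c a_diag)
next
  case (step \<beta> x i)
  have 1: "(\<Sum>j\<in>UNIV. \<epsilon> j * (axis i 1 + \<beta>) $ j) = \<epsilon> i + (\<Sum>j\<in>UNIV. \<epsilon> j * \<beta> $ j)"
  proof -
    have "(\<Sum>j\<in>UNIV. \<epsilon> j * (axis i 1 :: int^'n) $ j) = (\<Sum>j\<in>UNIV. if j = i then \<epsilon> i else 0)"
      by (intro sum.cong) (auto simp: axis_def)
    then show ?thesis by (simp add: distrib_left sum.distrib)
  qed
  have "snd (\<delta> (b (e i) x)) = b (e i) (snd (\<delta> x)) - b x (snd (\<delta> (e i)))"
    by (simp add: \<delta>_b snd_act)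
  also have "\<dots> = s (of_int (4 * (\<Sum>i\<in>UNIV. \<epsilon> i * \<beta> $ i))) (b (e i) x) + s (of_int (4 * \<epsilon> i)) (b (e i) x)"
    using b_antisym[of x "e i"]
    by (simp add: step.IH \<delta>_e scN_def snd_wedge He \<alpha>_\<alpha>c a_diag b_scale mult.commute)
  finally show ?case unfolding 1 by (simp add: scale_left_distrib distrib_left)
next
  case (add \<beta> x y)
  then show ?case by (simp add: \<delta>_add scale_right_distrib)
next
  case (scale \<beta> x c)
  then show ?case by (simp add: \<delta>_scale scN_def mult.commute)
qed

text \<open>Homogeneous functionals. Contraction with them turns tensors of degree \<beta> into root
  vectors, to which the induction on height in \<open>no_singular_vectors\<close> applies.\<close>

definition supported :: "('g \<Rightarrow> 'f) \<Rightarrow> int^'n \<Rightarrow> bool" where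
  "supported \<phi> \<gamma> \<longleftrightarrow> lf \<phi> \<and> (\<forall>\<gamma>'. \<gamma>' \<noteq> \<gamma> \<longrightarrow> (\<forall>x\<in>gs \<gamma>'. \<phi> x = 0))"

lemma supported_pr: "lf \<phi> \<Longrightarrow> supported (\<lambda>x. \<phi> (pr \<gamma> x)) \<gamma>"
  by (auto simp: supported_def Vector_Spaces.linear_iff pr_add pr_scale pr_same lf_zero)

lemma TP_supported:
  assumes "T \<in> TP \<beta>" "supported \<phi> \<gamma>"
  shows "fst T \<phi> \<in> gs (\<beta> - \<gamma>)"
    and "\<not> (0 \<le> \<gamma> \<and> \<gamma> \<noteq> 0 \<and> 0 \<le> \<beta> - \<gamma> \<and> \<beta> - \<gamma> \<noteq> 0) \<Longrightarrow> fst T \<phi> = 0"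
proof -
  have "fst T \<phi> \<in> gs (\<beta> - \<gamma>) \<and>
    (\<not> (0 \<le> \<gamma> \<and> \<gamma> \<noteq> 0 \<and> 0 \<le> \<beta> - \<gamma> \<and> \<beta> - \<gamma> \<noteq> 0) \<longrightarrow> fst T \<phi> = 0)"
    using assms(1) unfolding TP_def
  proof (induction rule: N.span_induct_alt)
    case (step c S T)
    then obtain x y \<beta>1 \<beta>2 where S: "S = tens x y" "x \<in> gs \<beta>1" "y \<in> gs \<beta>2" "\<beta>1 + \<beta>2 = \<beta>"
      "0 \<le> \<beta>1" "\<beta>1 \<noteq> 0" "0 \<le> \<beta>2" "\<beta>2 \<noteq> 0" by blast
    have *: "fst (scN c S + T) \<phi> = s c (s (\<phi> x) y) + fst T \<phi>"
      using assms(2) by (simp add: S(1) scN_def tens_def supported_def)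
    show ?case
    proof (cases "\<beta>1 = \<gamma>")
      case True
      then have "\<beta> - \<gamma> = \<beta>2" using S(4) by auto
      then show ?thesis using step.IH S True unfolding * by simp
    next
      case False
      then have "\<phi> x = 0" using assms(2) S(2) by (auto simp: supported_def)
      then show ?thesis using step.IH unfolding * by simp
    qed
  qed simp
  then show "fst T \<phi> \<in> gs (\<beta> - \<gamma>)"
    "\<not> (0 \<le> \<gamma> \<and> \<gamma> \<noteq> 0 \<and> 0 \<le> \<beta> - \<gamma> \<and> \<beta> - \<gamma> \<noteq> 0) \<Longrightarrow> fst T \<phi> = 0" by auto
qed

lemma finite_box: "finite {\<gamma>. 0 \<le> \<gamma> \<and> \<gamma> \<le> (\<beta> :: int^'n)}"
proof (rule finite_subset)
  show "finite (vec_lambda ` (\<Pi>\<^sub>E i\<in>UNIV. {0..\<beta> $ i}))"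
    by (intro finite_imageI finite_PiE) auto
  show "{\<gamma>. 0 \<le> \<gamma> \<and> \<gamma> \<le> \<beta>} \<subseteq> vec_lambda ` (\<Pi>\<^sub>E i\<in>UNIV. {0..\<beta> $ i})"
  proof
    fix \<gamma> assume "\<gamma> \<in> {\<gamma>. 0 \<le> \<gamma> \<and> \<gamma> \<le> \<beta>}"
    then have "vec_nth \<gamma> \<in> (\<Pi>\<^sub>E i\<in>UNIV. {0..\<beta> $ i})" by (auto simp: less_eq_vec_def)
    then show "\<gamma> \<in> vec_lambda ` (\<Pi>\<^sub>E i\<in>UNIV. {0..\<beta> $ i})"
      by (metis imageI vec_nth_inverse)
  qed
qed

lemma TP_eq_sum_pr:
  assumes "T \<in> TP \<beta>" "lf \<phi>"
  shows "fst T \<phi> = (\<Sum>\<gamma> | 0 \<le> \<gamma> \<and> \<gamma> \<le> \<beta>. fst T (\<lambda>x. \<phi> (pr \<gamma> x)))"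
  using assms(1) unfolding TP_def
proof (induction rule: N.span_induct_alt)
  case (step c S T)
  then obtain x y \<beta>1 \<beta>2 where S: "S = tens x y" "x \<in> gs \<beta>1" "y \<in> gs \<beta>2" "\<beta>1 + \<beta>2 = \<beta>"
    "0 \<le> \<beta>1" "\<beta>1 \<noteq> 0" "0 \<le> \<beta>2" "\<beta>2 \<noteq> 0" by blast
  have lf: "lf (\<lambda>x. \<phi> (pr \<gamma> x))" for \<gamma> using supported_pr[OF assms(2)] by (simp add: supported_def)
  have mem: "\<beta>1 \<in> {\<gamma>. 0 \<le> \<gamma> \<and> \<gamma> \<le> \<beta>}" using S(4,5,7) by (auto simp: less_eq_vec_def)
  have "(\<Sum>\<gamma> | 0 \<le> \<gamma> \<and> \<gamma> \<le> \<beta>. s (\<phi> (pr \<gamma> x)) y) =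
    (\<Sum>\<gamma> | 0 \<le> \<gamma> \<and> \<gamma> \<le> \<beta>. if \<gamma> = \<beta>1 then s (\<phi> x) y else 0)"
    by (intro sum.cong) (auto simp: pr_same[OF S(2)] lf_zero[OF assms(2)])
  also have "\<dots> = s (\<phi> x) y" using mem by (simp add: finite_box)
  finally show ?case using step.IH
    by (simp add: S(1) scN_def tens_def lf assms(2) sum.distrib scale_sum_right[symmetric]
        del: scale_scale)
qed simp

text \<open>The remainder T of \<delta> x is killed by all f_i. So its contractions lead to singular
  vectors of smaller height, which are 0 by induction, and only the leading term of \<delta> x
  contributes to the bracket. This gives 4 (\<rho> | \<beta>) = 2 (\<beta> | \<beta>) unless x = 0,
  and the signs of the two sides disagree.\<close>

lemma no_singular_vectors:
  assumes "x \<in> gs \<beta>" "0 \<le> \<beta>" "\<beta> \<noteq> 0" "\<And>i. b (f i) x = 0" shows "x = 0"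
  using assms
proof (induction "nat (ht \<beta>)" arbitrary: x \<beta> rule: less_induct)
  case less
  interpret sw: kac_moody s b sH \<alpha> \<alpha>c a "\<lambda>h. - Hm h" f e by (rule swap)
  have pos: "pos \<beta> x" using gs_pos less.prems by blast
  obtain T where T: "T \<in> TP \<beta>" "\<delta> x = wedge (\<nu> \<beta>) x + T" using \<delta>_pos[OF pos] by blast
  \<comment> \<open>The leading term of \<delta> x and the term from \<delta> (f i) cancel: both
    give \<open>\<epsilon> i * pairing i \<beta>\<close> times \<open>wedge (f i) x\<close>.\<close>
  have actT: "act (f i) T = 0" for i
  proof -
    have "act (f i) (\<delta> x) = act x (\<delta> (f i))"
      using \<delta>_b[of "f i" x] \<delta>_scale[of 0 0] by (simp add: less.prems(4))
    moreover have "b x (f i) = 0" using b_antisym[of x "f i"] by (simp add: less.prems(4))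
    ultimately have "act (f i) (wedge (\<nu> \<beta>) x) + act (f i) T =
        scN (- of_int (\<epsilon> i * pairing i \<beta>)) (wedge x (f i))"
      by (simp add: T(2) act_add \<delta>_f act_scale act_wedge gsD'[OF less.prems(1)] wt_\<alpha>c wedge_simps)
    moreover have "act (f i) (wedge (\<nu> \<beta>) x) = scN (of_int (\<epsilon> i * pairing i \<beta>)) (wedge (f i) x)"
      by (simp add: act_wedge fH \<alpha>_\<nu>h less.prems(4) wedge_simps)
    ultimately show ?thesis using wedge_antisym[of x "f i"] by simp
  qed
  have supp_f: "supported (\<lambda>x. \<phi> (b (f i) x)) (\<gamma> + axis i 1)" if "supported \<phi> \<gamma>" for \<phi> \<gamma> i
    unfolding supported_def
  proof (intro conjI allI impI ballI)
    show "lf (\<lambda>x. \<phi> (b (f i) x))" using that lf_b by (simp add: supported_def)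
    fix \<gamma>' y assume \<gamma>': "\<gamma>' \<noteq> \<gamma> + axis i 1" "y \<in> gs \<gamma>'"
    then have "b (f i) y \<in> gs (- axis i 1 + \<gamma>')" "- axis i 1 + \<gamma>' \<noteq> \<gamma>"
      using gs_b[OF gs_gens(2) \<gamma>'(2)] by (simp_all only:) auto
    then show "\<phi> (b (f i) y) = 0" using that by (auto simp: supported_def)
  qed
  \<comment> \<open>Inner induction with growing \<gamma>: \<phi> composed with f_i is supported in
    degree \<gamma> + \<alpha> i, so it contracts T to 0. Invariance of T then makes its contraction
    with \<phi> singular of degree \<beta> - \<gamma>, to which the outer induction applies.\<close>
  have T0: "fst T \<phi> = 0" if "supported \<phi> \<gamma>" for \<phi> \<gamma> using that
  proof (induction "nat (ht (\<beta> - \<gamma>))" arbitrary: \<phi> \<gamma> rule: less_induct)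
    case (less \<gamma> \<phi>)
    show ?case
    proof (rule ccontr)
      assume ne: "fst T \<phi> \<noteq> 0"
      then have \<gamma>: "0 \<le> \<gamma>" "\<gamma> \<noteq> 0" "0 \<le> \<beta> - \<gamma>" "\<beta> - \<gamma> \<noteq> 0"
        using TP_supported(2)[OF T(1) less.prems] by auto
      have h: "0 < ht \<gamma>" "0 < ht (\<beta> - \<gamma>)" using ht_pos[OF \<gamma>(1,2)] ht_pos[OF \<gamma>(3,4)] by simp_all
      have "b (f i) (fst T \<phi>) = 0" for i
      proof -
        have "fst T (\<lambda>x. \<phi> (b (f i) x)) = 0"
          by (rule less.hyps[OF _ supp_f[OF less.prems]]) (use h in simp)
        moreover have "fst (act (f i) T) \<phi> = 0" by (simp add: actT)
        ultimately show ?thesis using less.prems by (simp add: act_def supported_def)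
      qed
      with \<open>fst T \<phi> \<noteq> 0\<close> show False
        using less(1) TP_supported(1)[OF T(1) less.prems] \<gamma> h
          \<open>\<And>x \<beta>'. nat (ht \<beta>') < nat (ht \<beta>) \<Longrightarrow> x \<in> gs \<beta>' \<Longrightarrow> 0 \<le> \<beta>' \<Longrightarrow> \<beta>' \<noteq> 0 \<Longrightarrow>
            (\<And>i. b (f i) x = 0) \<Longrightarrow> x = 0\<close>[of "\<beta> - \<gamma>" "fst T \<phi>"] by auto
    qed
  qed
  have "snd T = 0"
  proof (rule contraction_determines_bracket[OF TP_TS[OF T(1)]])
    fix \<phi> assume "lf \<phi>"
    then show "fst T \<phi> = 0"
      using TP_eq_sum_pr[OF T(1)] T0[OF supported_pr] by simp
  qed
  then have "s (of_int (4 * (\<Sum>i\<in>UNIV. \<epsilon> i * \<beta> $ i))) x = s 2 (b (\<nu> \<beta>) x)"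
    using snd_\<delta>_pos[OF pos] by (simp add: T(2) snd_wedge)
  also have "\<dots> = s (of_int (2 * (\<Sum>i\<in>UNIV. \<beta> $ i * \<epsilon> i * pairing i \<beta>))) x"
    by (simp add: gsD[OF less.prems(1)] wt_\<nu>h)
  finally have eq: "x = 0 \<or> 4 * (\<Sum>i\<in>UNIV. \<epsilon> i * \<beta> $ i) = 2 * (\<Sum>i\<in>UNIV. \<beta> $ i * \<epsilon> i * pairing i \<beta>)"
    by (simp only: scale_cancel_right of_int_eq_iff) blast
  show "x = 0"
  proof (rule ccontr)
    assume "x \<noteq> 0"
    have \<beta>: "0 \<le> \<beta> $ i" for i using less.prems(2) by (simp add: less_eq_vec_def)
    \<comment> \<open>For the swapped generators x is annihilated by the raising operators and has
      degree -\<beta>, so the sl2 bound reads \<open>pairing i \<beta> \<le> 0\<close>.\<close>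
    have "x \<in> sw.gs (- \<beta>)" using less.prems(1) by (simp add: swap_gs)
    from sw.pairing_nonneg_if_singular[OF this \<open>x \<noteq> 0\<close> less.prems(4)]
    have "pairing i \<beta> \<le> 0" for i by simp
    then have "(\<Sum>i\<in>UNIV. \<beta> $ i * \<epsilon> i * pairing i \<beta>) \<le> 0"
      using \<beta> \<epsilon>_pos by (intro sum_nonpos mult_nonneg_nonpos mult_nonneg_nonneg) (auto simp: less_imp_le)
    moreover obtain j where "\<beta> $ j \<noteq> 0" using less.prems(3) by (auto simp: vec_eq_iff)
    then have "0 < (\<Sum>i\<in>UNIV. \<epsilon> i * \<beta> $ i)"
      using \<beta> \<epsilon>_pos by (intro sum_pos2[of _ j]) (auto simp: less_le intro!: mult_nonneg_nonneg)
    ultimately show False using eq \<open>x \<noteq> 0\<close> by linarith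
  qed
qed

text \<open>As [x, y] lies in \<hh>, its cobracket is 0. Contracting the cocycle identity with a
  functional of degree 0 that takes the value 1 at \<nu> \<beta> leaves only the leading terms, and
  they give twice the difference of [x, y] and \<phi>([x, y]) \<nu> \<beta>.\<close>

lemma bracket_opposite:
  assumes x: "x \<in> gs \<beta>" and y: "y \<in> gs (- \<beta>)" and \<beta>: "0 \<le> \<beta>" "\<beta> \<noteq> 0"
  shows "\<exists>t. b x y = s t (\<nu> \<beta>)"
proof -
  interpret sw: kac_moody_cobracket s b sH \<alpha> \<alpha>c a "\<lambda>h. - Hm h" f e \<epsilon> "\<lambda>x. - \<delta> x"
    by (rule swap_cobracket)
  obtain T where T: "T \<in> TP \<beta>" "\<delta> x = wedge (\<nu> \<beta>) x + T" using \<delta>_pos[OF gs_pos[OF x \<beta>]] by blast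
  have "sw.pos \<beta> y" using sw.gs_pos[of y \<beta>] y \<beta> by (simp add: swap_gs)
  from sw.\<delta>_pos[OF this] obtain T' where T': "T' \<in> sw.TP \<beta>" "- \<delta> y = wedge (- \<nu> \<beta>) y + T'" by auto
  then have \<delta>y: "\<delta> y = wedge (\<nu> \<beta>) y - T'" by (simp add: wedge_simps minus_equation_iff[of "\<delta> y"])
  have bxy: "b x y \<in> gs 0" using gs_b[OF x y] by simp
  obtain \<phi>0 where \<phi>0: "lf \<phi>0" "\<phi>0 (\<nu> \<beta>) = 1"
    using exists_separating_functional[OF vector_space_axioms, of "\<nu> \<beta>"] \<nu>_eq_0 \<beta>(2) by auto
  define \<phi> where "\<phi> z = \<phi>0 (pr 0 z)" for z
  have \<phi>: "supported \<phi> 0" unfolding \<phi>_def by (rule supported_pr[OF \<phi>0(1)])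
  then have lf: "lf \<phi>" by (simp add: supported_def)
  have \<phi>_ne: "\<phi> z = 0" if "z \<in> gs \<gamma>" "\<gamma> \<noteq> 0" for z \<gamma> using \<phi> that by (auto simp: supported_def)
  have \<phi>\<nu>: "\<phi> (\<nu> \<beta>) = 1" using \<phi>0(2) by (simp add: \<phi>_def pr_same[of _ 0])
  \<comment> \<open>In a summand v \<otimes> w of T neither v nor [y, v] has degree 0, so \<phi>
    vanishes on both.\<close>
  have 1: "fst (act y T) \<phi> = 0" using T(1) unfolding TP_def
  proof (induction rule: N.span_induct_alt)
    case (step c S T)
    then obtain v w \<beta>1 \<beta>2 where S: "S = tens v w" "v \<in> gs \<beta>1" "w \<in> gs \<beta>2" "\<beta>1 + \<beta>2 = \<beta>"
      "0 \<le> \<beta>1" "\<beta>1 \<noteq> 0" "0 \<le> \<beta>2" "\<beta>2 \<noteq> 0" by blast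
    have "\<phi> (b y v) = 0" by (rule \<phi>_ne[OF gs_b[OF y S(2)]]) (use S(4,8) in auto)
    moreover have "\<phi> v = 0" by (rule \<phi>_ne[OF S(2,6)])
    ultimately show ?case using step.IH
      by (simp add: S(1) act_add act_scale act_tens fst_scN) (simp add: tens_def)
  qed simp
  have 2: "fst (act x T') \<phi> = 0" using T'(1) unfolding sw.TP_def
  proof (induction rule: N.span_induct_alt)
    case (step c S T)
    then obtain v w \<beta>1 \<beta>2 where S: "S = tens v w" "v \<in> sw.gs \<beta>1" "w \<in> sw.gs \<beta>2" "\<beta>1 + \<beta>2 = \<beta>"
      "0 \<le> \<beta>1" "\<beta>1 \<noteq> 0" "0 \<le> \<beta>2" "\<beta>2 \<noteq> 0" by blast
    have v: "v \<in> gs (- \<beta>1)" using S(2) by (simp add: swap_gs)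
    have "\<phi> (b x v) = 0" by (rule \<phi>_ne[OF gs_b[OF x v]]) (use S(4,8) in auto)
    moreover have "\<phi> v = 0" by (rule \<phi>_ne[OF v]) (use S(6) in simp)
    ultimately show ?case using step.IH
      by (simp add: S(1) act_add act_scale act_tens fst_scN) (simp add: tens_def)
  qed simp
  have w: "fst (wedge v w) \<phi> = s (\<phi> v) w - s (\<phi> w) v" for v w
    by (simp add: wedge_def tens_def lf)
  have 3: "\<phi> x = 0" "\<phi> y = 0" "\<phi> (b x (\<nu> \<beta>)) = 0" "\<phi> (b y (\<nu> \<beta>)) = 0"
    using \<beta>(2) \<phi>_ne[OF x] \<phi>_ne[OF y] by (simp_all add: gsD'[OF x] gsD'[OF y] lf_simps[OF lf] lf_minus[OF lf])
  have "\<delta> (b x y) = 0" using gs_0[OF bxy] \<delta>_H by auto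
  then have "fst (act x (\<delta> y) - act y (\<delta> x)) \<phi> = 0" by (simp add: \<delta>_b)
  then have "fst (act x (wedge (\<nu> \<beta>) y)) \<phi> - fst (act y (wedge (\<nu> \<beta>) x)) \<phi> = 0"
    by (simp add: T(2) \<delta>y act_add act_diff 1 2)
  then have 4: "(b x y - s (\<phi> (b x y)) (\<nu> \<beta>)) - (b y x - s (\<phi> (b y x)) (\<nu> \<beta>)) = 0"
    by (simp add: act_wedge w 3 \<phi>\<nu>)
  define v where "v = b x y - s (\<phi> (b x y)) (\<nu> \<beta>)"
  have 5: "b y x - s (\<phi> (b y x)) (\<nu> \<beta>) = - v"
    using b_antisym[of y x] by (simp add: lf_minus[OF lf] v_def)
  have "v + v = 0" using 4 unfolding 5 by (simp only: v_def diff_minus_eq_add)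
  then have "s 2 v = 0" using scale_left_distrib[of 1 1 v] by simp
  then show ?thesis unfolding v_def by auto
qed

end

section \<open>Existence of the cobracket\<close>

context kac_moody
begin

context
  fixes \<epsilon> :: "'n \<Rightarrow> int"
  assumes \<epsilon>_sym: "\<epsilon> i * a i j = \<epsilon> j * a j i"
begin

abbreviation \<rho>e where "\<rho>e i \<equiv> scN (of_int (\<epsilon> i)) (wedge (hc i) (e i))"
abbreviation \<rho>f where "\<rho>f i \<equiv> scN (of_int (\<epsilon> i)) (wedge (hc i) (f i))"

text \<open>The powers have a closed form. Its leading coefficient \<open>h k\<close> corresponds to
  the degree k \<alpha>_i + \<alpha>_j, and the correction c_k = 2 \<epsilon>_i k (k - 1 + a i j)
  vanishes at k = 1 - a i j together with u_k.\<close>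

lemma serre_e_semidirect:
  assumes "i \<noteq> j" shows "(brS (e i, \<rho>e i) ^^ nat (1 - a i j)) (e j, \<rho>e j) = 0"
proof -
  interpret H: vector_space sH using Hm_linear by (auto simp: Vector_Spaces.linear_def)
  define u where "u k = (b (e i) ^^ k) (e j)" for k
  define h where "h k = sH (of_int (int k * \<epsilon> i)) (\<alpha>c i) + sH (of_int (\<epsilon> j)) (\<alpha>c j)" for k
  have u_Suc: "u (Suc k) = b (e i) (u k)" and u_0: "u 0 = e j" for k by (simp_all add: u_def)
  have hu: "b (hc i) (u k) = s (of_int (2 * int k + a i j)) (u k)" for k
  proof (induction k)
    case 0
    then show ?case by (simp add: u_0 He \<alpha>_\<alpha>c)
  next
    case (Suc k)
    have "b (hc i) (u (Suc k)) = s 2 (u (Suc k)) + b (e i) (b (hc i) (u k))"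
      unfolding u_Suc b_leibniz[of "hc i" "e i"] by (simp add: He \<alpha>_\<alpha>c a_diag b_scale)
    also have "\<dots> = s (2 + of_int (2 * int k + a i j)) (u (Suc k))"
      unfolding Suc.IH by (simp only: b_scale scale_left_distrib u_Suc)
    finally show ?case by (simp add: algebra_simps)
  qed
  have uh: "b (u k) (hc i) = s (- of_int (2 * int k + a i j)) (u k)" for k
    using b_antisym[of "u k" "hc i"] unfolding hu scale_minus_left .
  \<comment> \<open>By the symmetry of \<epsilon>, h_k acts on e_i by the same scalar as
    \<epsilon>_i h_i acts on u_k. Both actions contribute it to c_(k+1) - c_k, whence the factor 2
    in \<open>c_Suc\<close>.\<close>
  have \<alpha>h: "\<alpha> i (h k) = of_int (\<epsilon> i * (2 * int k + a i j))" for k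
    using arg_cong[OF \<epsilon>_sym[of i j], of "of_int :: int \<Rightarrow> 'f"]
    by (simp add: h_def \<alpha>_add \<alpha>_scale \<alpha>_\<alpha>c a_diag algebra_simps)
  have h_Suc: "Hm (h (Suc k)) = Hm (h k) + s (of_int (\<epsilon> i)) (hc i)" for k
    by (simp add: h_def Hm_add Hm_scale algebra_simps flip: scale_left_distrib)
  define c where "c k = (of_int (2 * \<epsilon> i * (int k * (int k - 1 + a i j))) :: 'f)" for k
  have c_Suc: "c (Suc k) = c k + 2 * of_int (\<epsilon> i * (2 * int k + a i j))" for k
    by (simp add: c_def algebra_simps)
  \<comment> \<open>At k = 0 the index k - 1 is truncated, which is harmless because c 0 =
    0.\<close>
  have main: "(brS (e i, \<rho>e i) ^^ k) (e j, \<rho>e j) =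
      (u k, wedge (Hm (h k)) (u k) - scN (c k) (wedge (e i) (u (k - 1))))" for k
  proof (induction k)
    case 0
    show ?case by (simp add: u_0 h_def c_def Hm_scale wedge_simps)
  next
    case (Suc k)
    let ?p = "of_int (\<epsilon> i * (2 * int k + a i j)) :: 'f"
    have c: "scN (c k) (act (e i) (wedge (e i) (u (k - 1)))) = scN (c k) (wedge (e i) (u k))"
      by (cases k) (simp_all add: c_def act_wedge bracket_self wedge_simps u_Suc)
    have group: "w - p - v - (p - y) = (w + y) - (v + (p + p))" for w p v y :: "'z::ab_group_add"
      by (simp add: algebra_simps)
    have a1: "act (e i) (wedge (Hm (h k)) (u k)) =
        wedge (Hm (h k)) (u (Suc k)) - scN ?p (wedge (e i) (u k))"
      by (simp add: act_wedge eH \<alpha>h wedge_simps u_Suc)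
    have ue: "b (u k) (e i) = - u (Suc k)" using b_antisym[of "u k" "e i"] by (simp add: u_Suc)
    have a2: "act (u k) (\<rho>e i) = scN ?p (wedge (e i) (u k)) - scN (of_int (\<epsilon> i)) (wedge (hc i) (u (Suc k)))"
    proof -
      define q where "q = (of_int (2 * int k + a i j) :: 'f)"
      have p: "?p = of_int (\<epsilon> i) * q" by (simp add: q_def)
      have uh': "b (u k) (hc i) = s (- q) (u k)" unfolding q_def by (rule uh)
      have "act (u k) (wedge (hc i) (e i)) = scN q (wedge (e i) (u k)) - wedge (hc i) (u (Suc k))"
        using wedge_antisym[of "u k" "e i"] by (simp add: act_wedge uh' ue wedge_simps)
      then show ?thesis unfolding p by (simp only: act_scale N.scale_right_diff_distrib N.scale_scale)
    qed
    have "act (e i) (wedge (Hm (h k)) (u k) - scN (c k) (wedge (e i) (u (k - 1)))) - act (u k) (\<rho>e i) =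
        wedge (Hm (h (Suc k))) (u (Suc k)) - scN (c (Suc k)) (wedge (e i) (u k))"
      unfolding act_diff act_scale[of "e i" "c k"] c a1 a2 h_Suc c_Suc wedge_simps
        N.scale_left_distrib mult_2[of ?p]
      by (rule group)
    then show ?case
      by (simp only: funpow.simps o_apply Suc) (simp only: brS_def fst_conv snd_conv u_Suc diff_Suc_1)
  qed
  let ?m = "nat (1 - a i j)"
  have "u ?m = 0" unfolding u_def by (rule serre_e[OF assms])
  moreover have "c ?m = 0" using a_nonpos[OF assms] by (simp add: c_def)
  ultimately show ?thesis unfolding main by (simp add: wedge_simps prod_eq_iff)
qed

end

text \<open>Under \<open>swap\<close> the coroots, and with them the prescribed tensors, change
  sign. Negating the tensor component is compatible with \<open>brS\<close> and undoes this.\<close>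

lemma serre_f_semidirect:
  assumes \<epsilon>_sym: "\<And>i j. \<epsilon> i * a i j = \<epsilon> j * a j i" and "i \<noteq> j"
  shows "(brS (f i, \<rho>f \<epsilon> i) ^^ nat (1 - a i j)) (f j, \<rho>f \<epsilon> j) = 0"
proof -
  interpret sw: kac_moody s b sH \<alpha> \<alpha>c a "\<lambda>h. - Hm h" f e by (rule swap)
  define \<sigma> :: "'g \<times> (('g \<Rightarrow> 'f) \<Rightarrow> 'g) \<times> 'g \<Rightarrow> _" where "\<sigma> p = (fst p, - snd p)" for p
  have \<sigma>: "\<sigma> (brS p q) = brS (\<sigma> p) (\<sigma> q)" for p q
    by (simp add: \<sigma>_def brS_def act_minus)
  have "\<sigma> ((brS p ^^ k) q) = (brS (\<sigma> p) ^^ k) (\<sigma> q)" for p q k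
    by (induction k) (simp_all add: \<sigma>)
  from this[of "nat (1 - a i j)" "(f i, sw.\<rho>e \<epsilon> i)" "(f j, sw.\<rho>e \<epsilon> j)"]
    sw.serre_e_semidirect[OF assms]
  show ?thesis by (simp add: \<sigma>_def wedge_simps prod_eq_iff)
qed

lemma cobracket_exists:
  fixes A :: "int^'n^'n"
  assumes pr: "lie_presented_by s b \<iota> (km_relations A sH \<alpha> \<alpha>c)"
    and a: "\<And>i j. A $ i $ j = a i j"
    and gens: "\<And>h. \<iota> (H h) = Hm h" "\<And>i. \<iota> (E i) = e i" "\<And>i. \<iota> (F i) = f i"
    and \<epsilon>_pos: "\<And>i. 0 < \<epsilon> i" and \<epsilon>_sym: "\<And>i j. \<epsilon> i * a i j = \<epsilon> j * a j i"
  shows "\<exists>\<delta>. kac_moody_cobracket s b sH \<alpha> \<alpha>c a Hm e f \<epsilon> \<delta>"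
proof -
  define \<rho> where "\<rho> x = (case x of H h \<Rightarrow> 0 | E i \<Rightarrow> \<rho>e \<epsilon> i | F i \<Rightarrow> \<rho>f \<epsilon> i)" for x :: "('h, 'n) km_gen"
  let ?ev = "lie_eval scS brS (\<lambda>x. (\<iota> x, \<rho> x))"
  have \<rho>_simps: "\<rho> (H h) = 0" "\<rho> (E i) = \<rho>e \<epsilon> i" "\<rho> (F i) = \<rho>f \<epsilon> i" for h i
    by (simp_all add: \<rho>_def)
  have "?ev t = ?ev u" if "(t, u) \<in> km_relations A sH \<alpha> \<alpha>c" for t u
    using that
  proof cases
    case (EF_same i)
    have "act (e i) (wedge (hc i) (f i)) = scN (- 2) (wedge (e i) (f i))"
      "act (f i) (wedge (hc i) (e i)) = scN 2 (wedge (f i) (e i))"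
      by (simp_all add: act_wedge eH fH ef fe \<alpha>_\<alpha>c a_diag wedge_simps)
    then have "act (e i) (wedge (hc i) (f i)) = act (f i) (wedge (hc i) (e i))"
      using wedge_antisym[of "f i" "e i"] by simp
    then show ?thesis by (simp add: EF_same brS_def gens \<rho>_simps ef act_scale)
  next
    \<comment> \<open>The tensor attached to [e_i, f_j] is (\<epsilon>_i a_ij - \<epsilon>_j a_ji)
      times \<open>wedge (e i) (f j)\<close>, so this relation expresses exactly that \<epsilon>
      symmetrizes the matrix.\<close>
    case (EF_diff i j)
    have "act (e i) (wedge (hc j) (f j)) = scN (- of_int (a j i)) (wedge (e i) (f j))"
      "act (f j) (wedge (hc i) (e i)) = scN (of_int (a i j)) (wedge (f j) (e i))"
      using EF_diff by (simp_all add: act_wedge eH fH ef fe \<alpha>_\<alpha>c wedge_simps)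
    moreover have "of_int (\<epsilon> i) * of_int (a i j) = (of_int (\<epsilon> j) * of_int (a j i) :: 'f)"
      using arg_cong[OF \<epsilon>_sym[of i j], of "of_int :: int \<Rightarrow> 'f"] by simp
    ultimately show ?thesis using wedge_antisym[of "f j" "e i"] EF_diff(3)
      by (simp add: EF_diff(1,2) brS_def gens \<rho>_simps ef act_scale zero_prod_def[symmetric])
  next
    case (HE h i)
    then show ?thesis
      by (simp add: brS_def scS_def gens \<rho>_simps He act_scale act_wedge HH wedge_simps mult.commute)
  next
    case (HF h i)
    then show ?thesis
      by (simp add: brS_def scS_def gens \<rho>_simps Hf act_scale act_wedge HH wedge_simps mult.commute)
  qed (simp_all add: brS_def scS_def gens \<rho>_simps Hm_add Hm_scale HH lie_eval_funpow_Bracket a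
      serre_e_semidirect[OF \<epsilon>_sym] serre_f_semidirect[OF \<epsilon>_sym] zero_prod_def[symmetric])
  moreover have "\<rho> x \<in> TS" for x by (cases x) (simp_all add: \<rho>_simps)
  ultimately obtain \<delta> where \<delta>: "\<forall>x. \<delta> x \<in> TS" "\<forall>x y. \<delta> (x + y) = \<delta> x + \<delta> y"
    "\<forall>c x. \<delta> (s c x) = scN c (\<delta> x)" "\<forall>x y. \<delta> (b x y) = act x (\<delta> y) - act y (\<delta> x)"
    "\<forall>x. \<delta> (\<iota> x) = \<rho> x"
    using presented_cocycle[OF pr, of \<rho>] by auto
  have "kac_moody_cobracket s b sH \<alpha> \<alpha>c a Hm e f \<epsilon> \<delta>"
  proof (rule kac_moody_cobracket.intro[OF kac_moody_axioms], rule kac_moody_cobracket_axioms.intro)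
    show "\<delta> (Hm h) = 0" for h using \<delta>(5)[rule_format, of "H h"] by (simp add: gens \<rho>_simps)
    show "\<delta> (e i) = \<rho>e \<epsilon> i" "\<delta> (f i) = \<rho>f \<epsilon> i" for i
      using \<delta>(5)[rule_format, of "E i"] \<delta>(5)[rule_format, of "F i"] by (simp_all add: gens \<rho>_simps)
  qed (use \<delta> \<epsilon>_pos \<epsilon>_sym in auto)
  then show ?thesis by blast
qed

end

context kac_moody
begin

lemma hc_nonzero: "hc i \<noteq> 0" and e_nonzero: "e i \<noteq> 0"
proof -
  interpret H: vector_space sH using Hm_linear by (auto simp: Vector_Spaces.linear_def)
  have "(\<Sum>j\<in>UNIV. sH (if j = i then 1 else 0) (\<alpha>c j)) = (\<Sum>j\<in>UNIV. if j = i then \<alpha>c i else 0)"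
    by (intro sum.cong) auto
  then have "\<alpha>c i \<noteq> 0" using \<alpha>c_indep[of "\<lambda>j. if j = i then 1 else 0" i] by auto
  then show "hc i \<noteq> 0" using Hm_eq_0 by auto
  then show "e i \<noteq> 0" using ef[of i i] by auto
qed

lemma derived_eq_dg: "derived_algebra s b = dg"
proof
  show "derived_algebra s b \<subseteq> dg" unfolding derived_algebra_def
    by (rule span_minimal) (auto simp: b_dg dg_subspace)
  have br: "b x y \<in> derived_algebra s b" for x y
    unfolding derived_algebra_def by (rule span_base) auto
  have half: "x \<in> derived_algebra s b" if "s c x \<in> derived_algebra s b" "c \<noteq> 0" for c x
    using span_scale[of "s c x" _ "inverse c"] that unfolding derived_algebra_def by simp
  have e: "e i \<in> derived_algebra s b" for i
    using half[of 2 "e i"] br[of "hc i" "e i"] by (simp add: He \<alpha>_\<alpha>c a_diag)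
  have f: "f i \<in> derived_algebra s b" for i
    using half[of "- 2" "f i"] br[of "hc i" "f i"] by (simp add: Hf \<alpha>_\<alpha>c a_diag)
  have pos: "x \<in> derived_algebra s b" if "pos_part s b g \<beta> x" "\<And>i. g i \<in> derived_algebra s b" for g \<beta> x
    using that(1) by (induction rule: pos_part.induct)
      (use that(2) br in \<open>auto simp: derived_algebra_def span_zero span_add span_scale\<close>)
  have "hc i \<in> derived_algebra s b" for i using br[of "e i" "f i"] by (simp add: ef)
  then show "dg \<subseteq> derived_algebra s b" unfolding dg_def
    by (intro span_minimal) (use pos[OF _ e] pos[OF _ f] in
        \<open>auto simp: dg_gens_def derived_algebra_def\<close>)
qed

lemma dg_closed [simp]: "0 \<in> dg" "x \<in> dg \<Longrightarrow> y \<in> dg \<Longrightarrow> x + y \<in> dg" "x \<in> dg \<Longrightarrow> s c x \<in> dg"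
  "x \<in> dg \<Longrightarrow> - x \<in> dg" "b x y \<in> dg" "e i \<in> dg" "f i \<in> dg" "hc i \<in> dg"
  using dg_subspace b_dg ef_dg hc_dg by (auto simp: subspace_0 subspace_add subspace_scale subspace_neg)

subsection \<open>Homogeneous elements of the centroid of the derived algebra\<close>

text \<open>The centroid condition without a convention on values outside \<open>dg\<close>, so that
  differences and commutators can be formed as functions on \<gg>.\<close>

definition cen :: "('g \<Rightarrow> 'g) \<Rightarrow> bool" where
  "cen \<psi> \<longleftrightarrow> (\<forall>x\<in>dg. \<psi> x \<in> dg) \<and> (\<forall>x\<in>dg. \<forall>y\<in>dg. \<psi> (x + y) = \<psi> x + \<psi> y) \<and>
    (\<forall>c. \<forall>x\<in>dg. \<psi> (s c x) = s c (\<psi> x)) \<and> (\<forall>x\<in>dg. \<forall>y\<in>dg. \<psi> (b x y) = b x (\<psi> y))"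

lemma cenD:
  assumes "cen \<psi>"
  shows "x \<in> dg \<Longrightarrow> \<psi> x \<in> dg" "x \<in> dg \<Longrightarrow> y \<in> dg \<Longrightarrow> \<psi> (x + y) = \<psi> x + \<psi> y"
    "x \<in> dg \<Longrightarrow> \<psi> (s c x) = s c (\<psi> x)" "x \<in> dg \<Longrightarrow> y \<in> dg \<Longrightarrow> \<psi> (b x y) = b x (\<psi> y)"
  using assms by (auto simp: cen_def)

lemma cen_zero: "cen \<psi> \<Longrightarrow> \<psi> 0 = 0"
  using cenD(3)[of \<psi> 0 0] by simp

lemma cen_minus: "cen \<psi> \<Longrightarrow> x \<in> dg \<Longrightarrow> \<psi> (- x) = - \<psi> x"
  using cenD(3)[of \<psi> x "-1"] by simp

lemma cen_b_left: "cen \<psi> \<Longrightarrow> x \<in> dg \<Longrightarrow> y \<in> dg \<Longrightarrow> \<psi> (b x y) = b (\<psi> x) y"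
  using cenD(4)[of \<psi> y x] cen_minus[of \<psi> "b y x"] b_antisym[of x y] b_antisym[of "\<psi> x" y] by simp

text \<open>If \<psi> kills e_i, it kills h_i = [e_i, f_i] and hence a_ik e_k for every k. So
  vanishing spreads over the connected diagram, and from the coroots to all f_k.\<close>

lemma cen_eq_0:
  assumes c: "cen \<psi>" and j: "\<psi> (e j) = 0" and x: "x \<in> dg"
  shows "\<psi> x = 0"
proof -
  have hc0: "\<psi> (hc i) = 0" if "\<psi> (e i) = 0" for i
    using cen_b_left[OF c, of "e i" "f i"] that by (simp add: ef)
  have e0: "\<psi> (e k) = 0" for k
  proof -
    have "k \<in> {i. \<psi> (e i) = 0}"
    proof (rule a_connected[of j])
      fix i k assume ik: "i \<in> {i. \<psi> (e i) = 0}" "a i k \<noteq> 0"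
      then have "\<psi> (b (hc i) (e k)) = 0" using cen_b_left[OF c, of "hc i" "e k"] hc0[of i] by simp
      then have "s (of_int (a i k)) (\<psi> (e k)) = 0" by (simp add: He \<alpha>_\<alpha>c cenD(3)[OF c])
      then show "k \<in> {i. \<psi> (e i) = 0}" using ik(2) by simp
    qed (use j in simp)
    then show ?thesis by simp
  qed
  have f0: "\<psi> (f k) = 0" for k
  proof -
    have "\<psi> (b (hc k) (f k)) = 0" using cen_b_left[OF c, of "hc k" "f k"] hc0[OF e0] by simp
    then have "s (- 2) (\<psi> (f k)) = 0" by (simp add: Hf \<alpha>_\<alpha>c a_diag cenD(3)[OF c] cen_minus[OF c])
    then show ?thesis by simp
  qed
  have pos0: "x \<in> dg \<and> \<psi> x = 0" if "pos_part s b g \<beta> x" "\<And>i. g i \<in> dg" "\<And>i. \<psi> (g i) = 0" for g \<beta> x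
    using that(1) by (induction rule: pos_part.induct) (use that(2,3) in \<open>auto simp: cenD[OF c] cen_zero[OF c]\<close>)
  have "x \<in> dg \<and> \<psi> x = 0"
    using x unfolding dg_def
  proof (induction rule: span_induct_alt)
    case base
    show ?case using cen_zero[OF c] by (simp add: span_zero)
  next
    case (step t x y)
    then have "x \<in> dg \<and> \<psi> x = 0" using hc0[OF e0] pos0[of e] pos0[of f] e0 f0
      by (auto simp: dg_gens_def)
    then show ?case using step.IH unfolding dg_def[symmetric] by (simp add: cenD[OF c])
  qed
  then show ?thesis by simp
qed

definition shift :: "'h \<Rightarrow> 'f \<Rightarrow> ('g \<Rightarrow> 'g) \<Rightarrow> 'g \<Rightarrow> 'g" where
  "shift h c \<psi> x = b (Hm h) (\<psi> x) - \<psi> (b (Hm h) x) - s c (\<psi> x)"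

text \<open>As h need not lie in \<open>dg\<close>, \<psi> need not commute with
  \<open>b (Hm h)\<close>. But this is a derivation of \<open>dg\<close>, and the commutator of a
  derivation with a centroid element is again in the centroid.\<close>

lemma cen_shift: assumes "cen \<psi>" shows "cen (shift h c \<psi>)"
  unfolding cen_def
proof (intro conjI ballI allI)
  fix x y t assume x: "x \<in> dg"
  then have "\<psi> x \<in> dg" by (rule cenD[OF assms])
  then show "shift h c \<psi> x \<in> dg"
    unfolding shift_def by (intro subspace_diff[OF dg_subspace]) (auto intro: cenD(1)[OF assms])
  show "shift h c \<psi> (s t x) = s t (shift h c \<psi> x)"
    using x by (simp add: shift_def b_scale cenD[OF assms] scale_right_diff_distrib mult.commute)
  assume y: "y \<in> dg"
  show "shift h c \<psi> (x + y) = shift h c \<psi> x + shift h c \<psi> y"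
    using x y by (simp add: shift_def b_add cenD[OF assms] scale_right_distrib)
  have "\<psi> (b (Hm h) (b x y)) = b (b (Hm h) x) (\<psi> y) + b x (\<psi> (b (Hm h) y))"
    unfolding b_leibniz[of "Hm h" x y] using x y by (simp add: cenD[OF assms])
  then show "shift h c \<psi> (b x y) = b x (shift h c \<psi> y)"
    using x y by (simp add: shift_def cenD[OF assms] b_diff b_scale b_leibniz[of "Hm h" x "\<psi> y"])
qed

lemma shift_e: "cen \<psi> \<Longrightarrow> shift h c \<psi> (e j) = b (Hm h) (\<psi> (e j)) - s (\<alpha> j h + c) (\<psi> (e j))"
  by (simp add: shift_def He cenD scale_left_distrib)

definition homogeneous :: "('g \<Rightarrow> 'g) \<Rightarrow> int^'n \<Rightarrow> bool" where
  "homogeneous \<psi> \<gamma> \<longleftrightarrow> (\<forall>h. \<forall>x\<in>dg. b (Hm h) (\<psi> x) = \<psi> (b (Hm h) x) + s (wt \<gamma> h) (\<psi> x))"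

lemma homogeneous_gs:
  "cen \<psi> \<Longrightarrow> homogeneous \<psi> \<gamma> \<Longrightarrow> x \<in> dg \<Longrightarrow> x \<in> gs \<beta> \<Longrightarrow> \<psi> x \<in> gs (\<beta> + \<gamma>)"
  by (simp add: homogeneous_def gs_def cenD scale_left_distrib)

text \<open>The centroid is stable under commutators with \<open>ad h\<close>, and evaluation at \<open>e\<^sub>j\<close> is injective,
  so that weight components can be split off by applying products of operators \<open>ad h - c\<close>.\<close>

lemma homogeneous_component_aux:
  assumes "finite B" "cen \<psi>" "\<psi> (e j) = (\<Sum>\<beta>\<in>insert \<beta>0 B. c \<beta>)" "\<beta>0 \<notin> B"
    "\<And>\<beta>. \<beta> \<in> insert \<beta>0 B \<Longrightarrow> c \<beta> \<in> gs \<beta>" "c \<beta>0 \<noteq> 0"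
  shows "\<exists>\<psi>'. cen \<psi>' \<and> \<psi>' (e j) \<in> gs \<beta>0 \<and> \<psi>' (e j) \<noteq> 0"
  using assms
proof (induction B arbitrary: c \<psi> rule: finite_induct)
  case empty
  then show ?case by auto
next
  case (insert \<beta>1 B)
  have "\<exists>h. wt \<beta>0 h \<noteq> wt \<beta>1 h" using wt_inj[of \<beta>0 \<beta>1] insert.prems(3) by blast
  then obtain h where h: "wt \<beta>0 h \<noteq> wt \<beta>1 h" by blast
  define \<psi>' where "\<psi>' = shift h (wt \<beta>1 h - \<alpha> j h) \<psi>"
  define c' where "c' \<beta> = s (wt \<beta> h - wt \<beta>1 h) (c \<beta>)" for \<beta>
  have "\<psi>' (e j) = b (Hm h) (\<psi> (e j)) - s (wt \<beta>1 h) (\<psi> (e j))"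
    unfolding \<psi>'_def using shift_e[OF insert.prems(1)] by simp
  also have "\<dots> = (\<Sum>\<beta>\<in>insert \<beta>0 (insert \<beta>1 B). c' \<beta>)"
    unfolding insert.prems(2) b_sum scale_sum_right sum_subtractf[symmetric]
    by (intro sum.cong) (auto simp: c'_def gsD[OF insert.prems(4)] scale_left_diff_distrib)
  also have "\<dots> = (\<Sum>\<beta>\<in>insert \<beta>0 B. c' \<beta>)"
    using insert.hyps by (intro sum.mono_neutral_right) (auto simp: c'_def)
  finally have *: "\<psi>' (e j) = (\<Sum>\<beta>\<in>insert \<beta>0 B. c' \<beta>)" .
  show ?case
  proof (rule insert.IH[where c = c' and \<psi> = \<psi>'])
    show "\<psi>' (e j) = (\<Sum>\<beta>\<in>insert \<beta>0 B. c' \<beta>)" by (rule *)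
    show "cen \<psi>'" unfolding \<psi>'_def by (rule cen_shift[OF insert.prems(1)])
    show "c' \<beta>0 \<noteq> 0" using h insert.prems(5) by (simp add: c'_def)
  qed (use insert.prems in \<open>auto simp: c'_def\<close>)
qed

lemma homogeneous_component:
  assumes "cen \<psi>" "pr \<beta> (\<psi> (e j)) \<noteq> 0"
  shows "\<exists>\<psi>'. cen \<psi>' \<and> \<psi>' (e j) \<noteq> 0 \<and> homogeneous \<psi>' (\<beta> - axis j 1)"
proof -
  let ?B = "{\<beta>'. pr \<beta>' (\<psi> (e j)) \<noteq> 0} - {\<beta>}"
  have B: "insert \<beta> ?B = {\<beta>'. pr \<beta>' (\<psi> (e j)) \<noteq> 0}" using assms(2) by auto
  have "\<exists>\<psi>'. cen \<psi>' \<and> \<psi>' (e j) \<in> gs \<beta> \<and> \<psi>' (e j) \<noteq> 0"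
  proof (rule homogeneous_component_aux[OF _ assms(1), of ?B])
    show "\<psi> (e j) = (\<Sum>\<beta>'\<in>insert \<beta> ?B. pr \<beta>' (\<psi> (e j)))"
      unfolding B by (rule sum_pr)
  qed (use finite_pr assms(2) in auto)
  then obtain \<psi>' where \<psi>': "cen \<psi>'" "\<psi>' (e j) \<in> gs \<beta>" "\<psi>' (e j) \<noteq> 0" by blast
  have "homogeneous \<psi>' (\<beta> - axis j 1)" unfolding homogeneous_def
  proof (intro allI ballI)
    fix h x assume x: "x \<in> dg"
    \<comment> \<open>The eigenvalue equation is known at e_j only; \<open>cen_eq_0\<close> carries
      it to all of \<open>dg\<close>.\<close>
    have "shift h (wt \<beta> h - \<alpha> j h) \<psi>' (e j) = 0"
      by (simp add: shift_e[OF \<psi>'(1)] gsD[OF \<psi>'(2)])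
    from cen_eq_0[OF cen_shift[OF \<psi>'(1)] this x]
    show "b (Hm h) (\<psi>' x) = \<psi>' (b (Hm h) x) + s (wt (\<beta> - axis j 1) h) (\<psi>' x)"
      by (simp add: shift_def algebra_simps)
  qed
  with \<psi>' show ?thesis by blast
qed

text \<open>The coroots lie in \<open>dg\<close>, so \<psi> commutes with them, which gives the
  first claim. For the second, \<psi>(h_j) is a nonzero element of degree \<gamma>, and degrees of
  mixed sign do not occur.\<close>

lemma homogeneous_degree:
  assumes c: "cen \<psi>" and h: "homogeneous \<psi> \<gamma>" and j: "\<psi> (e j) \<noteq> 0"
  shows "pairing i \<gamma> = 0" and "0 \<le> \<gamma> \<or> \<gamma> \<le> 0"
proof -
  have "s (wt \<gamma> (\<alpha>c i)) (\<psi> (e j)) = 0"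
    using h cenD(4)[OF c, of "hc i" "e j"] by (simp add: homogeneous_def)
  then show "pairing i \<gamma> = 0" using j by (simp add: wt_\<alpha>c)
  have "\<psi> (hc j) \<noteq> 0"
  proof
    assume "\<psi> (hc j) = 0"
    then have "\<psi> (b (hc j) (e j)) = 0" using cen_b_left[OF c, of "hc j" "e j"] by simp
    then show False using j by (simp add: He \<alpha>_\<alpha>c a_diag cenD(3)[OF c])
  qed
  moreover have "\<psi> (hc j) \<in> gs (0 + \<gamma>)" by (rule homogeneous_gs[OF c h]) auto
  ultimately show "0 \<le> \<gamma> \<or> \<gamma> \<le> 0" using gs_eq_0[of "\<psi> (hc j)" \<gamma>] by auto
qed

text \<open>In a row where \<gamma> vanishes, all terms of the zero sum are nonpositive, so \<gamma>
  vanishes at every neighbour; by connectedness \<gamma> would be 0.\<close>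

lemma null_full_support:
  assumes "0 \<le> \<gamma>" "\<gamma> \<noteq> 0" "\<And>i. pairing i \<gamma> = 0"
  shows "0 < \<gamma> $ i"
proof (rule ccontr)
  have nn: "0 \<le> \<gamma> $ k" for k using assms(1) by (simp add: less_eq_vec_def)
  assume "\<not> 0 < \<gamma> $ i"
  then have i: "\<gamma> $ i = 0" using nn[of i] by simp
  have "k \<in> {i. \<gamma> $ i = 0}" for k
  proof (rule a_connected[of i])
    fix k l assume k: "k \<in> {i. \<gamma> $ i = 0}" and kl: "a k l \<noteq> 0"
    have "(\<Sum>j\<in>UNIV. - (a k j * \<gamma> $ j)) = 0" using assms(3)[of k] by (simp add: pairing_def sum_negf)
    moreover have "0 \<le> - (a k j * \<gamma> $ j)" for j
      using k nn[of j] a_nonpos[of k j] by (cases "j = k") (auto simp: mult_nonpos_nonneg)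
    ultimately have "a k l * \<gamma> $ l = 0" by (subst (asm) sum_nonneg_eq_0_iff) auto
    then show "l \<in> {i. \<gamma> $ i = 0}" using kl by simp
  qed (use i in simp)
  then show False using assms(2) by (auto simp: vec_eq_iff)
qed

text \<open>The matrix (2) has no null vector. The second index provides the coroot independent of
  h_j in \<open>no_homogeneous_pos\<close>.\<close>

lemma null_not_single:
  assumes "0 \<le> \<gamma>" "\<gamma> \<noteq> 0" "\<And>i. pairing i \<gamma> = 0"
  shows "\<exists>i. i \<noteq> (j :: 'n)"
proof (rule ccontr)
  assume "\<nexists>i. i \<noteq> j"
  then have "UNIV = {j}" by auto
  then have "pairing j \<gamma> = 2 * \<gamma> $ j" unfolding pairing_def \<open>UNIV = {j}\<close> by (simp add: a_diag)
  then show False using assms(3)[of j] null_full_support[OF assms, of j] by simp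
qed

lemma gs_if_pr_eq_0: assumes "\<And>\<beta>'. \<beta>' \<noteq> \<beta> \<Longrightarrow> pr \<beta>' x = 0" shows "x \<in> gs \<beta>"
proof -
  have "{\<beta>'. pr \<beta>' x \<noteq> 0} \<subseteq> {\<beta>}" using assms by blast
  then have "x = (\<Sum>\<beta>'\<in>{\<beta>}. pr \<beta>' x)" by (intro decomp_sum[OF decomp_pr]) auto
  then have "x = pr \<beta> x" by simp
  then show ?thesis using pr_gs[of \<beta> x] by simp
qed

lemma pr_b: assumes "x \<in> gs \<gamma>" shows "pr (\<gamma> + \<beta>) (b x z) = b x (pr \<beta> z)"
proof -
  let ?B = "{\<beta>. pr \<beta> z \<noteq> 0}"
  have "decomp (b x z) (\<lambda>\<delta>. b x (pr (\<delta> - \<gamma>) z))"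
  proof (rule decompI[of "(+) \<gamma> ` ?B"])
    show "finite ((+) \<gamma> ` ?B)" using finite_pr by simp
    show "b x (pr (\<delta> - \<gamma>) z) \<in> gs \<delta>" for \<delta> using gs_b[OF assms pr_gs[of "\<delta> - \<gamma>"]] by simp
    show "b x (pr (\<delta> - \<gamma>) z) = 0" if "\<delta> \<notin> (+) \<gamma> ` ?B" for \<delta>
      using that imageI[of "\<delta> - \<gamma>" ?B "(+) \<gamma>"] by (cases "pr (\<delta> - \<gamma>) z = 0") auto
    have "b x z = (\<Sum>\<beta>\<in>?B. b x (pr \<beta> z))" unfolding b_sum[symmetric] using sum_pr[of z] by simp
    also have "\<dots> = (\<Sum>\<delta>\<in>(+) \<gamma> ` ?B. b x (pr (\<delta> - \<gamma>) z))"
      by (subst sum.reindex) (auto simp: inj_on_def)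
    finally show "b x z = (\<Sum>\<delta>\<in>(+) \<gamma> ` ?B. b x (pr (\<delta> - \<gamma>) z))" .
  qed
  then show ?thesis by (simp add: pr_eq)
qed

end

section \<open>Vanishing of homogeneous centroid elements of nonzero degree\<close>

context kac_moody_cobracket
begin

lemma no_homogeneous_pos:
  assumes c: "cen \<psi>" and hom: "homogeneous \<psi> \<gamma>" and \<gamma>: "0 \<le> \<gamma>" "\<gamma> \<noteq> 0" "\<And>i. pairing i \<gamma> = 0"
  shows "\<psi> (e j) = 0"
proof -
  have \<gamma>_pos: "0 < \<gamma> $ i" for i by (rule null_full_support[OF \<gamma>])
  \<comment> \<open>If \<psi> z = t e_j, then [f_j, \<psi> z] = [\<psi> f_j, z] is both -t h_j and,
    by \<open>bracket_opposite\<close>, a multiple of \<nu> \<beta> with \<beta> = \<gamma> -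
    \<alpha>_j. As \<gamma> has full support, \<nu> \<beta> involves a coroot other than h_j, so t =
    0.\<close>
  have simple: "\<psi> z = 0" if z: "z \<in> dg" "z \<in> gs (axis j 1 - \<gamma>)" for z j
  proof -
    define \<beta> where "\<beta> = \<gamma> - axis j 1"
    obtain i where i: "i \<noteq> j" using null_not_single[OF \<gamma>] by blast
    have \<beta>_i: "\<beta> $ i = \<gamma> $ i" using i by (simp add: \<beta>_def axis_def)
    have \<beta>: "0 \<le> \<beta>" "\<beta> \<noteq> 0"
    proof -
      have "0 \<le> \<beta> $ k" for k using \<gamma>_pos[of k] by (auto simp: \<beta>_def axis_def)
      then show "0 \<le> \<beta>" by (simp add: less_eq_vec_def)
      show "\<beta> \<noteq> 0" using \<beta>_i \<gamma>_pos[of i] by auto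
    qed
    have "\<psi> z \<in> gs (axis j 1)" using homogeneous_gs[OF c hom z] by simp
    then obtain t where t: "\<psi> z = s t (e j)" using gs_simple by blast
    have f: "\<psi> (f j) \<in> gs \<beta>" using homogeneous_gs[OF c hom, of "f j" "- axis j 1"] by (simp add: \<beta>_def)
    have zb: "z \<in> gs (- \<beta>)" using z by (simp add: \<beta>_def)
    obtain t' where t': "b (\<psi> (f j)) z = s t' (\<nu> \<beta>)" using bracket_opposite[OF f zb \<beta>] by blast
    have "b (f j) (\<psi> z) = b (\<psi> (f j)) z"
      using cenD(4)[OF c, of "f j" z] cen_b_left[OF c, of "f j" z] z by simp
    then have "- s t (hc j) = s t' (\<nu> \<beta>)" by (simp add: t t' b_scale fe)
    then have "s t (hc j) + s t' (\<nu> \<beta>) = s t (hc j) + - s t (hc j)" by (simp only:)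
    then have "Hm (sH t (\<alpha>c j) + sH t' (\<nu>h \<beta>)) = 0" by (simp add: Hm_add Hm_scale)
    then have "sH t (\<alpha>c j) + sH t' (\<nu>h \<beta>) = 0" by (rule Hm_eq_0)
    moreover have "sH t (\<alpha>c j) = (\<Sum>k\<in>UNIV. sH (if k = j then t else 0) (\<alpha>c k))"
    proof -
      have "(\<Sum>k\<in>UNIV. sH (if k = j then t else 0) (\<alpha>c k)) = (\<Sum>k\<in>UNIV. if k = j then sH t (\<alpha>c j) else 0)"
        by (intro sum.cong) auto
      then show ?thesis by simp
    qed
    ultimately have "(\<Sum>k\<in>UNIV. sH ((if k = j then t else 0) + t' * of_int (\<epsilon> k * \<beta> $ k)) (\<alpha>c k)) = 0"
      by (simp only: vH.scale_left_distrib sum.distrib \<nu>h_def vH.scale_sum_right vH.scale_scale)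
    from \<alpha>c_indep[OF this] have co: "(if k = j then t else 0) + t' * of_int (\<epsilon> k * \<beta> $ k) = 0" for k .
    from co[of i] have "t' = 0" using i \<beta>_i \<gamma>_pos[of i] \<epsilon>_pos[of i] by simp
    with co[of j] t show ?thesis by simp
  qed
  \<comment> \<open>Induction on the height of the degree \<beta> of the image. Since \<psi>
    commutes with f_i, the induction hypothesis makes \<psi> x singular unless \<beta> is simple,
    the case just treated.\<close>
  have zero: "\<psi> x = 0" if "x \<in> dg" "x \<in> gs (\<beta> - \<gamma>)" "0 \<le> \<beta>" "\<beta> \<noteq> 0" for x \<beta>
    using that
  proof (induction "nat (ht \<beta>)" arbitrary: x \<beta> rule: less_induct)
    case less
    have \<psi>x: "\<psi> x \<in> gs \<beta>" using homogeneous_gs[OF c hom less.prems(1,2)] by simp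
    show ?case
    proof (cases "\<exists>i. \<beta> = axis i 1")
      case True
      then show ?thesis using simple less.prems by blast
    next
      case False
      have "b (f i) (\<psi> x) = 0" for i
      proof (cases "0 \<le> \<beta> - axis i 1")
        case True
        have ne: "\<beta> - axis i 1 \<noteq> 0" using False by auto
        have "b (f i) x \<in> gs (\<beta> - axis i 1 - \<gamma>)"
          using gs_b[OF gs_gens(2) less.prems(2), of i] by (simp add: algebra_simps)
        then have "\<psi> (b (f i) x) = 0"
          by (intro less.hyps[of "\<beta> - axis i 1"]) (use ht_pos[OF less.prems(3,4)] True ne in auto)
        then show ?thesis using cenD(4)[OF c, of "f i" x] less.prems(1) by simp
      next
        case neg: False
        \<comment> \<open>This degree then has mixed sign, so its root space is 0: the bound would
          leave only \<beta> = 0 and \<beta> = \<alpha>_i, both excluded.\<close>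
        have "\<not> \<beta> - axis i 1 \<le> 0"
        proof
          assume le: "\<beta> - axis i 1 \<le> 0"
          have le': "\<beta> $ k - axis i 1 $ k \<le> 0" and ge: "0 \<le> \<beta> $ k" for k
            using le less.prems(3) by (simp_all add: less_eq_vec_def)
          have "\<beta> $ k = axis i (\<beta> $ i) $ k" for k
            using le'[of k] ge[of k] by (cases "k = i") (simp_all add: axis_def)
          then have eq: "\<beta> = axis i (\<beta> $ i)" unfolding vec_eq_iff by (rule allI)
          have "\<beta> $ i = 0 \<or> \<beta> $ i = 1" using le'[of i] ge[of i] by (simp add: axis_def) linarith
          then show False
          proof
            assume "\<beta> $ i = 0"
            then have "axis i (\<beta> $ i) = (0 :: int^'n)" by (simp add: vec_eq_iff axis_def)
            with eq less.prems(4) show False by simp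
          next
            assume "\<beta> $ i = 1"
            then have "axis i (\<beta> $ i) = (axis i 1 :: int^'n)" by (rule arg_cong)
            with eq have "\<beta> = axis i 1" by (rule HOL.trans)
            with False show False by blast
          qed
        qed
        moreover have "b (f i) (\<psi> x) \<in> gs (\<beta> - axis i 1)"
          using gs_b[OF gs_gens(2) \<psi>x, of i] by simp
        ultimately show ?thesis using gs_eq_0 neg by blast
      qed
      then show ?thesis using no_singular_vectors[OF \<psi>x less.prems(3,4)] by blast
    qed
  qed
  show ?thesis
    by (rule zero[of _ "axis j 1 + \<gamma>"]) (use \<gamma>(1) axis_add_nonneg[of \<gamma> j] in auto)
qed

end

section \<open>Scalars on the derived algebra, and its centralizer\<close>

context kac_moody
begin

text \<open>Matrices without null vector may fail to be symmetrizable, so a cobracket is postulated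
  only in the presence of a nonnegative null vector. Each use has one at hand: up to sign, the
  degree of a centroid element or of a component of the centralizer.\<close>

context
  assumes cobracket: "\<And>\<gamma>. 0 \<le> \<gamma> \<Longrightarrow> \<gamma> \<noteq> 0 \<Longrightarrow> (\<And>i. pairing i \<gamma> = 0) \<Longrightarrow>
    \<exists>\<epsilon> \<delta>. kac_moody_cobracket s b sH \<alpha> \<alpha>c a Hm e f \<epsilon> \<delta>"
begin

lemma no_homogeneous:
  assumes c: "cen \<psi>" and hom: "homogeneous \<psi> \<gamma>" and ne: "\<gamma> \<noteq> 0"
  shows "\<psi> (e j) = 0"
proof (rule ccontr)
  assume j: "\<psi> (e j) \<noteq> 0"
  note deg = homogeneous_degree[OF c hom j]
  consider "0 \<le> \<gamma>" | "0 \<le> - \<gamma>" using deg(2) by (auto simp: vec_0_le_uminus)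
  then show False
  proof cases
    case 1
    then obtain \<epsilon> \<delta> where "kac_moody_cobracket s b sH \<alpha> \<alpha>c a Hm e f \<epsilon> \<delta>"
      using cobracket ne deg(1) by blast
    then interpret kac_moody_cobracket s b sH \<alpha> \<alpha>c a Hm e f \<epsilon> \<delta> .
    show False using no_homogeneous_pos[OF c hom 1 ne deg(1)] j by simp
  next
    case 2
    then obtain \<epsilon> \<delta> where "kac_moody_cobracket s b sH \<alpha> \<alpha>c a Hm e f \<epsilon> \<delta>"
      using cobracket[of "- \<gamma>"] ne deg(1) by auto
    then interpret kac_moody_cobracket s b sH \<alpha> \<alpha>c a Hm e f \<epsilon> \<delta> .
    interpret sw: kac_moody_cobracket s b sH \<alpha> \<alpha>c a "\<lambda>h. - Hm h" f e \<epsilon> "\<lambda>x. - \<delta> x"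
      by (rule swap_cobracket)
    have dg: "sw.dg = dg" using sw.derived_eq_dg derived_eq_dg by simp
    have c': "sw.cen \<psi>" using c by (simp add: cen_def sw.cen_def dg)
    have "sw.homogeneous \<psi> (- \<gamma>)" unfolding sw.homogeneous_def
    proof (intro allI ballI)
      fix h x assume "x \<in> sw.dg"
      then have x: "x \<in> dg" by (simp add: dg)
      have "b (Hm h) (\<psi> x) = \<psi> (b (Hm h) x) + s (wt \<gamma> h) (\<psi> x)" using hom x by (simp add: homogeneous_def)
      then show "b (- Hm h) (\<psi> x) = \<psi> (b (- Hm h) x) + s (wt (- \<gamma>) h) (\<psi> x)"
        by (simp add: b_minus cen_minus[OF c])
    qed
    from sw.no_homogeneous_pos[OF c' this 2] have f0: "\<psi> (f j) = 0" using ne deg(1) by simp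
    from sw.cen_eq_0[OF c' f0, of "e j"] j show False by (simp add: dg)
  qed
qed

lemma cen_scalar: assumes c: "cen \<psi>" shows "\<exists>t. \<forall>x\<in>dg. \<psi> x = s t x"
proof -
  fix j :: 'n
  have "pr \<beta> (\<psi> (e j)) = 0" if "\<beta> \<noteq> axis j 1" for \<beta>
    using homogeneous_component[OF c, of \<beta> j] no_homogeneous that by fastforce
  then have "\<psi> (e j) \<in> gs (axis j 1)" by (rule gs_if_pr_eq_0)
  then obtain t where t: "\<psi> (e j) = s t (e j)" using gs_simple by blast
  have "cen (\<lambda>x. \<psi> x - s t x)" using c
    by (auto simp: cen_def b_diff b_scale scale_right_distrib scale_right_diff_distrib mult.commute
        intro: subspace_diff[OF dg_subspace])
  from cen_eq_0[OF this, of j] t have "\<psi> x = s t x" if "x \<in> dg" for x using that by simp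
  then show ?thesis by blast
qed

text \<open>The homogeneous components of z are annihilated by e_i, f_i and the coroots as well. In
  nonzero degree such a component has null degree and is singular, hence 0; what remains lies in
  \<hh> and is killed by all simple roots. The lemma is why maps into the centralizer satisfy the
  centroid identity for brackets with all of \<gg>.\<close>

lemma centralizer_central:
  assumes z: "\<And>x. x \<in> dg \<Longrightarrow> b z x = 0" shows "b y z = 0"
proof -
  have z': "b x z = 0" if "x \<in> dg" for x using z[OF that] b_antisym[of x z] by simp
  have comp: "b x (pr \<beta> z) = 0" if "x \<in> dg" "x \<in> gs \<gamma>" for x \<beta> \<gamma>
    using pr_b[OF that(2), of \<beta> z] z'[OF that(1)] pr_same[of 0 0] by simp
  have ef0: "b (e i) (pr \<beta> z) = 0" "b (f i) (pr \<beta> z) = 0" for i \<beta>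
    using comp[OF dg_closed(6) gs_gens(1)] comp[OF dg_closed(7) gs_gens(2)] by auto
  have pr0: "pr \<beta> z = 0" if \<beta>: "\<beta> \<noteq> 0" for \<beta>
  proof (rule ccontr)
    assume ne: "pr \<beta> z \<noteq> 0"
    have "s (wt \<beta> (\<alpha>c i)) (pr \<beta> z) = 0" for i
      using comp[OF dg_closed(8) gs_gens(3), of i \<beta>] gsD[OF pr_gs, of "\<alpha>c i" \<beta> z] by simp
    then have null: "pairing i \<beta> = 0" for i using ne by (simp add: wt_\<alpha>c)
    consider "0 \<le> \<beta>" | "0 \<le> - \<beta>" using gs_eq_0[OF pr_gs[of \<beta> z]] ne by (auto simp: vec_0_le_uminus)
    then show False
    proof cases
      case 1
      then obtain \<epsilon> \<delta> where "kac_moody_cobracket s b sH \<alpha> \<alpha>c a Hm e f \<epsilon> \<delta>"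
        using cobracket \<beta> null by blast
      then interpret kac_moody_cobracket s b sH \<alpha> \<alpha>c a Hm e f \<epsilon> \<delta> .
      show False using no_singular_vectors[OF pr_gs 1 \<beta> ef0(2)] ne by simp
    next
      case 2
      then obtain \<epsilon> \<delta> where "kac_moody_cobracket s b sH \<alpha> \<alpha>c a Hm e f \<epsilon> \<delta>"
        using cobracket[of "- \<beta>"] \<beta> null by auto
      then interpret kac_moody_cobracket s b sH \<alpha> \<alpha>c a Hm e f \<epsilon> \<delta> .
      interpret sw: kac_moody_cobracket s b sH \<alpha> \<alpha>c a "\<lambda>h. - Hm h" f e \<epsilon> "\<lambda>x. - \<delta> x"
        by (rule swap_cobracket)
      have "pr \<beta> z \<in> sw.gs (- \<beta>)" by (simp add: swap_gs)
      from sw.no_singular_vectors[OF this 2] ef0(1) \<beta> ne show False by simp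
    qed
  qed
  then have "z \<in> gs 0" by (rule gs_if_pr_eq_0)
  then obtain h where h: "z = Hm h" using gs_0 by blast
  have \<alpha>0: "\<alpha> i h = 0" for i using z'[of "e i"] e_nonzero[of i] by (simp add: h eH)
  have "y \<in> {y. b y z = 0}"
  proof (rule generated)
    show "subspace {y. b y z = 0}" by (auto simp: subspace_def b_add b_scale)
    show "b v w \<in> {y. b y z = 0}" if "v \<in> {y. b y z = 0}" "w \<in> {y. b y z = 0}" for v w
      using that b_leibniz[of v w z] by simp
  qed (auto simp: h HH eH fH \<alpha>0)
  then show ?thesis by simp
qed

end

end

section \<open>Symmetrizability from a null vector and a path\<close>

lemma path_symmetrizable:
  fixes B :: "nat \<Rightarrow> nat \<Rightarrow> int" and g :: "nat \<Rightarrow> int" and N :: nat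
  defines "I \<equiv> {1..N}"
  assumes diag: "\<And>k. k \<in> I \<Longrightarrow> B k k = 2"
    and nonpos: "\<And>k l. k \<in> I \<Longrightarrow> l \<in> I \<Longrightarrow> k \<noteq> l \<Longrightarrow> B k l \<le> 0"
    and zero_sym: "\<And>k l. k \<in> I \<Longrightarrow> l \<in> I \<Longrightarrow> B k l = 0 \<Longrightarrow> B l k = 0"
    and path: "\<And>k. 1 \<le> k \<Longrightarrow> k < N \<Longrightarrow> B k (Suc k) \<noteq> 0"
    and g_pos: "\<And>k. k \<in> I \<Longrightarrow> 0 < g k"
    and null: "\<And>k. k \<in> I \<Longrightarrow> (\<Sum>l\<in>I. B k l * g l) = 0"
  shows "\<exists>\<epsilon>. (\<forall>k\<in>I. 0 < \<epsilon> k) \<and> (\<forall>k\<in>I. \<forall>l\<in>I. \<epsilon> k * B k l = \<epsilon> l * B l k)"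
proof -
  have up: "0 < - B k (Suc k)" "0 < - B (Suc k) k" if "1 \<le> k" "k < N" for k
    using path[OF that] nonpos[of k "Suc k"] nonpos[of "Suc k" k] zero_sym[of "Suc k" k] that
    by (auto simp: I_def less_le)
  show ?thesis
  \<comment> \<open>Without edges off the path the diagram is a tree and can be symmetrized
    outright. With a further edge, counting against the null vector forces the matrix itself to be
    symmetric.\<close>
  proof (cases "\<forall>k\<in>I. \<forall>l\<in>I. k < l \<longrightarrow> B k l \<noteq> 0 \<longrightarrow> l = Suc k")
    case True
    \<comment> \<open>Consecutive values must have ratio \<open>B k (Suc k)\<close> to
      \<open>B (Suc k) k\<close>; multiplying by all denominators along the path keeps \<epsilon>
      integral.\<close>
    define \<epsilon> where "\<epsilon> k = (\<Prod>t\<in>{1..<k}. - B t (Suc t)) * (\<Prod>t\<in>{k..<N}. - B (Suc t) t)" for k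
    have pos: "0 < \<epsilon> k" if "k \<in> I" for k
      unfolding \<epsilon>_def using that up by (intro mult_pos_pos prod_pos) (auto simp: I_def)
    have step: "\<epsilon> k * B k (Suc k) = \<epsilon> (Suc k) * B (Suc k) k" if k: "1 \<le> k" "k < N" for k
    proof -
      have "{1..<Suc k} = insert k {1..<k}" "{k..<N} = insert k {Suc k..<N}" using k by auto
      then show ?thesis by (simp add: \<epsilon>_def)
    qed
    have "\<epsilon> k * B k l = \<epsilon> l * B l k" if "k \<in> I" "l \<in> I" "k < l" for k l
    proof (cases "B k l = 0")
      case True
      then show ?thesis using zero_sym that by simp
    next
      case False
      then have "l = Suc k" using True that by blast
      then show ?thesis using step[of k] that by (simp add: I_def)
    qed
    then have "\<epsilon> k * B k l = \<epsilon> l * B l k" if "k \<in> I" "l \<in> I" for k l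
      using that by (cases k l rule: linorder_cases) auto
    with pos show ?thesis by blast
  next
    case False
    then obtain p q where pq: "p \<in> I" "q \<in> I" "p < q" "B p q \<noteq> 0" "q \<noteq> Suc p" by blast
    \<comment> \<open>Scaling by g turns the null vector into the all-ones vector, so off the
      diagonal every row of T sums to 2. For an edge, T k l * T l k = B k l * B l k \<ge> 1, so by
      the arithmetic-geometric mean it carries at least 2 of the total 2 N.\<close>
    define T :: "nat \<Rightarrow> nat \<Rightarrow> real" where "T k l = - (of_int (B k l) * of_int (g l) / of_int (g k))" for k l
    define w where "w x = T (fst x) (snd x) + T (snd x) (fst x)" for x
    define P where "P = {(k, l). k \<in> I \<and> l \<in> I \<and> k < l}"
    have finP: "finite P" by (rule finite_subset[of _ "I \<times> I"]) (auto simp: P_def I_def)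
    have T_nonneg: "0 \<le> T k l" if "k \<in> I" "l \<in> I" "k \<noteq> l" for k l
      using nonpos[OF that] g_pos[OF that(1)] g_pos[OF that(2)]
      by (simp add: T_def divide_nonpos_pos mult_nonpos_nonneg)
    have w_nonneg: "0 \<le> w x" if "x \<in> P" for x
      using that T_nonneg by (auto simp: P_def w_def)
    have TT: "T k l * T l k = of_int (B k l * B l k)" if "k \<in> I" "l \<in> I" for k l
      using g_pos[OF that(1)] g_pos[OF that(2)] by (simp add: T_def)
    have edge: "1 \<le> T k l * T l k" if "(k, l) \<in> P" "B k l \<noteq> 0" for k l
    proof -
      have "k \<in> I" "l \<in> I" "k \<noteq> l" using that by (auto simp: P_def)
      moreover from this have "B l k \<noteq> 0" using zero_sym[of l k] that(2) by blast
      ultimately have "0 < B k l * B l k"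
        using that(2) nonpos[of k l] nonpos[of l k] by (intro mult_neg_neg) (auto simp: less_le)
      then have "1 \<le> B k l * B l k" by simp
      then show ?thesis using TT[OF \<open>k \<in> I\<close> \<open>l \<in> I\<close>] by (metis of_int_1_le_iff)
    qed
    have w_ge: "2 \<le> w (k, l)" if "(k, l) \<in> P" "B k l \<noteq> 0" for k l
    proof -
      have "0 \<le> T k l" "0 \<le> T l k" using that T_nonneg by (auto simp: P_def)
      then have "sqrt (T k l * T l k) \<le> (T k l + T l k) / 2" by (rule arith_geo_mean_sqrt)
      from order_trans[OF real_sqrt_ge_one[OF edge[OF that]] this] show ?thesis
        by (simp add: w_def)
    qed
    have total: "(\<Sum>x\<in>P. w x) = 2 * of_nat N"
    proof -
      have row: "(\<Sum>l\<in>I - {k}. T k l) = 2" if k: "k \<in> I" for k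
      proof -
        have "(\<Sum>l\<in>I. T k l) = - (of_int (\<Sum>l\<in>I. B k l * g l) / of_int (g k))"
          by (simp add: T_def sum_negf sum_divide_distrib)
        also have "\<dots> = 0" by (simp add: null[OF k])
        finally have "(\<Sum>l\<in>I. T k l) = 0" .
        moreover have "T k k = - 2" using g_pos[OF k] by (simp add: T_def diag[OF k])
        moreover have "(\<Sum>l\<in>I. T k l) = T k k + (\<Sum>l\<in>I - {k}. T k l)"
          using k by (intro sum.remove) (auto simp: I_def)
        ultimately show ?thesis by simp
      qed
      have "2 * of_nat N = (\<Sum>k\<in>I. (2 :: real))" by (simp add: I_def)
      also have "\<dots> = (\<Sum>k\<in>I. \<Sum>l\<in>I - {k}. T k l)"
        by (rule sum.cong[OF HOL.refl]) (rule row[symmetric])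
      also have "\<dots> = (\<Sum>x\<in>Sigma I (\<lambda>k. I - {k}). T (fst x) (snd x))"
        by (subst sum.Sigma) (auto simp: I_def case_prod_beta)
      also have "Sigma I (\<lambda>k. I - {k}) = P \<union> prod.swap ` P" by (auto simp: P_def image_iff)
      also have "(\<Sum>x\<in>P \<union> prod.swap ` P. T (fst x) (snd x)) =
          (\<Sum>x\<in>P. T (fst x) (snd x)) + (\<Sum>x\<in>prod.swap ` P. T (fst x) (snd x))"
        by (intro sum.union_disjoint) (use finP in \<open>auto simp: P_def\<close>)
      also have "(\<Sum>x\<in>prod.swap ` P. T (fst x) (snd x)) = (\<Sum>x\<in>P. T (snd x) (fst x))"
        by (subst sum.reindex) auto
      finally show ?thesis by (simp add: w_def sum.distrib)
    qed
    text \<open>The \<open>N - 1\<close> path edges and the extra edge already account for the total \<open>2 N\<close>, so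
      equality holds in the arithmetic-geometric mean inequality for every edge.\<close>
    define S where "S = insert (p, q) ((\<lambda>k. (k, Suc k)) ` {1..<N})"
    have N: "1 \<le> N" using pq by (auto simp: I_def)
    have S: "S \<subseteq> P" using pq by (auto simp: S_def P_def I_def)
    have S_ge: "2 \<le> w x" if "x \<in> S" for x
    proof -
      have "x \<in> P" using that S by blast
      moreover have "B (fst x) (snd x) \<noteq> 0" using that pq path by (auto simp: S_def)
      ultimately show ?thesis using w_ge[of "fst x" "snd x"] by simp
    qed
    have finS: "finite S" by (simp add: S_def)
    have card_S: "card S = N"
    proof -
      have "(p, q) \<notin> (\<lambda>k. (k, Suc k)) ` {1..<N}" using pq(5) by auto
      moreover have "card ((\<lambda>k. (k, Suc k)) ` {1..<N}) = N - 1"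
        by (subst card_image) (auto simp: inj_on_def)
      ultimately show ?thesis using N by (simp add: S_def)
    qed
    have le2: "w x \<le> 2" if x: "x \<in> P" "B (fst x) (snd x) \<noteq> 0" for x
    proof (rule ccontr)
      assume "\<not> w x \<le> 2"
      have "2 * of_nat N < (\<Sum>y\<in>insert x S. w y)"
      proof (cases "x \<in> S")
        case True
        have "(\<Sum>y\<in>S. 2) < (\<Sum>y\<in>S. w y)"
          by (rule sum_strict_mono_ex1) (use finS S_ge True \<open>\<not> w x \<le> 2\<close> not_le in blast)+
        then show ?thesis using True by (simp add: card_S insert_absorb mult.commute)
      next
        case False
        have "(\<Sum>y\<in>S. 2) \<le> (\<Sum>y\<in>S. w y)" by (rule sum_mono) (rule S_ge)
        then show ?thesis using False \<open>\<not> w x \<le> 2\<close> finS by (simp add: card_S)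
      qed
      also have "\<dots> \<le> (\<Sum>y\<in>P. w y)"
        by (rule sum_mono2) (use finP S x w_nonneg in auto)
      finally show False using total by simp
    qed
    have sym: "B k l = B l k" if kl: "k \<in> I" "l \<in> I" "k < l" for k l
    proof (cases "B k l = 0")
      case True
      then show ?thesis using zero_sym kl by simp
    next
      case False
      have x: "(k, l) \<in> P" using kl by (simp add: P_def)
      have "T k l + T l k \<le> 2" using le2[OF x] False by (simp add: w_def)
      moreover have "1 \<le> T k l * T l k" by (rule edge[OF x False])
      moreover have "0 \<le> T k l" "0 \<le> T l k" using kl T_nonneg by auto
      moreover have "(T k l + T l k)\<^sup>2 - 4 * (T k l * T l k) = (T k l - T l k)\<^sup>2"
        by (simp add: power2_eq_square algebra_simps)
      moreover have "(T k l + T l k)\<^sup>2 \<le> 2\<^sup>2" using calculation by (intro power_mono) auto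
      ultimately have "T k l * T l k = 1"
        using zero_le_power2[of "T k l - T l k"] by (simp only: power2_eq_square)
      then have "B k l * B l k = 1" using TT[OF kl(1,2)] by (metis of_int_eq_1_iff)
      then show ?thesis using zmult_eq_1_iff by auto
    qed
    then have "B k l = B l k" if "k \<in> I" "l \<in> I" for k l
      using that by (cases k l rule: linorder_cases) auto
    then show ?thesis by (intro exI[of _ "\<lambda>_. 1"]) auto
  qed
qed

text \<open>Membership travels along the path down to its first vertex and then up again; the
  symmetric zero pattern allows both directions.\<close>

lemma indecomposable_connected:
  fixes A :: "int^'n::finite^'n"
  assumes gcm: "generalized_cartan_matrix A" and ind: "indecomposable_matrix A"
    and i: "i \<in> S" and S: "\<And>i j. i \<in> S \<Longrightarrow> A $ i $ j \<noteq> 0 \<Longrightarrow> j \<in> S"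
  shows "k \<in> S"
proof -
  obtain \<sigma> where \<sigma>: "bij_betw \<sigma> {1..CARD('n)} UNIV"
    and "(\<Prod>k = 1..<CARD('n). A $ \<sigma> k $ \<sigma> (k + 1)) \<noteq> 0"
    using ind unfolding indecomposable_matrix_def by blast
  then have path: "A $ \<sigma> m $ \<sigma> (Suc m) \<noteq> 0" if "1 \<le> m" "m < CARD('n)" for m
    using that by (auto simp: prod_zero_iff)
  have path': "A $ \<sigma> (Suc m) $ \<sigma> m \<noteq> 0" if "1 \<le> m" "m < CARD('n)" for m
    using path[OF that] gcm by (auto simp: generalized_cartan_matrix_def)
  have surj: "x \<in> \<sigma> ` {1..CARD('n)}" for x
    using \<sigma> by (simp add: bij_betw_def)
  obtain m where m: "i = \<sigma> m" "1 \<le> m" "m \<le> CARD('n)" using surj[of i] by auto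
  obtain l where l: "k = \<sigma> l" "1 \<le> l" "l \<le> CARD('n)" using surj[of k] by auto
  have down: "\<sigma> (m - d) \<in> S" if "d < m" for d
    using that
  proof (induction d)
    case (Suc d)
    have "A $ \<sigma> (Suc (m - Suc d)) $ \<sigma> (m - Suc d) \<noteq> 0"
      by (rule path') (use Suc.prems m in auto)
    then show ?case using Suc S by (simp add: Suc_diff_Suc)
  qed (use i m in simp)
  have up: "\<sigma> (1 + d) \<in> S" if "1 + d \<le> CARD('n)" for d
    using that
  proof (induction d)
    case 0
    show ?case using down[of "m - 1"] m by simp
  next
    case (Suc d)
    then show ?case using path[of "1 + d"] S by simp
  qed
  show ?thesis using up[of "l - 1"] l by simp
qed

lemma indecomposable_null_symmetrizable:
  fixes A :: "int^'n::finite^'n" and \<gamma> :: "int^'n"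
  assumes gcm: "generalized_cartan_matrix A" and ind: "indecomposable_matrix A"
    and \<gamma>: "\<And>i. 0 < \<gamma> $ i" "\<And>i. (\<Sum>j\<in>UNIV. A $ i $ j * \<gamma> $ j) = 0"
  shows "\<exists>\<epsilon>. (\<forall>i. 0 < \<epsilon> i) \<and> (\<forall>i j. \<epsilon> i * A $ i $ j = \<epsilon> j * A $ j $ i)"
proof -
  obtain \<sigma> where \<sigma>: "bij_betw \<sigma> {1..CARD('n)} UNIV"
    and prod: "(\<Prod>k = 1..<CARD('n). A $ \<sigma> k $ \<sigma> (k + 1)) \<noteq> 0"
    using ind unfolding indecomposable_matrix_def by blast
  have inj: "\<sigma> k = \<sigma> l \<longleftrightarrow> k = l" if "k \<in> {1..CARD('n)}" "l \<in> {1..CARD('n)}" for k l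
    using \<sigma> that by (meson bij_betw_def inj_on_eq_iff)
  have "\<exists>\<epsilon>. (\<forall>k\<in>{1..CARD('n)}. 0 < \<epsilon> k) \<and>
    (\<forall>k\<in>{1..CARD('n)}. \<forall>l\<in>{1..CARD('n)}. \<epsilon> k * A $ \<sigma> k $ \<sigma> l = \<epsilon> l * A $ \<sigma> l $ \<sigma> k)"
  proof (rule path_symmetrizable[where g = "\<lambda>k. \<gamma> $ \<sigma> k"])
    show "A $ \<sigma> k $ \<sigma> (Suc k) \<noteq> 0" if "1 \<le> k" "k < CARD('n)" for k
      using prod that by (auto simp: prod_zero_iff)
    show "(\<Sum>l\<in>{1..CARD('n)}. A $ \<sigma> k $ \<sigma> l * \<gamma> $ \<sigma> l) = 0" for k
      using sum.reindex_bij_betw[OF \<sigma>, of "\<lambda>j. A $ \<sigma> k $ j * \<gamma> $ j"] \<gamma>(2) by simp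
  qed (use gcm \<gamma>(1) inj in \<open>auto simp: generalized_cartan_matrix_def\<close>)
  then obtain \<epsilon> where \<epsilon>: "\<And>k. k \<in> {1..CARD('n)} \<Longrightarrow> 0 < \<epsilon> k"
    "\<And>k l. k \<in> {1..CARD('n)} \<Longrightarrow> l \<in> {1..CARD('n)} \<Longrightarrow> \<epsilon> k * A $ \<sigma> k $ \<sigma> l = \<epsilon> l * A $ \<sigma> l $ \<sigma> k"
    by blast
  define \<tau> where "\<tau> = inv_into {1..CARD('n)} \<sigma>"
  have \<tau>: "\<tau> i \<in> {1..CARD('n)}" "\<sigma> (\<tau> i) = i" for i
    using \<sigma> unfolding \<tau>_def bij_betw_def by (auto intro: inv_into_into f_inv_into_f simp del: atLeastAtMost_iff)
  show ?thesis
    using \<epsilon>(1)[OF \<tau>(1)] \<epsilon>(2)[OF \<tau>(1) \<tau>(1)] by (intro exI[of _ "\<lambda>i. \<epsilon> (\<tau> i)"]) (simp add: \<tau>(2))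
qed

section \<open>From the presentation to the locale, and the final theorem\<close>

lemma kac_moody_algebra_locale:
  fixes A :: "int^'n::finite^'n"
    and sH :: "'f::field_char_0 \<Rightarrow> 'h::ab_group_add \<Rightarrow> 'h"
    and \<iota> :: "('h, 'n) km_gen \<Rightarrow> 'g::ab_group_add"
  assumes gcm: "generalized_cartan_matrix A" and ind: "indecomposable_matrix A"
    and km: "kac_moody_algebra A sH \<alpha> \<alpha>c s b \<iota>"
  shows "kac_moody s b sH \<alpha> \<alpha>c (\<lambda>i j. A $ i $ j) (\<lambda>h. \<iota> (H h)) (\<lambda>i. \<iota> (E i)) (\<lambda>i. \<iota> (F i))"
proof -
  have re: "realization A sH \<alpha> \<alpha>c" and pr: "lie_presented_by s b \<iota> (km_relations A sH \<alpha> \<alpha>c)"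
    using km by (auto simp: kac_moody_algebra_def)
  have L: "lie_algebra s b" using pr by (simp add: lie_presented_by_def)
  interpret lie_algebra s b by (rule L)
  have vH: "vector_space sH" using re by (simp add: realization_def)
  interpret vH: vector_space sH by (rule vH)
  have vF: "vector_space ((*) :: 'f \<Rightarrow> 'f \<Rightarrow> 'f)" by unfold_locales (auto simp: algebra_simps)
  interpret vP: vector_space "pointwise_scale (*) :: 'f \<Rightarrow> ('h \<Rightarrow> 'f) \<Rightarrow> _"
    by (rule vector_space_pointwise_scale[OF vF])
  have rel: "lie_eval s b \<iota> t = lie_eval s b \<iota> u" if "(t, u) \<in> km_relations A sH \<alpha> \<alpha>c" for t u
    using pr lie_cong.rel[OF that] unfolding lie_presented_by_def by blast
  show ?thesis
  proof (rule kac_moody.intro[OF L], rule kac_moody_axioms.intro)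
    show "Vector_Spaces.linear sH s (\<lambda>h. \<iota> (H h))"
      unfolding Vector_Spaces.linear_iff
      using vH vector_space_axioms rel[OF km_relations.H_plus] rel[OF km_relations.H_scale] by simp
    show "\<iota> (H h) = 0 \<Longrightarrow> h = 0" for h by (rule kac_moody_H_eq_0[OF gcm km])
    show "Vector_Spaces.linear sH (*) (\<alpha> i)" "\<alpha> i (\<alpha>c j) = of_int (A $ j $ i)" for i j
      using re by (auto simp: realization_def)
    show "c i = 0" if "\<And>h. (\<Sum>i\<in>UNIV. c i * \<alpha> i h) = 0" for c i
    proof (rule ccontr)
      assume ne: "c i \<noteq> 0"
      have inj: "inj \<alpha>" using re by (simp add: realization_def)
      have "(\<Sum>v\<in>range \<alpha>. pointwise_scale (*) (c (inv \<alpha> v)) v) = (\<Sum>i\<in>UNIV. pointwise_scale (*) (c i) (\<alpha> i))"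
        by (subst sum.reindex[OF inj]) (simp add: inj)
      also have "\<dots> = 0"
      proof
        fix h
        have "(\<Sum>i\<in>B. pointwise_scale (*) (c i) (\<alpha> i)) h = (\<Sum>i\<in>B. c i * \<alpha> i h)" for B :: "'n set"
          by (induction B rule: infinite_finite_induct) (auto simp: pointwise_scale_def)
        then show "(\<Sum>i\<in>UNIV. pointwise_scale (*) (c i) (\<alpha> i)) h = 0 h" using that by simp
      qed
      finally have "vP.dependent (range \<alpha>)"
        unfolding vP.dependent_finite[OF finite_imageI[OF finite]]
        using ne inj by (intro exI[of _ "\<lambda>v. c (inv \<alpha> v)"]) auto
      then show False using re by (simp add: realization_def)
    qed
    show "c i = 0" if "(\<Sum>i\<in>UNIV. sH (c i) (\<alpha>c i)) = 0" for c i
    proof (rule ccontr)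
      assume ne: "c i \<noteq> 0"
      have inj: "inj \<alpha>c" using re by (simp add: realization_def)
      have "(\<Sum>v\<in>range \<alpha>c. sH (c (inv \<alpha>c v)) v) = (\<Sum>i\<in>UNIV. sH (c i) (\<alpha>c i))"
        by (subst sum.reindex[OF inj]) (simp add: inj)
      then have "vH.dependent (range \<alpha>c)"
        unfolding vH.dependent_finite[OF finite_imageI[OF finite]]
        using ne inj that by (intro exI[of _ "\<lambda>v. c (inv \<alpha>c v)"]) auto
      then show False using re by (simp add: realization_def)
    qed
    show "A $ i $ i = 2" "A $ i $ j = 0 \<Longrightarrow> A $ j $ i = 0" "i \<noteq> j \<Longrightarrow> A $ i $ j \<le> 0" for i j
      using gcm by (auto simp: generalized_cartan_matrix_def)
    show "k \<in> S" if "i \<in> S" "\<And>i j. i \<in> S \<Longrightarrow> A $ i $ j \<noteq> 0 \<Longrightarrow> j \<in> S" for i k S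
      by (rule indecomposable_connected[OF gcm ind that])
    show "b (\<iota> (H h)) (\<iota> (H h')) = 0" for h h'
      using rel[OF km_relations.HH] by simp
    show "b (\<iota> (H h)) (\<iota> (E i)) = s (\<alpha> i h) (\<iota> (E i))" for h i
      using rel[OF km_relations.HE] by simp
    show "b (\<iota> (H h)) (\<iota> (F i)) = s (- \<alpha> i h) (\<iota> (F i))" for h i
      using rel[OF km_relations.HF] by simp
    show "b (\<iota> (E i)) (\<iota> (F j)) = (if i = j then \<iota> (H (\<alpha>c i)) else 0)" for i j
      using rel[OF km_relations.EF_same, of i] rel[OF km_relations.EF_diff, of i j] by auto
    show "(b (\<iota> (E i)) ^^ nat (1 - A $ i $ j)) (\<iota> (E j)) = 0" if "i \<noteq> j" for i j
      using rel[OF km_relations.serre_E[OF that]] by (simp add: lie_eval_funpow_Bracket)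
    show "(b (\<iota> (F i)) ^^ nat (1 - A $ i $ j)) (\<iota> (F j)) = 0" if "i \<noteq> j" for i j
      using rel[OF km_relations.serre_F[OF that]] by (simp add: lie_eval_funpow_Bracket)
    show "x \<in> U" if U: "subspace U" "\<And>h. \<iota> (H h) \<in> U" "\<And>i. \<iota> (E i) \<in> U" "\<And>i. \<iota> (F i) \<in> U"
      "\<And>x y. x \<in> U \<Longrightarrow> y \<in> U \<Longrightarrow> b x y \<in> U" for U x
    proof -
      have "lie_eval s b \<iota> t \<in> U" for t
      proof (induction t)
        case (Gen x)
        show ?case using U(2-4) by (cases x) auto
      qed (use U in \<open>auto simp: subspace_def\<close>)
      moreover obtain t where "lie_eval s b \<iota> t = x"
        using pr unfolding lie_presented_by_def surj_def by metis
      ultimately show ?thesis by blast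
    qed
  qed
qed

text \<open>The universal property of the quotient. With it the second summand is handled as linear
  maps on \<gg>, without cosets.\<close>

lemma (in lie_algebra) quotient_hom_endos_eq:
  assumes W: "subspace W" and C: "subspace C"
  shows "quotient_hom_endos s W C = {\<eta>. (\<forall>x y. \<eta> (x + y) = \<eta> x + \<eta> y) \<and> (\<forall>c x. \<eta> (s c x) = s c (\<eta> x)) \<and>
    range \<eta> \<subseteq> C \<and> (\<forall>x\<in>W. \<eta> x = 0)}" (is "_ = ?R")
proof
  have coset: "coset_proj W x = coset_proj W y \<longleftrightarrow> x - y \<in> W" for x y
  proof
    assume "coset_proj W x = coset_proj W y"
    moreover have "x \<in> coset_proj W x" unfolding coset_proj_def using subspace_0[OF W] by force
    ultimately have "x \<in> (+) y ` W" by (simp add: coset_proj_def)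
    then show "x - y \<in> W" by auto
  next
    have sub: "coset_proj W x \<subseteq> coset_proj W y" if "x - y \<in> W" for x y
    proof
      fix z assume "z \<in> coset_proj W x"
      then obtain w where "w \<in> W" "z = x + w" by (auto simp: coset_proj_def)
      then have "z = y + ((x - y) + w)" "(x - y) + w \<in> W" using subspace_add[OF W that] by auto
      then show "z \<in> coset_proj W y" unfolding coset_proj_def by blast
    qed
    assume xy: "x - y \<in> W"
    then have "y - x \<in> W" using subspace_neg[OF W xy] by simp
    with xy show "coset_proj W x = coset_proj W y" using sub by blast
  qed
  show "quotient_hom_endos s W C \<subseteq> ?R"
  proof
    fix \<eta> assume "\<eta> \<in> quotient_hom_endos s W C"
    then obtain \<phi> where \<phi>: "\<phi> \<in> quotient_hom s W C" "\<eta> = \<phi> \<circ> coset_proj W"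
      by (auto simp: quotient_hom_endos_def)
    have lin: "\<eta> (x + y) = \<eta> x + \<eta> y" "\<eta> (s c x) = s c (\<eta> x)" for x y c
      using \<phi> by (auto simp: quotient_hom_def)
    have "range \<eta> \<subseteq> C" using \<phi> by (auto simp: quotient_hom_def)
    moreover have "\<eta> x = 0" if "x \<in> W" for x
    proof -
      have "coset_proj W x = coset_proj W 0" using that by (simp add: coset)
      then have "\<eta> x = \<eta> 0" by (simp add: \<phi>(2))
      then show ?thesis using lin(2)[of 0 0] by simp
    qed
    ultimately show "\<eta> \<in> ?R" using lin by blast
  qed
  show "?R \<subseteq> quotient_hom_endos s W C"
  proof
    fix \<eta> assume "\<eta> \<in> ?R"
    then have \<eta>: "\<And>x y. \<eta> (x + y) = \<eta> x + \<eta> y" "\<And>c x. \<eta> (s c x) = s c (\<eta> x)" "\<And>x. \<eta> x \<in> C"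
      "\<And>x. x \<in> W \<Longrightarrow> \<eta> x = 0" by auto
    define \<phi> where "\<phi> = restrict (\<lambda>K. \<eta> (SOME x. coset_proj W x = K)) (range (coset_proj W))"
    have \<phi>: "\<phi> (coset_proj W x) = \<eta> x" for x
    proof -
      define y where "y = (SOME y. coset_proj W y = coset_proj W x)"
      have "coset_proj W y = coset_proj W x" unfolding y_def by (rule someI[of _ x]) simp
      then have "y - x \<in> W" by (simp add: coset)
      then have "\<eta> ((y - x) + x) = \<eta> x" by (simp only: \<eta>(1,4)) simp
      then show ?thesis by (simp add: \<phi>_def y_def)
    qed
    have "\<phi> \<in> quotient_hom s W C"
      unfolding quotient_hom_def by (auto simp: \<phi> \<eta>(1-3)) (simp_all add: \<phi>_def)
    moreover have "\<eta> = \<phi> \<circ> coset_proj W" by (simp add: fun_eq_iff \<phi>)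
    ultimately show "\<eta> \<in> quotient_hom_endos s W C" unfolding quotient_hom_endos_def by blast
  qed
qed

theorem corollary3p5:
  fixes A :: "int^'n::finite^'n"
    and sH :: "'f::field_char_0 \<Rightarrow> 'h::ab_group_add \<Rightarrow> 'h"
    and \<alpha> :: "'n \<Rightarrow> 'h \<Rightarrow> 'f" and \<alpha>c :: "'n \<Rightarrow> 'h"
    and s :: "'f \<Rightarrow> 'g::ab_group_add \<Rightarrow> 'g" and b :: "'g \<Rightarrow> 'g \<Rightarrow> 'g"
    and \<iota> :: "('h, 'n) km_gen \<Rightarrow> 'g"
  assumes "generalized_cartan_matrix A"
    and "indecomposable_matrix A"
    and "kac_moody_algebra A sH \<alpha> \<alpha>c s b \<iota>"
  shows "central_lie_algebra s b (derived_algebra s b) \<and>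
    internal_direct_sum (pointwise_scale s)
      (lie_centroid s b UNIV)
      (scalar_endos s UNIV)
      (quotient_hom_endos s (derived_algebra s b)
        (lie_centralizer b (derived_algebra s b)))"
proof -
  interpret kac_moody s b sH \<alpha> \<alpha>c "\<lambda>i j. A $ i $ j" "\<lambda>h. \<iota> (H h)" "\<lambda>i. \<iota> (E i)" "\<lambda>i. \<iota> (F i)"
    by (rule kac_moody_algebra_locale[OF assms])
  have pr: "lie_presented_by s b \<iota> (km_relations A sH \<alpha> \<alpha>c)"
    using assms(3) by (simp add: kac_moody_algebra_def)
  have cobracket: "\<exists>\<epsilon> \<delta>. kac_moody_cobracket s b sH \<alpha> \<alpha>c (\<lambda>i j. A $ i $ j)
      (\<lambda>h. \<iota> (H h)) (\<lambda>i. \<iota> (E i)) (\<lambda>i. \<iota> (F i)) \<epsilon> \<delta>"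
    if \<gamma>: "0 \<le> \<gamma>" "\<gamma> \<noteq> 0" "\<And>i. pairing i \<gamma> = 0" for \<gamma>
  proof -
    have "\<exists>\<epsilon>. (\<forall>i. 0 < \<epsilon> i) \<and> (\<forall>i j. \<epsilon> i * A $ i $ j = \<epsilon> j * A $ j $ i)"
      by (rule indecomposable_null_symmetrizable[OF assms(1,2), of \<gamma>])
        (use null_full_support[OF \<gamma>] \<gamma>(3) in \<open>simp_all add: pairing_def\<close>)
    then obtain \<epsilon> where "\<forall>i. 0 < \<epsilon> i" "\<forall>i j. \<epsilon> i * A $ i $ j = \<epsilon> j * A $ j $ i" by blast
    then show ?thesis
      by (intro exI[of _ \<epsilon>] cobracket_exists[OF pr HOL.refl HOL.refl HOL.refl HOL.refl]) simp_all
  qed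
  interpret vP: vector_space "pointwise_scale s :: 'f \<Rightarrow> ('g \<Rightarrow> 'g) \<Rightarrow> _"
    by (rule vector_space_pointwise_scale) (rule vector_space_axioms)
  have scalar: "\<exists>t. \<forall>x\<in>dg. \<psi> x = s t x" if "cen \<psi>" for \<psi>
    by (rule cen_scalar[OF cobracket that])
  have central: "b y z = 0" if "z \<in> lie_centralizer b dg" for y z
    by (rule centralizer_central[OF cobracket]) (use that in \<open>auto simp: lie_centralizer_def\<close>)
  have C_subspace: "subspace (lie_centralizer b dg)"
    by (auto simp: subspace_def lie_centralizer_def b_add b_scale)
  let ?T = "quotient_hom_endos s dg (lie_centralizer b dg)"
  note T_eq = quotient_hom_endos_eq[OF dg_subspace C_subspace]

  have "lie_centroid s b dg = scalar_endos s dg"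
  proof
    show "lie_centroid s b dg \<subseteq> scalar_endos s dg"
    proof
      fix \<psi> assume \<psi>: "\<psi> \<in> lie_centroid s b dg"
      then have "cen \<psi>" by (auto simp: lie_centroid_def linear_endos_def cen_def)
      then obtain t where "\<forall>x\<in>dg. \<psi> x = s t x" using scalar by blast
      then have "\<psi> = restrict (s t) dg" using \<psi>
        by (auto simp: lie_centroid_def linear_endos_def fun_eq_iff restrict_def PiE_def extensional_def)
      then show "\<psi> \<in> scalar_endos s dg" by (auto simp: scalar_endos_def)
    qed
    show "scalar_endos s dg \<subseteq> lie_centroid s b dg"
      by (auto simp: scalar_endos_def lie_centroid_def linear_endos_def scale_right_distrib b_scale
          mult.commute)
  qed
  then have 1: "central_lie_algebra s b (derived_algebra s b)"
    by (simp add: central_lie_algebra_def derived_eq_dg)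

  have "restrict (s c) UNIV = s c" for c by (simp add: fun_eq_iff)
  then have S_eq: "scalar_endos s UNIV = range s" by (auto simp: scalar_endos_def)
  have S: "vP.subspace (range s)"
  proof (rule vP.subspaceI)
    show "0 \<in> range s" by (rule range_eqI[of _ _ 0]) auto
    show "x + y \<in> range s" if xy: "x \<in> range s" "y \<in> range s" for x y
    proof -
      obtain c d where "x = s c" "y = s d" using xy by blast
      then have "x + y = s (c + d)" by (auto simp: fun_eq_iff scale_left_distrib)
      then show ?thesis by blast
    qed
    show "pointwise_scale s c x \<in> range s" if x: "x \<in> range s" for c x
    proof -
      obtain d where "x = s d" using x by blast
      then have "pointwise_scale s c x = s (c * d)" by (auto simp: fun_eq_iff pointwise_scale_def)
      then show ?thesis by blast
    qed
  qed
  have T: "vP.subspace ?T"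
    unfolding T_eq
    by (rule vP.subspaceI) (auto simp: pointwise_scale_def scale_right_distrib mult.commute image_subset_iff
        intro: subspace_0[OF C_subspace] subspace_add[OF C_subspace] subspace_scale[OF C_subspace])
  have sum: "lie_centroid s b UNIV = {x + y | x y. x \<in> range s \<and> y \<in> ?T}"
  proof
    show "lie_centroid s b UNIV \<subseteq> {x + y | x y. x \<in> range s \<and> y \<in> ?T}"
    proof
      fix \<eta> assume "\<eta> \<in> lie_centroid s b UNIV"
      then have \<eta>: "\<And>x y. \<eta> (x + y) = \<eta> x + \<eta> y" "\<And>c x. \<eta> (s c x) = s c (\<eta> x)"
        "\<And>x y. \<eta> (b x y) = b x (\<eta> y)" by (auto simp: lie_centroid_def linear_endos_def)
      \<comment> \<open>Since \<eta> [v, w] = [v, \<eta> w] is again a bracket, \<eta> restricts to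
        the derived algebra, where it is a scalar.\<close>
      have "\<eta> x \<in> dg" if "x \<in> dg" for x
        using that unfolding derived_eq_dg[symmetric] derived_algebra_def
      proof (induction rule: span_induct_alt)
        case base
        show ?case using \<eta>(2)[of 0 0] by (simp add: span_zero)
      next
        case (step c x y)
        then obtain v w where x: "x = b v w" by blast
        have "\<eta> x \<in> span {b x y | x y. True}" unfolding x \<eta>(3) by (rule span_base) blast
        then show ?case using step.IH by (simp add: \<eta>(1,2) span_add span_scale)
      qed
      then have "cen \<eta>" by (simp add: cen_def \<eta>)
      then obtain t where t: "\<And>x. x \<in> dg \<Longrightarrow> \<eta> x = s t x" using scalar by blast
      define \<eta>' where "\<eta>' x = \<eta> x - s t x" for x
      have zero: "\<eta>' x = 0" if "x \<in> dg" for x using t[OF that] by (simp add: \<eta>'_def)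
      \<comment> \<open>The difference \<eta>' still satisfies the centroid identity and vanishes on
        brackets, so its values are central.\<close>
      have "b (\<eta>' y) x = 0" for x y
      proof -
        have "b x (\<eta>' y) = \<eta>' (b x y)" by (simp add: \<eta>'_def b_diff b_scale \<eta>(3))
        then show ?thesis using zero[of "b x y"] b_antisym[of "\<eta>' y" x] by simp
      qed
      then have "range \<eta>' \<subseteq> lie_centralizer b dg" by (auto simp: lie_centralizer_def)
      then have "\<eta>' \<in> ?T" unfolding T_eq
        using zero by (auto simp: \<eta>'_def \<eta> scale_right_distrib scale_right_diff_distrib mult.commute)
      moreover have "\<eta> = s t + \<eta>'" by (auto simp: fun_eq_iff \<eta>'_def)
      ultimately show "\<eta> \<in> {x + y | x y. x \<in> range s \<and> y \<in> ?T}" by blast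
    qed
    show "{x + y | x y. x \<in> range s \<and> y \<in> ?T} \<subseteq> lie_centroid s b UNIV"
    proof
      fix \<eta> assume "\<eta> \<in> {x + y | x y. x \<in> range s \<and> y \<in> ?T}"
      then obtain t \<eta>' where \<eta>: "\<eta> = s t + \<eta>'" and \<eta>': "\<eta>' \<in> ?T" by blast
      from \<eta>' have *: "\<And>x y. \<eta>' (x + y) = \<eta>' x + \<eta>' y" "\<And>c x. \<eta>' (s c x) = s c (\<eta>' x)"
        "\<And>x. \<eta>' x \<in> lie_centralizer b dg" "\<And>x. x \<in> dg \<Longrightarrow> \<eta>' x = 0" unfolding T_eq by auto
      show "\<eta> \<in> lie_centroid s b UNIV"
        unfolding \<eta> lie_centroid_def linear_endos_def
        by (auto simp: * scale_right_distrib b_add b_scale mult.commute central[OF *(3)])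
    qed
  qed
  have int: "range s \<inter> ?T = {0}"
  proof
    show "range s \<inter> ?T \<subseteq> {0}"
    proof
      fix \<eta> assume "\<eta> \<in> range s \<inter> ?T"
      then have "\<eta> \<in> range s" and T: "\<eta> \<in> ?T" by (rule IntD1, rule IntD2)
      then obtain t where t: "\<eta> = s t" by blast
      fix i
      have "\<eta> (\<iota> (E i)) = 0" using T dg_closed(6)[of i] unfolding T_eq by simp
      then have "t = 0" using e_nonzero[of i] by (simp add: t)
      then show "\<eta> \<in> {0}" by (simp add: t fun_eq_iff)
    qed
    show "{0} \<subseteq> range s \<inter> ?T"
      using vP.subspace_0[OF S] vP.subspace_0[OF T] by simp
  qed
  have "internal_direct_sum (pointwise_scale s) (lie_centroid s b UNIV) (scalar_endos s UNIV) ?T"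
    unfolding internal_direct_sum_def S_eq using S T sum int by (intro conjI)
  with 1 show ?thesis by (simp add: derived_eq_dg)
qed

end
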